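(* Let $n\geqslant 1$ be an integer, let $\ell>-1$ and $\mu,\nu^2\geqslant 0$ be real numbers such that $\delta\doteq(\mu-1)^2-4\nu^2\geqslant 0$. Let $p$ satisfy $$1<p<\max\left\{p_{\mathrm{Str}}\!\left(n+\tfrac{\mu}{\ell+1},\ell\right),\ p_{\mathrm{Fuj}}\!\left((\ell+1)n+\tfrac{\mu-1}{2}-\tfrac{\sqrt{\delta}}{2}\right)\right\}.$$ Let $u_0,u_1\in L^1_{\mathrm{loc}}(\mathbb{R}^n)$ be nonnegative, nontrivial and compactly supported functions with supports contained in $B_R$ for some $R>0$, such that $$u_1+\tfrac{\mu-1-\sqrt{\delta}}{2}\,u_0\geqslant 0.$$ For $\varepsilon>0$, let $u\in\mathcal{C}\big([1,T),W^{1,1}_{\mathrm{loc}}(\mathbb{R}^n)\big)\cap \mathcal{C}^1\big([1,T),L^{1}_{\mathrm{loc}}(\mathbb{R}^n)\big)\cap L^p_{\mathrm{loc}}\big((1,T)\times \mathbb{R}^n\big)$ be a weak solution, with lifespan $T=T(\varepsilon)$, to the Cauchy problem $$\begin{cases}\partial_t^2u-t^{2\ell}\Delta u+\mu t^{-1}\partial_t u+\nu^2t^{-2}u=|u|^p, & x\in\mathbb{R}^n,\ t>1,\\ u(1,x)=\varepsilon u_0(x), & x\in\mathbb{R}^n,\\ \partial_tu(1,x)=\varepsilon u_1(x), & x\in\mathbb{R}^n.\end{cases}$$ Then there exists a constant $\varepsilon_0=\varepsilon_0(u_0,u_1,n,p,\ell,\mu,\nu^2,R)>0$ such that for any $\varepsilon\in(0,\varepsilon_0]$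 the weak solution $u$ blows up in finite time (i.e. $T(\varepsilon)<\infty$). Furthermore, there is a constant $C>0$ independent of $\varepsilon$ such that, for any $\varepsilon\in(0,\varepsilon_0]$, the following upper bounds for the lifespan hold: $$T(\varepsilon)\leqslant\begin{cases} C\,\varepsilon^{-\frac{p(p-1)}{\theta(n,\ell,\mu,p)}} & \text{if } p<p_{\mathrm{Str}}\big(n+\tfrac{\mu}{\ell+1},\ell\big),\\[4pt] C\,\varepsilon^{-\left(\frac{2}{p-1}-\left((\ell+1)n+\frac{\mu-1}{2}-\frac{\sqrt{\delta}}{2}\right)\right)^{-1}} & \text{if } p<p_{\mathrm{Fuj}}\big((\ell+1)n+\tfrac{\mu-1}{2}-\tfrac{\sqrt{\delta}}{2}\big),\end{cases}$$ where $$\theta(n,\ell,\mu,p)\doteq \ell+1+\Big(\tfrac{n+1}{2}(\ell+1)+\tfrac{\mu-3\ell}{2}\Big)p-\Big(\tfrac{n-1}{2}(\ell+1)+\tfrac{\ell+\mu}{2}\Big)p^2.$$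
   Context: Notation. $B_\rho$ is the ball in $\mathbb{R}^n$ of radius $\rho$ centred at the origin. $\phi_\ell(t)\doteq \frac{t^{\ell+1}}{\ell+1}$. Fujita exponent: $p_{\mathrm{Fuj}}(k)\doteq 1+\frac{2}{k}$ for real $k>0$, with the convention $p_{\mathrm{Fuj}}(k)=\infty$ for $k\leqslant 0$. Strauss-type exponent: for real $d$, $p_{\mathrm{Str}}(d,\ell)$ is the biggest root of the quadratic equation in $p$ $$\left(\tfrac{d-1}{2}+\tfrac{\ell}{2(\ell+1)}\right)p^2-\left(\tfrac{d+1}{2}-\tfrac{3\ell}{2(\ell+1)}\right)p-1=0$$ (read as a linear equation if the leading coefficient vanishes). Thus $p_{\mathrm{Str}}\big(n+\tfrac{\mu}{\ell+1},\ell\big)$ is the biggest root of $$\Big(\tfrac{n-1}{2}(\ell+1)+\tfrac{\ell+\mu}{2}\Big)p^2-\Big(\tfrac{n+1}{2}(\ell+1)+\tfrac{\mu-3\ell}{2}\Big)p-(\ell+1)=0.$$ Weak solution. Let $u_0,u_1\in L^1_{\mathrm{loc}}(\mathbb{R}^n)$ with supports contained in $B_R$. A function $u\in\mathcal{C}([1,T),W^{1,1}_{\mathrm{loc}}(\mathbb{R}^n))\cap\mathcal{C}^1([1,T),L^1_{\mathrm{loc}}(\mathbb{R}^n))\cap L^p_{\mathrm{loc}}((1,T)\times\mathbb{R}^n)$ is a weak solution of the Cauchy problem on $[1,T)$ if $u(1,\cdot)=\varepsilon u_0$ in $L^1_{\mathrm{loc}}(\mathbb{R}^n)$, the support condition $\mathrm{supp}\,u(t,\cdot)\subset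 B_{R+\phi_\ell(t)-\phi_\ell(1)}$ holds for any $t\in(1,T)$, and $$\begin{aligned}&\int_{\mathbb{R}^n}\partial_tu(t,x)\phi(t,x)\,\mathrm{d}x+\int_1^t\int_{\mathbb{R}^n}\big(-\partial_tu(s,x)\phi_s(s,x)+s^{2\ell}\nabla u(s,x)\cdot\nabla\phi(s,x)\big)\mathrm{d}x\,\mathrm{d}s\\&\quad+\int_1^t\int_{\mathbb{R}^n}\big(\mu s^{-1}\partial_tu(s,x)\phi(s,x)+\nu^2s^{-2}u(s,x)\phi(s,x)\big)\mathrm{d}x\,\mathrm{d}s\\&=\varepsilon\int_{\mathbb{R}^n}u_1(x)\phi(1,x)\,\mathrm{d}x+\int_1^t\int_{\mathbb{R}^n}|u(s,x)|^p\phi(s,x)\,\mathrm{d}x\,\mathrm{d}s\end{aligned}$$ holds for any $t\in(1,T)$ and any test function $\phi\in\mathcal{C}^\infty_0([1,T)\times\mathbb{R}^n)$. Lifespan. $T=T(\varepsilon)\in(1,\infty]$ denotes the maximal existence time of the weak solution; an upper bound for $T(\varepsilon)$ means that whenever $u$ is a weak solution on $[1,T)$, the number $T$ obeys that bound. *)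

theory Defs
  imports "HOL-Analysis.Analysis"
begin

subsection \<open>Exponents\<close>

definition phi_speed :: "real \<Rightarrow> real \<Rightarrow> real" where
  "phi_speed l t = t powr (l + 1) / (l + 1)"

definition pFuj :: "real \<Rightarrow> ereal" where
  "pFuj k = (if k > 0 then ereal (1 + 2 / k) else \<infinity>)"

text \<open>The set of roots is always finite, since the constant term is \<open>-1\<close>. It is nonempty for
  \<open>d = n + \<mu> / (l + 1)\<close> with \<open>n \<ge> 1\<close>, \<open>l > -1\<close>, \<open>\<mu> \<ge> 0\<close>, the only arguments that are used.\<close>

definition pStr :: "real \<Rightarrow> real \<Rightarrow> real" where
  "pStr d l = Max {q. ((d - 1) / 2 + l / (2 * (l + 1))) * q\<^sup>2
                   - ((d + 1) / 2 - 3 * l / (2 * (l + 1))) * q - 1 = 0}"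

definition theta :: "nat \<Rightarrow> real \<Rightarrow> real \<Rightarrow> real \<Rightarrow> real" where
  "theta n l \<mu> p =
     l + 1 + ((real n + 1) / 2 * (l + 1) + (\<mu> - 3 * l) / 2) * p
     - ((real n - 1) / 2 * (l + 1) + (l + \<mu>) / 2) * p\<^sup>2"

subsection \<open>Test functions\<close>

text \<open>\<open>Ck_on k f U\<close> is meant for open \<open>U\<close>: all iterated partial derivatives of \<open>f\<close> up to order
  \<open>k\<close> exist and are continuous on \<open>U\<close>.\<close>

primrec Ck_on :: "nat \<Rightarrow> ('a::euclidean_space \<Rightarrow> real) \<Rightarrow> 'a set \<Rightarrow> bool" where
  "Ck_on 0 f U \<longleftrightarrow> continuous_on U f"
| "Ck_on (Suc k) f U \<longleftrightarrow> (\<forall>x\<in>U. f differentiable (at x)) \<and>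
     (\<forall>b\<in>Basis. Ck_on k (\<lambda>x. frechet_derivative f (at x) b) U)"

definition smooth_on :: "('a::euclidean_space \<Rightarrow> real) \<Rightarrow> 'a set \<Rightarrow> bool" where
  "smooth_on f U \<longleftrightarrow> (\<forall>k. Ck_on k f U)"

definition grad :: "(real ^ 'n \<Rightarrow> real) \<Rightarrow> real ^ 'n \<Rightarrow> real ^ 'n" where
  "grad f x = (\<chi> i. frechet_derivative f (at x) (axis i 1))"

definition test_function :: "(real ^ 'n \<Rightarrow> real) \<Rightarrow> bool" where
  "test_function \<psi> \<longleftrightarrow> smooth_on \<psi> UNIV \<and> compact (closure {x. \<psi> x \<noteq> 0})"

text \<open>The time interval \<open>[1,T)\<close>, where \<open>T = \<infinity>\<close> is allowed.\<close>

definition time_dom :: "ereal \<Rightarrow> real set" where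
  "time_dom T = {t. 1 \<le> t \<and> ereal t < T}"

text \<open>The class \<open>C\<^sub>0\<^sup>\<infinity>([1,T) \<times> \<real>\<^sup>n)\<close>. Smoothness up to the boundary \<open>t = 1\<close> means smoothness on an
  open neighbourhood. The support is taken in \<open>[1,T) \<times> \<real>\<^sup>n\<close>; it may meet \<open>t = 1\<close>, and the values
  of \<open>\<phi>\<close> outside \<open>[1,T) \<times> \<real>\<^sup>n\<close> are irrelevant.\<close>

definition spacetime_test_function :: "ereal \<Rightarrow> (real \<times> (real ^ 'n) \<Rightarrow> real) \<Rightarrow> bool" where
  "spacetime_test_function T \<phi> \<longleftrightarrow>
     (\<exists>U. open U \<and> time_dom T \<times> UNIV \<subseteq> U \<and> smooth_on \<phi> U) \<and>
     (let S = closure {z \<in> time_dom T \<times> UNIV. \<phi> z \<noteq> 0}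
      in compact S \<and> S \<subseteq> time_dom T \<times> UNIV)"

subsection \<open>Function spaces\<close>

text \<open>Elements of \<open>L\<^sup>1\<^sub>l\<^sub>o\<^sub>c\<close> are represented by functions, and all notions below are invariant
  under modification on a null set.\<close>

definition L1_loc :: "(real ^ 'n \<Rightarrow> 'b::euclidean_space) \<Rightarrow> bool" where
  "L1_loc f \<longleftrightarrow> (\<forall>K. compact K \<longrightarrow> f absolutely_integrable_on K)"

definition ess_support :: "(real ^ 'n \<Rightarrow> real) \<Rightarrow> (real ^ 'n) set" where
  "ess_support f = - \<Union>{U. open U \<and> (AE x in lebesgue. x \<in> U \<longrightarrow> f x = 0)}"

definition has_weak_gradient :: "(real ^ 'n \<Rightarrow> real) \<Rightarrow> (real ^ 'n \<Rightarrow> real ^ 'n) \<Rightarrow> bool" where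
  "has_weak_gradient f g \<longleftrightarrow> L1_loc f \<and> L1_loc g \<and>
     (\<forall>\<psi>. test_function \<psi> \<longrightarrow>
        (LINT x|lebesgue. f x *\<^sub>R grad \<psi> x) = - (LINT x|lebesgue. \<psi> x *\<^sub>R g x))"

text \<open>Continuity of curves refers to the topology given by the seminorms \<open>\<integral>\<^sub>K |f|\<close>, \<open>K\<close> compact.\<close>

definition cont_L1_loc :: "real set \<Rightarrow> (real \<Rightarrow> real ^ 'n \<Rightarrow> 'b::euclidean_space) \<Rightarrow> bool" where
  "cont_L1_loc I v \<longleftrightarrow> (\<forall>t\<in>I. L1_loc (v t)) \<and>
     (\<forall>t0\<in>I. \<forall>K. compact K \<longrightarrow>
        ((\<lambda>t. LINT x:K|lebesgue. norm (v t x - v t0 x)) \<longlongrightarrow> 0) (at t0 within I))"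

text \<open>\<open>v \<in> C(I, W\<^sup>1\<^sup>,\<^sup>1\<^sub>l\<^sub>o\<^sub>c)\<close>, with \<open>g t\<close> the weak gradient of \<open>v t\<close>.\<close>

definition cont_W11_loc ::
    "real set \<Rightarrow> (real \<Rightarrow> real ^ 'n \<Rightarrow> real) \<Rightarrow> (real \<Rightarrow> real ^ 'n \<Rightarrow> real ^ 'n) \<Rightarrow> bool" where
  "cont_W11_loc I v g \<longleftrightarrow>
     (\<forall>t\<in>I. has_weak_gradient (v t) (g t)) \<and> cont_L1_loc I v \<and> cont_L1_loc I g"

text \<open>\<open>v \<in> C\<^sup>1(I, L\<^sup>1\<^sub>l\<^sub>o\<^sub>c)\<close>, with derivative \<open>w\<close> (one-sided at an endpoint of \<open>I\<close>).\<close>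

definition C1_L1_loc ::
    "real set \<Rightarrow> (real \<Rightarrow> real ^ 'n \<Rightarrow> real) \<Rightarrow> (real \<Rightarrow> real ^ 'n \<Rightarrow> real) \<Rightarrow> bool" where
  "C1_L1_loc I v w \<longleftrightarrow> cont_L1_loc I v \<and> cont_L1_loc I w \<and>
     (\<forall>t0\<in>I. \<forall>K. compact K \<longrightarrow>
        ((\<lambda>t. LINT x:K|lebesgue. \<bar>(v t x - v t0 x) / (t - t0) - w t0 x\<bar>) \<longlongrightarrow> 0)
          (at t0 within I))"

text \<open>\<open>v \<in> L\<^sup>p\<^sub>l\<^sub>o\<^sub>c((1,T) \<times> \<real>\<^sup>n)\<close>. Joint measurability is required of the representative; every curve
  in \<open>C([1,T), L\<^sup>1\<^sub>l\<^sub>o\<^sub>c)\<close> has a jointly measurable representative.\<close>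

definition Lp_loc_spacetime :: "real \<Rightarrow> ereal \<Rightarrow> (real \<Rightarrow> real ^ 'n \<Rightarrow> real) \<Rightarrow> bool" where
  "Lp_loc_spacetime p T v \<longleftrightarrow>
     (\<forall>K. compact K \<and> K \<subseteq> {t. 1 < t \<and> ereal t < T} \<times> UNIV \<longrightarrow>
        (\<lambda>(t, x). v t x) \<in> borel_measurable (lebesgue_on K) \<and>
        (\<lambda>(t, x). \<bar>v t x\<bar> powr p) absolutely_integrable_on K)"

subsection \<open>Weak solutions\<close>

text \<open>The functions \<open>ut\<close> and \<open>gu\<close> are \<open>\<partial>\<^sub>t u\<close> and \<open>\<nabla>u\<close>; they are unique up to null sets at each
  time. Membership in \<open>L\<^sup>p\<^sub>l\<^sub>o\<^sub>c((1,T) \<times> \<real>\<^sup>n)\<close> does not control \<open>\<bar>u\<bar>\<^sup>p\<close> near \<open>t = 1\<close>. That the nonlinear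
  term in the integral identity is finite is part of the identity, but must be stated
  explicitly because the integral of a non-integrable function is \<open>0\<close> in HOL. The other
  integrals converge by the continuity assumptions.\<close>

definition weak_solution ::
    "real \<Rightarrow> real \<Rightarrow> real \<Rightarrow> real \<Rightarrow> real \<Rightarrow> (real ^ 'n \<Rightarrow> real) \<Rightarrow> (real ^ 'n \<Rightarrow> real) \<Rightarrow> real \<Rightarrow>
     ereal \<Rightarrow> (real \<Rightarrow> real ^ 'n \<Rightarrow> real) \<Rightarrow> bool" where
  "weak_solution l \<mu> \<nu> p R u0 u1 \<epsilon> T u \<longleftrightarrow> 1 < T \<and>
     (\<exists>ut gu.
        cont_W11_loc (time_dom T) u gu \<and>
        C1_L1_loc (time_dom T) u ut \<and>
        Lp_loc_spacetime p T u \<and>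
        (AE x in lebesgue. u 1 x = \<epsilon> * u0 x) \<and>
        (\<forall>t. 1 < t \<and> ereal t < T \<longrightarrow>
           ess_support (u t) \<subseteq> ball 0 (R + phi_speed l t - phi_speed l 1)) \<and>
        (\<forall>t \<phi>. 1 < t \<and> ereal t < T \<and> spacetime_test_function T \<phi> \<longrightarrow>
           (\<lambda>(s, x). \<bar>u s x\<bar> powr p * \<phi> (s, x)) absolutely_integrable_on ({1..t} \<times> UNIV) \<and>
           (LINT x|lebesgue. ut t x * \<phi> (t, x))
           + (LINT s:{1..t}|lebesgue. (LINT x|lebesgue.
                - ut s x * deriv (\<lambda>r. \<phi> (r, x)) s
                + s powr (2 * l) * (gu s x \<bullet> grad (\<lambda>y. \<phi> (s, y)) x)))
           + (LINT s:{1..t}|lebesgue. (LINT x|lebesgue.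
                \<mu> / s * ut s x * \<phi> (s, x) + \<nu>\<^sup>2 / s\<^sup>2 * u s x * \<phi> (s, x)))
           = \<epsilon> * (LINT x|lebesgue. u1 x * \<phi> (1, x))
             + (LINT s:{1..t}|lebesgue. (LINT x|lebesgue. \<bar>u s x\<bar> powr p * \<phi> (s, x)))))"

end

theory Submission
  imports Defs "HOL-Real_Asymp.Real_Asymp"
begin

text \<open>
  Let \<open>\<alpha>(t) \<Phi>(x) \<ge> 0\<close> solve the adjoint linear equation and multiply it by \<open>h(t/\<tau>)^k\<close>, where \<open>h\<close> is a smooth
  step that is \<open>1\<close> on \<open>(-\<infinity>, 1/2]\<close> and \<open>0\<close> on \<open>[1, \<infinity>)\<close> and \<open>2 \<le> \<tau> < T\<close>. Used as a test function, it bounds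
  \<open>\<epsilon>\<close> times a positive functional of the data by integrals of \<open>|u|\<close> over \<open>[\<tau>/2, \<tau>]\<close>, to which a weighted
  Young inequality applies.

  With \<open>\<Phi> = 1\<close> and \<open>\<alpha>(t) = t^(1+r)\<close>, \<open>r = (\<mu> - 1 - sqrt \<delta>)/2\<close> (or \<open>t^(1+r) ln(2\<tau>/t)\<close> when \<open>\<delta> = 0\<close>, since the
  data term of the pure power may then vanish), part of the integral of \<open>|u|^p\<close> is absorbed. This gives the
  Fujita-type bound, and also an upper bound \<open>A\<close> for the integral of \<open>|u|^p h(t/\<tau>)^k\<close> over \<open>[\<tau>/2, \<tau>]\<close>.

  With \<open>\<Phi>\<close> the radial solution of \<open>\<Delta>\<Phi> = \<Phi>\<close>, of size \<open>|x|^(-(n-1)/2) e^|x|\<close>, and \<open>\<alpha>\<close> the decaying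
  solution of the remaining ordinary differential equation (a modified Bessel function of the second kind in
  \<open>t^(l+1)/(l+1)\<close>), the same inequality bounds \<open>\<epsilon>^p\<close> by a power of \<open>\<tau>\<close> times that integral. Inserting the bound \<open>A\<close>
  gives the Strauss-type estimate without any iteration. Both estimates hold for all \<open>\<tau> < T\<close>, so one may take
  \<open>\<epsilon>0 = 1\<close>.
\<close>

subsection \<open>Smooth functions\<close>

text \<open>The exponential weight works because its two factors match on the support of
  \<open>u\<close>: for |x| up to \<open>R + phi_speed l t - phi_speed l 1\<close> the growth e^|x|
  of the spatial factor is undone by the decay exp(- \<open>phi_speed l t\<close>) of the time
  factor, and only powers of \<tau> survive. The integral of \<Phi>^q over such a ball,
  \<open>q = p / (p - 1)\<close>, is carried by a layer of bounded width along the sphere, which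
  decides how the dimension enters \<open>theta\<close>. The price is that the data functional has
  to be positive for the decaying time factor; this rests on a differential inequality for the
  Bessel function, 2 z m' < m. The power \<open>k \<ge> 2 * q\<close> of the step is forced by
  Young's inequality: two derivatives of h^k leave h^(k - 2), and division by the weight h^k that
  accompanies |u|^p leaves h^(k - 2 q), which must stay bounded. The bound \<open>A\<close> does not
  involve \<epsilon>, because the data term is nonnegative and may be dropped once part of the
  nonlinear term has been kept on the left. In the second estimate the parameter of Young's
  inequality is a power of \<tau> chosen to give both terms the same order; this balance produces
  the exponent with \<open>theta\<close>.\<close>

text \<open>Openness of \<open>U\<close> carries an equality on \<open>U\<close> over to the
  derivatives. The induction runs over all pairs of functions, since the step replaces both by their
  partial derivatives.\<close>

lemma Ck_on_cong:
  assumes "open U" "\<And>x. x \<in> U \<Longrightarrow> f x = g x"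
  shows "Ck_on k f U \<longleftrightarrow> Ck_on k g U"
  using assms(2)
proof (induction k arbitrary: f g)
  case 0
  then show ?case by (simp cong: continuous_on_cong)
next
  case (Suc k)
  have *: "Ck_on (Suc k) g U" if fg: "\<And>x. x \<in> U \<Longrightarrow> f x = g x" and f: "Ck_on (Suc k) f U" for f g :: "'a \<Rightarrow> real"
  proof -
    have d: "f differentiable at x" if "x \<in> U" for x using f that by simp
    have fd: "frechet_derivative g (at x) = frechet_derivative f (at x)" if "x \<in> U" for x
      using frechet_derivative_transform_within_open[OF d[OF that] assms(1) that] fg by metis
    have "g differentiable at x" if "x \<in> U" for x
      using d[OF that] fg that assms(1) unfolding differentiable_def
      by (meson has_derivative_transform_within_open)
    moreover have "Ck_on k (\<lambda>x. frechet_derivative g (at x) b) U" if "b \<in> Basis" for b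
      using f that Suc.IH[of "\<lambda>x. frechet_derivative g (at x) b" "\<lambda>x. frechet_derivative f (at x) b"] fd
      by simp
    ultimately show ?thesis by simp
  qed
  show ?case using *[of f g] *[of g f] Suc.prems by metis
qed

text \<open>\<open>frechet_derivative\<close> is defined by choice. This rule admits any explicit
  derivative in its place, so that smoothness proofs become computations with formulas.\<close>

lemma Ck_on_SucI:
  assumes "open U" "\<And>x. x \<in> U \<Longrightarrow> (f has_derivative f' x) (at x)"
    and "\<And>b. b \<in> Basis \<Longrightarrow> Ck_on k (\<lambda>x. f' x b) U"
  shows "Ck_on (Suc k) f U"
proof -
  have "frechet_derivative f (at x) = f' x" if "x \<in> U" for x
    using assms(2)[OF that] by (metis frechet_derivative_at)
  then have "Ck_on k (\<lambda>x. frechet_derivative f (at x) b) U" if "b \<in> Basis" for b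
    using Ck_on_cong[OF assms(1), of "\<lambda>x. frechet_derivative f (at x) b" "\<lambda>x. f' x b"] assms(3)[OF that] by simp
  then show ?thesis using assms(2) by (auto simp: differentiable_def)
qed

lemma Ck_on_SucD:
  assumes "Ck_on (Suc k) f U"
  shows "\<And>x. x \<in> U \<Longrightarrow> (f has_derivative frechet_derivative f (at x)) (at x)"
    and "\<And>b. b \<in> Basis \<Longrightarrow> Ck_on k (\<lambda>x. frechet_derivative f (at x) b) U"
  using assms by (auto simp: frechet_derivative_works)

lemma Ck_on_Suc_imp: "Ck_on (Suc k) f U \<Longrightarrow> Ck_on k f U"
proof (induction k arbitrary: f)
  case 0
  then have "f differentiable_on U"
    unfolding differentiable_on_def Ck_on.simps using differentiable_at_withinI by blast
  then show ?case by (simp add: differentiable_imp_continuous_on)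
next
  case (Suc k)
  have "Ck_on k (\<lambda>x. frechet_derivative f (at x) b) U" if "b \<in> Basis" for b
    using Ck_on_SucD(2)[OF Suc.prems that] by (rule Suc.IH)
  then show ?case using Suc.prems[unfolded Ck_on.simps(2)[of "Suc k" f U]] by (subst Ck_on.simps(2)) blast
qed

lemma Ck_on_const: "open U \<Longrightarrow> Ck_on k (\<lambda>x. c) U"
proof (induction k arbitrary: c)
  case (Suc k)
  then show ?case by (intro Ck_on_SucI[where f' = "\<lambda>x v. 0"]) auto
qed auto

lemma Ck_on_add:
  assumes "open U" "Ck_on k f U" "Ck_on k g U"
  shows "Ck_on k (\<lambda>x. f x + g x) U"
  using assms(2,3)
proof (induction k arbitrary: f g)
  case 0
  then show ?case by (simp add: continuous_on_add)
next
  case (Suc k)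
  show ?case
    using Suc.IH[OF Ck_on_SucD(2)[OF Suc.prems(1)] Ck_on_SucD(2)[OF Suc.prems(2)]]
    by (intro Ck_on_SucI[OF assms(1) has_derivative_add[OF Ck_on_SucD(1)[OF Suc.prems(1)] Ck_on_SucD(1)[OF Suc.prems(2)]]]) auto
qed

lemma Ck_on_mult:
  assumes "open U" "Ck_on k f U" "Ck_on k g U"
  shows "Ck_on k (\<lambda>x. f x * g x) U"
  using assms(2,3)
proof (induction k arbitrary: f g)
  case 0
  then show ?case by (simp add: continuous_on_mult)
next
  case (Suc k)
  show ?case
    by (intro Ck_on_SucI[OF assms(1) has_derivative_mult[OF Ck_on_SucD(1)[OF Suc.prems(1)] Ck_on_SucD(1)[OF Suc.prems(2)]]]
       Ck_on_add assms(1) Suc.IH Ck_on_Suc_imp[OF Suc.prems(1)] Ck_on_Suc_imp[OF Suc.prems(2)]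
       Ck_on_SucD(2)[OF Suc.prems(1)] Ck_on_SucD(2)[OF Suc.prems(2)]) auto
qed

lemma Ck_on_sum:
  assumes "open U" "finite I" "\<And>i. i \<in> I \<Longrightarrow> Ck_on k (f i) U"
  shows "Ck_on k (\<lambda>x. \<Sum>i\<in>I. f i x) U"
  using assms(2,3) by (induction I rule: finite_induct) (auto intro: Ck_on_add Ck_on_const assms(1))

lemma Ck_on_compose_linear:
  assumes "open U" "open V" "bounded_linear L" "L ` U \<subseteq> V" "Ck_on k f V"
  shows "Ck_on k (\<lambda>x. f (L x)) U"
  using assms(5)
proof (induction k arbitrary: f)
  case 0
  then show ?case using assms(4)
    by (auto intro!: continuous_on_compose2[OF _ linear_continuous_on[OF assms(3)]])
next
  case (Suc k)
  have "((\<lambda>x. f (L x)) has_derivative (\<lambda>v. frechet_derivative f (at (L x)) (L v))) (at x)" if "x \<in> U" for x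
    using Ck_on_SucD(1)[OF Suc.prems, of "L x"] assms(4) that
    by (intro has_derivative_compose[OF bounded_linear_imp_has_derivative[OF assms(3)]]) auto
  moreover have "Ck_on k (\<lambda>x. frechet_derivative f (at (L x)) (L v)) U" for v
  proof -
    \<comment> \<open>\<open>Ck_on\<close> controls basis directions only. Expanding
      \<open>L v\<close> in the basis turns the derivative into a combination of partial derivatives
      with constant coefficients.\<close>
    have "frechet_derivative f (at (L x)) (L v) = (\<Sum>c\<in>Basis. (L v \<bullet> c) * frechet_derivative f (at (L x)) c)"
      if "x \<in> U" for x
    proof -
      have "linear (frechet_derivative f (at (L x)))"
        using Ck_on_SucD(1)[OF Suc.prems, of "L x"] assms(4) that
        by (auto intro: has_derivative_linear)
      then show ?thesis
        by (subst (1) euclidean_representation[of "L v", symmetric], subst linear_sum)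
          (auto simp: linear_cmul)
    qed
    moreover have "Ck_on k (\<lambda>x. \<Sum>c\<in>Basis. (L v \<bullet> c) * frechet_derivative f (at (L x)) c) U"
      using Ck_on_SucD(2)[OF Suc.prems]
      by (intro Ck_on_sum Ck_on_mult Ck_on_const assms Suc.IH) auto
    ultimately show ?thesis using Ck_on_cong[OF assms(1)] by (metis (no_types, lifting))
  qed
  ultimately show ?case by (intro Ck_on_SucI[OF assms(1)])
qed

text \<open>By the chain rule a partial derivative is h' composed with \<open>g\<close>, times a
  partial derivative of \<open>g\<close>. The induction generalises over \<open>h\<close>, while
  \<open>g\<close> is merely lowered by one order.\<close>

lemma Ck_on_compose_real:
  fixes h :: "real \<Rightarrow> real"
  assumes "open U" "open I" "g ` U \<subseteq> I" "Ck_on k h I" "Ck_on k g U"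
  shows "Ck_on k (\<lambda>x. h (g x)) U"
  using assms(4,5)
proof (induction k arbitrary: h)
  case 0
  then show ?case using assms(3) continuous_on_compose2[of I h U g] by auto
next
  case (Suc k)
  have lin: "frechet_derivative h (at y) v = frechet_derivative h (at y) 1 * v" if "y \<in> I" for y v
    using linear_cmul[OF has_derivative_linear[OF Ck_on_SucD(1)[OF Suc.prems(1) that]], of v 1] by simp
  have "((\<lambda>x. h (g x)) has_derivative
      (\<lambda>v. frechet_derivative h (at (g x)) 1 * frechet_derivative g (at x) v)) (at x)" if "x \<in> U" for x
  proof -
    have gx: "g x \<in> I" using that assms(3) by auto
    have "frechet_derivative h (at (g x)) = (\<lambda>v. frechet_derivative h (at (g x)) 1 * v)"
      using lin[OF gx] by (rule ext)
    with Ck_on_SucD(1)[OF Suc.prems(1) gx]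
    have "(h has_derivative (\<lambda>v. frechet_derivative h (at (g x)) 1 * v)) (at (g x))" by simp
    from has_derivative_compose[OF Ck_on_SucD(1)[OF Suc.prems(2) that] this] show ?thesis .
  qed
  moreover have "Ck_on k (\<lambda>x. frechet_derivative h (at (g x)) 1 * frechet_derivative g (at x) b) U"
    if "b \<in> Basis" for b
  proof (rule Ck_on_mult[OF assms(1) Suc.IH Ck_on_SucD(2)[OF Suc.prems(2) that]])
    show "Ck_on k (\<lambda>y. frechet_derivative h (at y) 1) I"
      using Ck_on_SucD(2)[OF Suc.prems(1), of 1] by simp
    show "Ck_on k g U" using Suc.prems(2) by (rule Ck_on_Suc_imp)
  qed
  ultimately show ?case by (rule Ck_on_SucI[OF assms(1)])
qed

lemma Ck_on_real_SucI:
  fixes f :: "real \<Rightarrow> real"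
  assumes "open U" "\<And>x. x \<in> U \<Longrightarrow> (f has_real_derivative f' x) (at x)" "Ck_on k f' U"
  shows "Ck_on (Suc k) f U"
  using assms by (intro Ck_on_SucI[where f' = "\<lambda>x v. f' x * v"]) (auto simp: has_field_derivative_def)

lemma smooth_on_cong:
  assumes "open U" "\<And>x. x \<in> U \<Longrightarrow> f x = g x"
  shows "smooth_on f U \<longleftrightarrow> smooth_on g U"
  using Ck_on_cong[OF assms] by (auto simp: smooth_on_def)

lemma smooth_on_const: "open U \<Longrightarrow> smooth_on (\<lambda>x. c) U"
  by (simp add: smooth_on_def Ck_on_const)

lemma smooth_on_add: "open U \<Longrightarrow> smooth_on f U \<Longrightarrow> smooth_on g U \<Longrightarrow> smooth_on (\<lambda>x. f x + g x) U"
  by (simp add: smooth_on_def Ck_on_add)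

lemma smooth_on_mult: "open U \<Longrightarrow> smooth_on f U \<Longrightarrow> smooth_on g U \<Longrightarrow> smooth_on (\<lambda>x. f x * g x) U"
  by (simp add: smooth_on_def Ck_on_mult)

lemma smooth_on_diff: "open U \<Longrightarrow> smooth_on f U \<Longrightarrow> smooth_on g U \<Longrightarrow> smooth_on (\<lambda>x. f x - g x) U"
  using smooth_on_add[of U f "\<lambda>x. (-1) * g x"] smooth_on_mult[of U "\<lambda>x. -1" g] smooth_on_const[of U "-1"] by simp

lemma smooth_on_power: "open U \<Longrightarrow> smooth_on f U \<Longrightarrow> smooth_on (\<lambda>x. f x ^ k) U"
  by (induction k) (auto intro: smooth_on_const smooth_on_mult)

lemma smooth_on_sum:
  "open U \<Longrightarrow> finite I \<Longrightarrow> (\<And>i. i \<in> I \<Longrightarrow> smooth_on (f i) U) \<Longrightarrow> smooth_on (\<lambda>x. \<Sum>i\<in>I. f i x) U"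
  by (simp add: smooth_on_def Ck_on_sum)

lemma smooth_on_compose_linear:
  "open U \<Longrightarrow> open V \<Longrightarrow> bounded_linear L \<Longrightarrow> L ` U \<subseteq> V \<Longrightarrow> smooth_on f V \<Longrightarrow> smooth_on (\<lambda>x. f (L x)) U"
  unfolding smooth_on_def using Ck_on_compose_linear by blast

lemma smooth_on_compose_real:
  fixes h :: "real \<Rightarrow> real"
  shows "open U \<Longrightarrow> open I \<Longrightarrow> smooth_on h I \<Longrightarrow> smooth_on g U \<Longrightarrow> g ` U \<subseteq> I \<Longrightarrow> smooth_on (\<lambda>x. h (g x)) U"
  unfolding smooth_on_def using Ck_on_compose_real by blast

lemma smooth_on_subset:
  assumes "open U" "open V" "U \<subseteq> V" "smooth_on f V"
  shows "smooth_on f U"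
  using smooth_on_compose_linear[OF assms(1,2) bounded_linear_ident _ assms(4)] assms(3) by auto

lemma smooth_on_linear:
  fixes L :: "'a::euclidean_space \<Rightarrow> real"
  assumes "open U" "bounded_linear L"
  shows "smooth_on L U"
proof -
  have "Ck_on k L U" for k
  proof (cases k)
    case 0
    then show ?thesis using assms(2) by (simp add: linear_continuous_on)
  next
    case (Suc m)
    show ?thesis unfolding Suc using assms
      by (intro Ck_on_SucI[where f' = "\<lambda>x. L"] Ck_on_const bounded_linear_imp_has_derivative) auto
  qed
  then show ?thesis by (simp add: smooth_on_def)
qed

text \<open>A class of functions closed under differentiation on \<open>U\<close> consists of smooth
  functions: order \<open>k\<close> is reached by moving \<open>k\<close> times to another member of
  the class. It serves real powers and power series.\<close>

lemma smooth_on_real_coinduct: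
  fixes f :: "real \<Rightarrow> real"
  assumes "open U" "P f"
    and step: "\<And>f. P f \<Longrightarrow> \<exists>f'. P f' \<and> (\<forall>x\<in>U. (f has_real_derivative f' x) (at x))"
  shows "smooth_on f U"
proof -
  have "Ck_on k f U" if "P f" for k f
    using that
  proof (induction k arbitrary: f)
    case 0
    then obtain f' where "\<forall>x\<in>U. (f has_real_derivative f' x) (at x)" using step by blast
    then show ?case by (auto intro!: continuous_at_imp_continuous_on intro: DERIV_isCont)
  next
    case (Suc k)
    then obtain f' where f': "P f'" "\<forall>x\<in>U. (f has_real_derivative f' x) (at x)" using step by blast
    then show ?case using Suc.IH by (auto intro!: Ck_on_real_SucI[OF assms(1)] simp del: Ck_on.simps)
  qed
  then show ?thesis using assms(2) by (simp add: smooth_on_def)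
qed

lemma smooth_on_real_antideriv:
  fixes f :: "real \<Rightarrow> real"
  assumes "open U" "\<And>x. x \<in> U \<Longrightarrow> (f has_real_derivative f' x) (at x)" "smooth_on f' U"
  shows "smooth_on f U"
  unfolding smooth_on_def
proof
  fix k show "Ck_on k f U"
    using Ck_on_real_SucI[OF assms(1,2), of k] assms(3) Ck_on_Suc_imp by (auto simp: smooth_on_def simp del: Ck_on.simps)
qed

lemma smooth_on_imp_differentiable: "smooth_on f U \<Longrightarrow> x \<in> U \<Longrightarrow> f differentiable at x"
  unfolding smooth_on_def using Ck_on.simps(2)[of 0 f U] by blast

lemma smooth_on_imp_continuous_on: "smooth_on f U \<Longrightarrow> continuous_on U f"
  unfolding smooth_on_def using Ck_on.simps(1)[of f U] by blast

lemma smooth_on_frechet_derivative: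
  "smooth_on f U \<Longrightarrow> b \<in> Basis \<Longrightarrow> smooth_on (\<lambda>x. frechet_derivative f (at x) b) U"
  unfolding smooth_on_def using Ck_on.simps(2)[of _ f U] by blast

lemma smooth_on_real_derivative:
  fixes f :: "real \<Rightarrow> real"
  assumes "open U" "smooth_on f U"  "\<And>x. x \<in> U \<Longrightarrow> (f has_real_derivative f' x) (at x)"
  shows "smooth_on f' U"
proof -
  have "frechet_derivative f (at x) 1 = f' x" if "x \<in> U" for x
    using frechet_derivative_at[OF assms(3)[OF that, unfolded has_field_derivative_def]] by (metis mult.right_neutral)
  then show ?thesis
    using smooth_on_frechet_derivative[OF assms(2), of 1]
      smooth_on_cong[OF assms(1), of "\<lambda>x. frechet_derivative f (at x) 1" f'] by simp
qed

lemma smooth_on_powr: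
  shows "smooth_on (\<lambda>x::real. x powr a) {0<..}"
\<comment> \<open>The coefficient \<open>c\<close> belongs to the class because differentiation
  brings down the exponent.\<close>
proof (rule smooth_on_real_coinduct[where P = "\<lambda>f. \<exists>c a. f = (\<lambda>x. c * x powr a)"])
  show "\<exists>c b. (\<lambda>x. x powr a) = (\<lambda>x. c * x powr b)" by (intro exI[of _ 1] exI[of _ a]) auto
  fix f :: "real \<Rightarrow> real" assume "\<exists>c a. f = (\<lambda>x. c * x powr a)"
  then obtain c a where f: "f = (\<lambda>x. c * x powr a)" by auto
  show "\<exists>f'. (\<exists>c a. f' = (\<lambda>x. c * x powr a)) \<and> (\<forall>x\<in>{0<..}. (f has_real_derivative f' x) (at x))"
    unfolding f by (intro exI[of _ "\<lambda>x. c * a * x powr (a - 1)"] conjI) (auto intro!: derivative_eq_intros)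
qed auto

lemma smooth_on_inverse: "smooth_on (\<lambda>x::real. inverse x) {0<..}"
  using smooth_on_powr[of "-1"] smooth_on_cong[of "{0<..}" "\<lambda>x::real. x powr -1" inverse] by (simp add: powr_minus)

lemma smooth_on_ln: "smooth_on (ln :: real \<Rightarrow> real) {0<..}"
  by (rule smooth_on_real_antideriv[OF _ _ smooth_on_inverse]) (auto intro!: derivative_eq_intros simp: divide_inverse)

subsection \<open>A smooth cutoff\<close>

text \<open>The flat function exp(-1/x) times a power of 1/x. With the powers included, the
  derivative of a member is a linear combination of members, so smoothness follows by an induction
  over the order for all \<open>m\<close> at once.\<close>

definition flat_exp :: "nat \<Rightarrow> real \<Rightarrow> real" where
  "flat_exp m x = (if 0 < x then inverse x ^ m * exp (- inverse x) else 0)"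

lemma flat_exp_tendsto_0: "(flat_exp m \<longlongrightarrow> 0) (at 0)"
proof -
  have "((\<lambda>x. inverse x ^ m * exp (- inverse x)) \<longlongrightarrow> 0) (at_right (0::real))"
    by real_asymp
  then have "(flat_exp m \<longlongrightarrow> 0) (at_right 0)"
    by (rule Lim_transform_eventually) (auto simp: flat_exp_def eventually_at_right_less intro!: eventually_mono[OF eventually_at_right_less])
  moreover have "(flat_exp m \<longlongrightarrow> 0) (at_left 0)"
    by (rule Lim_transform_eventually[OF tendsto_const]) (auto simp: flat_exp_def eventually_at_filter)
  ultimately show ?thesis by (simp add: filterlim_at_split)
qed

lemma flat_exp_deriv:
  "(flat_exp m has_real_derivative flat_exp (m + 2) x - real m * flat_exp (m + 1) x) (at x)"
proof (cases x "0::real" rule: linorder_cases)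
  case less
  have "((\<lambda>x. 0) has_real_derivative 0) (at x)" by simp
  then have "(flat_exp m has_real_derivative 0) (at x)"
    by (rule has_field_derivative_transform_within_open[where S = "{..<0}"]) (use less in \<open>auto simp: flat_exp_def\<close>)
  then show ?thesis using less by (simp add: flat_exp_def)
next
  case equal
  \<comment> \<open>The difference quotient of \<open>flat_exp m\<close> at 0 is
    \<open>flat_exp (Suc m)\<close>, so the derivative at 0 is a limit already known.\<close>
  have "((\<lambda>h. (flat_exp m (0 + h) - flat_exp m 0) / h) \<longlongrightarrow> 0) (at 0)"
    by (rule Lim_transform_eventually[OF flat_exp_tendsto_0[of "Suc m"]])
      (auto simp: flat_exp_def eventually_at_filter field_simps)
  then show ?thesis using equal by (simp add: DERIV_def flat_exp_def)
next
  case greater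
  have "((\<lambda>x. inverse x ^ m * exp (- inverse x)) has_real_derivative
      inverse x ^ (m + 2) * exp (- inverse x) - real m * (inverse x ^ (m + 1) * exp (- inverse x))) (at x)"
  proof -
    have i: "(inverse has_real_derivative - (inverse x ^ 2)) (at x)"
      using greater by (auto intro!: derivative_eq_intros simp: power2_eq_square)
    have "((\<lambda>x. inverse x ^ m) has_real_derivative - (real m * inverse x ^ (m + 1))) (at x)"
    proof (cases m)
      case (Suc k)
      show ?thesis unfolding Suc using DERIV_power_Suc[OF i, of k] by (simp add: power2_eq_square mult_ac)
    qed simp
    moreover have "((\<lambda>x. exp (- inverse x)) has_real_derivative exp (- inverse x) * inverse x ^ 2) (at x)"
      using greater by (auto intro!: derivative_eq_intros simp: power2_eq_square)
    ultimately show ?thesis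
      by (auto dest: DERIV_mult simp: power2_eq_square algebra_simps)
  qed
  then have "(flat_exp m has_real_derivative
      inverse x ^ (m + 2) * exp (- inverse x) - real m * (inverse x ^ (m + 1) * exp (- inverse x))) (at x)"
    by (rule has_field_derivative_transform_within_open[where S = "{0<..}"]) (use greater in \<open>auto simp: flat_exp_def\<close>)
  then show ?thesis using greater by (simp add: flat_exp_def)
qed

lemma smooth_on_flat_exp: "smooth_on (flat_exp m) UNIV"
  unfolding smooth_on_def
proof
  fix k show "Ck_on k (flat_exp m) UNIV"
  proof (induction k arbitrary: m)
    case 0
    then show ?case by (auto intro!: continuous_at_imp_continuous_on DERIV_isCont flat_exp_deriv)
  next
    case (Suc k)
    have "Ck_on k (\<lambda>x. flat_exp (m + 2) x + (- real m) * flat_exp (m + 1) x) UNIV"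
      by (intro Ck_on_add Ck_on_mult Ck_on_const Suc.IH) auto
    then show ?case
      by (intro Ck_on_real_SucI[where f' = "\<lambda>x. flat_exp (m + 2) x - real m * flat_exp (m + 1) x"] flat_exp_deriv) auto
  qed
qed

text \<open>The quotient f / (f + g) of flat functions that vanish exactly on x \<ge> 1 and on x
  \<le> 1/2. These sets are disjoint, so the denominator is positive everywhere.\<close>

lemma smooth_step_exists:
  obtains h :: "real \<Rightarrow> real" where "smooth_on h UNIV" "\<And>x. x \<le> 1/2 \<Longrightarrow> h x = 1"
    "\<And>x. 1 \<le> x \<Longrightarrow> h x = 0" "\<And>x. 0 \<le> h x" "\<And>x. h x \<le> 1"
proof -
  define f g where "f = (\<lambda>x. flat_exp 0 (1 - x))" and "g = (\<lambda>x. flat_exp 0 (x - 1/2))"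
  define h where "h x = f x * inverse (f x + g x)" for x
  have f: "f x \<ge> 0" "x < 1 \<Longrightarrow> f x > 0" "1 \<le> x \<Longrightarrow> f x = 0" for x by (auto simp: f_def flat_exp_def)
  have g: "g x \<ge> 0" "x > 1/2 \<Longrightarrow> g x > 0" "x \<le> 1/2 \<Longrightarrow> g x = 0" for x by (auto simp: g_def flat_exp_def)
  have fg: "f x + g x > 0" for x
    using f[of x] g[of x] by (cases "x < 1") auto
  have lin: "smooth_on (\<lambda>x::real. c * x + d) UNIV" for c d
    by (intro smooth_on_add smooth_on_const smooth_on_linear bounded_linear_mult_right) auto
  have sf: "smooth_on f UNIV" unfolding f_def
    using lin[of "-1" 1] by (intro smooth_on_compose_real[OF _ _ smooth_on_flat_exp]) auto
  have sg: "smooth_on g UNIV" unfolding g_def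
    using lin[of "1" "-1/2"] by (intro smooth_on_compose_real[OF _ _ smooth_on_flat_exp]) auto
  have "smooth_on h UNIV" unfolding h_def
    by (intro smooth_on_mult sf smooth_on_compose_real[OF _ _ smooth_on_inverse] smooth_on_add sg) (use fg in auto)
  moreover have "h x = 1" if "x \<le> 1/2" for x using fg[of x] g(3)[OF that] by (simp add: h_def)
  moreover have "h x = 0" if "1 \<le> x" for x using f(3)[OF that] by (simp add: h_def)
  moreover have "0 \<le> h x" "h x \<le> 1" for x using fg[of x] f(1)[of x] g(1)[of x] by (auto simp: h_def field_simps)
  ultimately show ?thesis by (rule that)
qed

section \<open>Powers of the step and their first two derivatives\<close>

lemma smooth_on_real_derivE:
  fixes f :: "real \<Rightarrow> real"
  assumes "open U" "smooth_on f U"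
  obtains f' where "\<And>x. x \<in> U \<Longrightarrow> (f has_real_derivative f' x) (at x)" "smooth_on f' U"
proof -
  have "(f has_real_derivative deriv f x) (at x)" if "x \<in> U" for x
    using smooth_on_imp_differentiable[OF assms(2) that]
    by (simp add: DERIV_deriv_iff_real_differentiable)
  then show ?thesis using that smooth_on_real_derivative[OF assms] by blast
qed

text \<open>Here \<open>g1\<close> and \<open>g2\<close> are the derivatives of h^k, not of
  \<open>h\<close>. The bounds by h^(k - 2) record that two differentiations cost at most two powers
  of the step, the loss that Young's inequality has to afford.\<close>

definition is_cutoff :: "nat \<Rightarrow> (real \<Rightarrow> real) \<Rightarrow> (real \<Rightarrow> real) \<Rightarrow> (real \<Rightarrow> real) \<Rightarrow> real \<Rightarrow> bool" where
  "is_cutoff k h g1 g2 C \<longleftrightarrow> smooth_on h UNIV \<and> (\<forall>x\<ge>1. h x = 0) \<and> (\<forall>x\<le>1/2. h x = 1) \<and>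
     (\<forall>x. 0 \<le> h x) \<and> (\<forall>x. h x \<le> 1) \<and>
     (\<forall>x. ((\<lambda>x. h x ^ k) has_real_derivative g1 x) (at x)) \<and> (\<forall>x. (g1 has_real_derivative g2 x) (at x)) \<and>
     (\<forall>x. \<bar>g1 x\<bar> \<le> C * h x ^ (k - 2)) \<and> (\<forall>x. \<bar>g2 x\<bar> \<le> C * h x ^ (k - 2)) \<and>
     (\<forall>x<1/2. g1 x = 0) \<and> (\<forall>x<1/2. g2 x = 0) \<and> C > 0"

lemma is_cutoffD:
  assumes "is_cutoff k h g1 g2 C"
  shows "smooth_on h UNIV" "\<And>x. 1 \<le> x \<Longrightarrow> h x = 0" "\<And>x. x \<le> 1/2 \<Longrightarrow> h x = 1" "\<And>x. 0 \<le> h x" "\<And>x. h x \<le> 1"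
    "\<And>x. ((\<lambda>x. h x ^ k) has_real_derivative g1 x) (at x)" "\<And>x. (g1 has_real_derivative g2 x) (at x)"
    "\<And>x. \<bar>g1 x\<bar> \<le> C * h x ^ (k - 2)" "\<And>x. \<bar>g2 x\<bar> \<le> C * h x ^ (k - 2)"
    "\<And>x. x < 1/2 \<Longrightarrow> g1 x = 0" "\<And>x. x < 1/2 \<Longrightarrow> g2 x = 0" "C > 0"
  using assms by (simp_all add: is_cutoff_def)

text \<open>Since \<open>h\<close> is constant off [1/2, 1], h' and h'' are bounded by compactness.
  The derivatives k h^(k-1) h' and k (k-1) h^(k-2) h'^2 + k h^(k-1) h'' then have every term bounded
  by a multiple of h^(k-2), because 0 \<le> h \<le> 1.\<close>

lemma cutoff_exists:
  fixes k :: nat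
  assumes "k \<ge> 2"
  obtains h g1 g2 C where "is_cutoff k h g1 g2 C"
proof -
  obtain h :: "real \<Rightarrow> real" where h: "smooth_on h UNIV" "\<And>x. x \<le> 1/2 \<Longrightarrow> h x = 1"
    "\<And>x. 1 \<le> x \<Longrightarrow> h x = 0" "\<And>x. 0 \<le> h x" "\<And>x. h x \<le> 1" using smooth_step_exists by blast
  obtain h1 where h1: "\<And>x. (h has_real_derivative h1 x) (at x)" "smooth_on h1 UNIV"
    using smooth_on_real_derivE[OF open_UNIV h(1)] by auto
  obtain h2 where h2: "\<And>x. (h1 has_real_derivative h2 x) (at x)" "smooth_on h2 UNIV"
    using smooth_on_real_derivE[OF open_UNIV h1(2)] by auto
  have z1: "h1 x = 0" if "x < 1/2 \<or> x > 1" for x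
  proof -
    from that consider "x < 1/2" | "x > 1" by blast
    then show ?thesis
    proof cases
      case 1
      have "(h has_real_derivative 0) (at x)"
        by (rule has_field_derivative_transform_within_open[where S = "{..<1/2}" and f = "\<lambda>x. 1"]) (use 1 h(2) in auto)
      then show ?thesis using h1(1) DERIV_unique by blast
    next
      case 2
      have "(h has_real_derivative 0) (at x)"
        by (rule has_field_derivative_transform_within_open[where S = "{1<..}" and f = "\<lambda>x. 0"]) (use 2 h(3) in auto)
      then show ?thesis using h1(1) DERIV_unique by blast
    qed
  qed
  have z2: "h2 x = 0" if "x < 1/2 \<or> x > 1" for x
  proof -
    have "(h1 has_real_derivative 0) (at x)"
      by (rule has_field_derivative_transform_within_open[where S = "{..<1/2} \<union> {1<..}" and f = "\<lambda>x. 0"]) (use that z1 in auto)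
    then show ?thesis using h2(1) DERIV_unique by blast
  qed
  have bnd: "\<exists>M>0. \<forall>x. \<bar>f x\<bar> \<le> M" if "smooth_on f UNIV" "\<And>x. x < 1/2 \<or> x > 1 \<Longrightarrow> f x = 0" for f :: "real \<Rightarrow> real"
  proof -
    have "compact (f ` {1/2..1})"
      using smooth_on_imp_continuous_on[OF that(1)] by (intro compact_continuous_image) (auto intro: continuous_on_subset)
    then obtain M where M: "\<forall>y\<in>f ` {1/2..1}. norm y \<le> M" using compact_imp_bounded bounded_iff by metis
    have "\<bar>f x\<bar> \<le> max M 1" for x
    proof (cases "x \<in> {1/2..1}")
      case True
      then have "\<bar>f x\<bar> \<le> M" using M by force
      then show ?thesis by simp
    qed (use that(2)[of x] in auto)
    then show ?thesis by (intro exI[of _ "max M 1"]) auto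
  qed
  obtain M1 where M1: "M1 > 0" "\<And>x. \<bar>h1 x\<bar> \<le> M1" using bnd[OF h1(2) z1] by blast
  obtain M2 where M2: "M2 > 0" "\<And>x. \<bar>h2 x\<bar> \<le> M2" using bnd[OF h2(2) z2] by blast
  obtain j where k: "k = j + 2" using assms by (metis add.commute le_Suc_ex)
  define g1 where "g1 x = real k * h x ^ (j + 1) * h1 x" for x
  define g2 where "g2 x = real k * (real (j + 1) * h x ^ j * h1 x * h1 x + h x ^ (j + 1) * h2 x)" for x
  define C where "C = real k * M1 + real k * (real (j + 1) * M1 * M1 + M2)"
  have hp: "0 \<le> h x ^ j" "h x ^ (j + 1) \<le> h x ^ j" "0 \<le> h x ^ (j+1)" for x
    using h(4)[of x] h(5)[of x] by (auto simp: mult_left_le_one_le)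
  have kpos: "real k > 0" using k by simp
  have b1: "\<bar>g1 x\<bar> \<le> real k * M1 * h x ^ j" for x
  proof -
    have "\<bar>g1 x\<bar> = real k * (h x ^ (j + 1) * \<bar>h1 x\<bar>)" using hp(3)[of x] by (simp add: g1_def abs_mult del: power_Suc)
    also have "\<dots> \<le> real k * (h x ^ j * M1)" using hp[of x] M1(2)[of x] by (intro mult_left_mono mult_mono) auto
    finally show ?thesis by (simp add: mult_ac)
  qed
  have b2: "\<bar>g2 x\<bar> \<le> real k * (real (j + 1) * M1 * M1 + M2) * h x ^ j" for x
  proof -
    have "\<bar>real (j + 1) * h x ^ j * h1 x * h1 x + h x ^ (j + 1) * h2 x\<bar>
        \<le> \<bar>real (j + 1) * h x ^ j * h1 x * h1 x\<bar> + \<bar>h x ^ (j + 1) * h2 x\<bar>" by (rule abs_triangle_ineq)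
    also have "\<dots> = real (j + 1) * h x ^ j * (\<bar>h1 x\<bar> * \<bar>h1 x\<bar>) + h x ^ (j + 1) * \<bar>h2 x\<bar>"
      using hp[of x] by (simp add: abs_mult del: power_Suc)
    also have "\<dots> \<le> real (j + 1) * h x ^ j * (M1 * M1) + h x ^ j * M2"
      using hp[of x] M1(2)[of x] M1(1) M2(2)[of x] by (intro add_mono mult_mono) auto
    finally have "\<bar>real (j + 1) * h x ^ j * h1 x * h1 x + h x ^ (j + 1) * h2 x\<bar> \<le> (real (j + 1) * M1 * M1 + M2) * h x ^ j"
      by (simp add: algebra_simps)
    then have "real k * \<bar>real (j + 1) * h x ^ j * h1 x * h1 x + h x ^ (j + 1) * h2 x\<bar> \<le> real k * ((real (j + 1) * M1 * M1 + M2) * h x ^ j)"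
      by (intro mult_left_mono) auto
    then show ?thesis using kpos unfolding g2_def abs_mult by (simp add: mult.assoc)
  qed
  have "is_cutoff k h g1 g2 C" unfolding is_cutoff_def
  proof (intro conjI allI impI h)
    show "C > 0" using M1 M2 kpos unfolding C_def by (intro add_pos_pos mult_pos_pos) auto
    show "((\<lambda>x. h x ^ k) has_real_derivative g1 x) (at x)" for x
      using DERIV_power_Suc[OF h1(1), of "j + 1" x] by (simp add: g1_def k mult_ac)
    show "(g1 has_real_derivative g2 x) (at x)" for x
    proof -
      have "((\<lambda>x. h x ^ (j + 1)) has_real_derivative (1 + real j) * (h1 x * h x ^ j)) (at x)"
        using DERIV_power_Suc[OF h1(1), of j x] by simp
      from DERIV_cmult[OF DERIV_mult[OF this h2(1)], of "real k"] show ?thesis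
        unfolding g1_def g2_def by (simp add: algebra_simps)
    qed
    show "\<bar>g1 x\<bar> \<le> C * h x ^ (k - 2)" for x
    proof -
      have "0 \<le> real k * (real (j + 1) * M1 * M1 + M2) * h x ^ j" using M1 M2 hp[of x] by simp
      then show ?thesis using b1[of x] by (simp add: C_def k distrib_right)
    qed
    show "\<bar>g2 x\<bar> \<le> C * h x ^ (k - 2)" for x
    proof -
      have "0 \<le> real k * M1 * h x ^ j" using M1 hp[of x] by simp
      then show ?thesis using b2[of x] by (simp add: C_def k distrib_right)
    qed
    show "g1 x = 0" if "x < 1/2" for x using z1 that by (simp add: g1_def)
    show "g2 x = 0" if "x < 1/2" for x using z1 z2 that by (simp add: g2_def)
  qed
  then show ?thesis by (rule that)
qed

subsection \<open>Solutions of the modified Bessel equation\<close>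

text \<open>The recursion expresses that the power series H with these coefficients solves 4 z H'' +
  4 a H' = H with H(0) = 1. For a > 0 all coefficients are positive, so that H is at least 1 and
  increasing on the half-line.\<close>

primrec bessel_coeff :: "real \<Rightarrow> nat \<Rightarrow> real" where
  "bessel_coeff a 0 = 1"
| "bessel_coeff a (Suc k) = bessel_coeff a k / (4 * (real k + 1) * (real k + a))"

text \<open>The hypergeometric function \<open>0F1(a; z/4)\<close>.\<close>

definition bessel_series :: "real \<Rightarrow> real \<Rightarrow> real" where
  "bessel_series a z = (\<Sum>k. bessel_coeff a k * z ^ k)"

lemma bessel_coeff_pos: "a > 0 \<Longrightarrow> bessel_coeff a k > 0"
  by (induction k) auto

lemma bessel_coeff_le: "a > 0 \<Longrightarrow> bessel_coeff a k \<le> (1 / (4 * a)) ^ k / fact k"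
proof (induction k)
  case (Suc k)
  have "bessel_coeff a (Suc k) = bessel_coeff a k * (1 / (4 * (real k + 1) * (real k + a)))" by simp
  also have "\<dots> \<le> ((1 / (4 * a)) ^ k / fact k) * (1 / (4 * (real k + 1) * a))"
  proof (intro mult_mono)
    show "1 / (4 * (real k + 1) * (real k + a)) \<le> 1 / (4 * (real k + 1) * a)"
      using Suc.prems by (intro divide_left_mono mult_left_mono mult_pos_pos) auto
  qed (use Suc in auto)
  also have "\<dots> = (1 / (4 * a)) ^ Suc k / fact (Suc k)" by (simp add: field_simps)
  finally show ?case .
qed auto

lemma summable_bessel_coeff:
  assumes "a > 0"
  shows "summable (\<lambda>k. bessel_coeff a k * z ^ k)"
proof (rule summable_comparison_test)
  show "summable (\<lambda>k. inverse (fact k) * (\<bar>z\<bar> / (4 * a)) ^ k)" by (rule summable_exp)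
  have "norm (bessel_coeff a k * z ^ k) \<le> inverse (fact k) * (\<bar>z\<bar> / (4 * a)) ^ k" for k
  proof -
    have "norm (bessel_coeff a k * z ^ k) = bessel_coeff a k * \<bar>z\<bar> ^ k"
      using bessel_coeff_pos[OF assms, of k] by (simp add: abs_mult power_abs)
    also have "\<dots> \<le> (1 / (4 * a)) ^ k / fact k * \<bar>z\<bar> ^ k"
      using bessel_coeff_le[OF assms, of k] by (intro mult_right_mono) auto
    also have "\<dots> = inverse (fact k) * (\<bar>z\<bar> / (4 * a)) ^ k" by (simp add: power_divide field_simps)
    finally show ?thesis .
  qed
  then show "\<exists>N. \<forall>n\<ge>N. norm (bessel_coeff a n * z ^ n) \<le> inverse (fact n) * (\<bar>z\<bar> / (4 * a)) ^ n" by blast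
qed

lemma summable_diffs_all:
  fixes c :: "nat \<Rightarrow> real"
  assumes "\<And>x. summable (\<lambda>n. c n * x ^ n)"
  shows "summable (\<lambda>n. diffs c n * x ^ n)"
  using termdiff_converges_all[OF assms] .

lemma smooth_on_power_series:
  fixes c :: "nat \<Rightarrow> real"
  assumes "\<And>x. summable (\<lambda>n. c n * x ^ n)"
  shows "smooth_on (\<lambda>x. \<Sum>n. c n * x ^ n) UNIV"
proof (rule smooth_on_real_coinduct[where P = "\<lambda>f. \<exists>c. (\<forall>x. summable (\<lambda>n. c n * x ^ n)) \<and> f = (\<lambda>x. \<Sum>n. c n * x ^ n)"])
  fix f :: "real \<Rightarrow> real"
  assume "\<exists>c. (\<forall>x. summable (\<lambda>n. c n * x ^ n)) \<and> f = (\<lambda>x. \<Sum>n. c n * x ^ n)"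
  then obtain c where c: "\<And>x. summable (\<lambda>n. c n * x ^ n)" "f = (\<lambda>x. \<Sum>n. c n * x ^ n)" by blast
  have "(f has_real_derivative (\<Sum>n. diffs c n * x ^ n)) (at x)" for x
    unfolding c(2) by (rule termdiffs_strong_converges_everywhere[OF c(1)])
  then show "\<exists>f'. (\<exists>c. (\<forall>x. summable (\<lambda>n. c n * x ^ n)) \<and> f' = (\<lambda>x. \<Sum>n. c n * x ^ n)) \<and>
      (\<forall>x\<in>UNIV. (f has_real_derivative f' x) (at x))"
    using summable_diffs_all[OF c(1)] by blast
qed (use assms in auto)

lemma bessel_series_ode:
  assumes "a > 0"
  obtains H1 H2 where "\<And>z. (bessel_series a has_real_derivative H1 z) (at z)"
    "\<And>z. (H1 has_real_derivative H2 z) (at z)"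
    "\<And>z. 4 * z * H2 z + 4 * a * H1 z = bessel_series a z"
    "\<And>z. 0 \<le> z \<Longrightarrow> 0 \<le> H1 z" "bessel_series a 0 = 1" "smooth_on (bessel_series a) UNIV"
proof -
  define c where "c = bessel_coeff a"
  have s: "summable (\<lambda>n. c n * x ^ n)" for x unfolding c_def by (rule summable_bessel_coeff[OF assms])
  note s1 = summable_diffs_all[OF s]
  note s2 = summable_diffs_all[OF s1]
  have H: "bessel_series a = (\<lambda>x. \<Sum>n. c n * x ^ n)" by (auto simp: bessel_series_def c_def)
  define H1 where "H1 x = (\<Sum>n. diffs c n * x ^ n)" for x
  define H2 where "H2 x = (\<Sum>n. diffs (diffs c) n * x ^ n)" for x
  have ode: "4 * z * H2 z + 4 * a * H1 z = bessel_series a z" for z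
  proof -
    \<comment> \<open>The series of z H'' is that of H'' with the index shifted by one; the missing
      term is \<open>g 0 = 0\<close>. After the shift the recursion can be applied coefficient by
      coefficient.\<close>
    define g where "g n = real n * diffs c n * z ^ n" for n
    have "(\<lambda>n. z * (diffs (diffs c) n * z ^ n)) sums (z * H2 z)"
      unfolding H2_def by (intro sums_mult summable_sums s2)
    moreover have "z * (diffs (diffs c) n * z ^ n) = g (Suc n)" for n
      by (simp add: g_def diffs_def algebra_simps)
    ultimately have "(\<lambda>n. g (Suc n)) sums (z * H2 z)" by simp
    then have "g sums (z * H2 z + g 0)" by (simp only: sums_Suc_iff)
    then have 1: "g sums (z * H2 z)" by (simp add: g_def)
    have "(\<lambda>n. diffs c n * z ^ n) sums H1 z" unfolding H1_def by (intro summable_sums s1)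
    from sums_add[OF sums_mult[OF 1, of 4] sums_mult[OF this, of "4 * a"]]
    have "(\<lambda>n. 4 * g n + 4 * a * (diffs c n * z ^ n)) sums (4 * z * H2 z + 4 * a * H1 z)" by (simp add: mult_ac)
    moreover have "4 * g n + 4 * a * (diffs c n * z ^ n) = c n * z ^ n" for n
    proof -
      define q where "q = c (Suc n)"
      have "(4 * (real n + 1) * (real n + a)) * (c n / (4 * (real n + 1) * (real n + a))) = c n"
        using assms by (subst times_divide_eq_right, subst nonzero_mult_div_cancel_left) auto
      then have "(4 * (real n + 1) * (real n + a)) * q = c n"
        by (simp only: q_def c_def bessel_coeff.simps)
      moreover have "4 * g n + 4 * a * (diffs c n * z ^ n) = ((4 * (real n + 1) * (real n + a)) * q) * z ^ n"
        unfolding g_def diffs_def q_def[symmetric] by (simp add: algebra_simps)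
      ultimately show ?thesis by simp
    qed
    ultimately have "(\<lambda>n. c n * z ^ n) sums (4 * z * H2 z + 4 * a * H1 z)" by simp
    then show ?thesis unfolding H by (simp add: sums_unique)
  qed
  show ?thesis
  proof (rule that[of H1 H2, OF _ _ ode])
    show "(bessel_series a has_real_derivative H1 z) (at z)" for z
      unfolding H H1_def by (rule termdiffs_strong_converges_everywhere[OF s])
    show "(H1 has_real_derivative H2 z) (at z)" for z
      unfolding H1_def[abs_def] H2_def by (rule termdiffs_strong_converges_everywhere[OF s1])
    show "0 \<le> H1 z" if "0 \<le> z" for z
      unfolding H1_def using that assms by (intro suminf_nonneg s1) (auto simp: diffs_def c_def intro!: mult_nonneg_nonneg less_imp_le[OF bessel_coeff_pos] divide_nonneg_nonneg)
    show "bessel_series a 0 = 1" unfolding H by (simp add: powser_zero c_def)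
    show "smooth_on (bessel_series a) UNIV" unfolding H by (rule smooth_on_power_series[OF s])
  qed
qed

section \<open>Growing and decaying solutions of w'' = (1 + b (b - 1) / z^2) w\<close>

text \<open>The sum E = w + w' satisfies E' = E + c w / \<rho>^2, so E' differs from E by at most
  |c| E / \<rho>^2. As 1/\<rho>^2 is integrable at infinity, E e^(-\<rho>) is nonincreasing after
  multiplication by e^(|c|/\<rho>) and nondecreasing after multiplication by e^(-|c|/\<rho>). The
  bound w' \<le> B w passes the lower estimate from E to w.\<close>

lemma exp_growth_of_ode:
  fixes w w1 :: "real \<Rightarrow> real" and \<rho>0 c B :: real
  assumes "\<rho>0 > 0" "B \<ge> 0"
    and d1: "\<And>\<rho>. \<rho> \<ge> \<rho>0 \<Longrightarrow> (w has_real_derivative w1 \<rho>) (at \<rho>)"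
    and d2: "\<And>\<rho>. \<rho> \<ge> \<rho>0 \<Longrightarrow> (w1 has_real_derivative (1 + c / \<rho>\<^sup>2) * w \<rho>) (at \<rho>)"
    and w: "\<And>\<rho>. \<rho> \<ge> \<rho>0 \<Longrightarrow> 0 < w \<rho>" "\<And>\<rho>. \<rho> \<ge> \<rho>0 \<Longrightarrow> 0 \<le> w1 \<rho>" "\<And>\<rho>. \<rho> \<ge> \<rho>0 \<Longrightarrow> w1 \<rho> \<le> B * w \<rho>"
  obtains a C where "a > 0" "C > 0" "\<And>\<rho>. \<rho> \<ge> \<rho>0 \<Longrightarrow> a * exp \<rho> \<le> w \<rho>"
    "\<And>\<rho>. \<rho> \<ge> \<rho>0 \<Longrightarrow> w \<rho> \<le> C * exp \<rho>" "\<And>\<rho>. \<rho> \<ge> \<rho>0 \<Longrightarrow> w1 \<rho> \<le> C * exp \<rho>"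
proof -
  define E where "E \<rho> = w \<rho> + w1 \<rho>" for \<rho>
  have dE: "(E has_real_derivative w1 \<rho> + (1 + c / \<rho>\<^sup>2) * w \<rho>) (at \<rho>)" if "\<rho> \<ge> \<rho>0" for \<rho>
    unfolding E_def by (intro DERIV_add d1 d2 that)
  have cw: "\<bar>c / \<rho>\<^sup>2 * w \<rho>\<bar> \<le> \<bar>c\<bar> / \<rho>\<^sup>2 * E \<rho>" if "\<rho> \<ge> \<rho>0" for \<rho>
  proof -
    have "\<bar>c / \<rho>\<^sup>2 * w \<rho>\<bar> = \<bar>c\<bar> / \<rho>\<^sup>2 * w \<rho>" using w(1)[OF that] by (simp add: abs_mult)
    also have "\<dots> \<le> \<bar>c\<bar> / \<rho>\<^sup>2 * E \<rho>" using w[OF that] by (intro mult_left_mono) (auto simp: E_def)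
    finally show ?thesis .
  qed
  define P where "P \<rho> = E \<rho> * exp (- \<rho> + \<bar>c\<bar> / \<rho>)" for \<rho>
  define Q where "Q \<rho> = E \<rho> * exp (- \<rho> - \<bar>c\<bar> / \<rho>)" for \<rho>
  have P: "P \<rho> \<le> P \<rho>0" if "\<rho> \<ge> \<rho>0" for \<rho>
  proof (rule DERIV_nonpos_imp_nonincreasing[OF that])
    fix x assume x: "\<rho>0 \<le> x" "x \<le> \<rho>"
    have "(P has_real_derivative ((w1 x + (1 + c / x\<^sup>2) * w x) + E x * (- 1 - \<bar>c\<bar> / x\<^sup>2)) * exp (- x + \<bar>c\<bar> / x)) (at x)"
      unfolding P_def using x assms(1) by (auto intro!: derivative_eq_intros dE simp: power2_eq_square field_simps)
    moreover have "(w1 x + (1 + c / x\<^sup>2) * w x) + E x * (- 1 - \<bar>c\<bar> / x\<^sup>2) = c / x\<^sup>2 * w x - \<bar>c\<bar> / x\<^sup>2 * E x"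
      by (simp add: E_def algebra_simps)
    moreover have "c / x\<^sup>2 * w x - \<bar>c\<bar> / x\<^sup>2 * E x \<le> 0" using abs_le_D1[OF cw[OF x(1)]] by simp
    ultimately show "\<exists>y. (P has_real_derivative y) (at x) \<and> y \<le> 0"
      by (metis exp_ge_zero mult_nonpos_nonneg)
  qed
  have Q: "Q \<rho>0 \<le> Q \<rho>" if "\<rho> \<ge> \<rho>0" for \<rho>
  proof (rule DERIV_nonneg_imp_nondecreasing[OF that])
    fix x assume x: "\<rho>0 \<le> x" "x \<le> \<rho>"
    have "(Q has_real_derivative ((w1 x + (1 + c / x\<^sup>2) * w x) + E x * (- 1 + \<bar>c\<bar> / x\<^sup>2)) * exp (- x - \<bar>c\<bar> / x)) (at x)"
      unfolding Q_def using x assms(1) by (auto intro!: derivative_eq_intros dE simp: power2_eq_square field_simps)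
    moreover have "(w1 x + (1 + c / x\<^sup>2) * w x) + E x * (- 1 + \<bar>c\<bar> / x\<^sup>2) = c / x\<^sup>2 * w x + \<bar>c\<bar> / x\<^sup>2 * E x"
      by (simp add: E_def algebra_simps)
    moreover have "c / x\<^sup>2 * w x + \<bar>c\<bar> / x\<^sup>2 * E x \<ge> 0" using abs_le_D2[OF cw[OF x(1)]] by simp
    ultimately show "\<exists>y. (Q has_real_derivative y) (at x) \<and> y \<ge> 0"
      by (metis exp_ge_zero mult_nonneg_nonneg)
  qed
  have Epos: "E \<rho> > 0" if "\<rho> \<ge> \<rho>0" for \<rho> using w[OF that] by (simp add: E_def)
  have up: "E \<rho> \<le> P \<rho>0 * exp \<rho>" if "\<rho> \<ge> \<rho>0" for \<rho>
  proof -
    have "E \<rho> * exp (- \<rho>) \<le> P \<rho>"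
      unfolding P_def using Epos[OF that] assms(1) that by (intro mult_left_mono) auto
    then have "E \<rho> * exp (- \<rho>) \<le> P \<rho>0" using P[OF that] by linarith
    then have "E \<rho> * exp (- \<rho>) * exp \<rho> \<le> P \<rho>0 * exp \<rho>" by (intro mult_right_mono) auto
    then show ?thesis by (simp add: mult.assoc flip: exp_add)
  qed
  have lo: "Q \<rho>0 * exp \<rho> \<le> E \<rho>" if "\<rho> \<ge> \<rho>0" for \<rho>
  proof -
    have "Q \<rho> \<le> E \<rho> * exp (- \<rho>)"
      unfolding Q_def using Epos[OF that] assms(1) that by (intro mult_left_mono) auto
    then have "Q \<rho>0 \<le> E \<rho> * exp (- \<rho>)" using Q[OF that] by linarith
    then have "Q \<rho>0 * exp \<rho> \<le> E \<rho> * exp (- \<rho>) * exp \<rho>" by (intro mult_right_mono) auto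
    then show ?thesis by (simp add: mult.assoc flip: exp_add)
  qed
  show ?thesis
  proof (rule that[of "Q \<rho>0 / (1 + B)" "P \<rho>0"])
    show "Q \<rho>0 / (1 + B) > 0" using Epos[of \<rho>0] assms(2) by (simp add: Q_def)
    show "P \<rho>0 > 0" using Epos[of \<rho>0] by (simp add: P_def)
    fix \<rho> assume r: "\<rho> \<ge> \<rho>0"
    have "Q \<rho>0 * exp \<rho> \<le> (1 + B) * w \<rho>" using lo[OF r] w(3)[OF r] by (simp add: E_def distrib_right)
    then show "Q \<rho>0 / (1 + B) * exp \<rho> \<le> w \<rho>" using assms(2) by (simp add: field_simps)
    show "w \<rho> \<le> P \<rho>0 * exp \<rho>" "w1 \<rho> \<le> P \<rho>0 * exp \<rho>" using up[OF r] w[OF r] by (auto simp: E_def)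
  qed
qed

text \<open>Up to a constant factor, \<open>dominant b z\<close> is \<open>sqrt z\<close> times the modified Bessel function of the
  first kind of order \<open>b - 1/2\<close>.\<close>

definition dominant :: "real \<Rightarrow> real \<Rightarrow> real" where
  "dominant b z = z powr b * bessel_series (b + 1/2) (z\<^sup>2)"

lemma bessel_series_mono:
  assumes "a > 0" "0 \<le> x" "x \<le> y"
  shows "bessel_series a x \<le> bessel_series a y"
proof -
  obtain H1 H2 where "\<And>z. (bessel_series a has_real_derivative H1 z) (at z)" "\<And>z. 0 \<le> z \<Longrightarrow> 0 \<le> H1 z"
    using bessel_series_ode[OF assms(1)] by metis
  then show ?thesis
    by (intro DERIV_nonneg_imp_nondecreasing[OF assms(3)]) (use assms(2) in \<open>meson order_trans\<close>)
qed

lemma bessel_series_ge_1: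
  assumes "a > 0" "0 \<le> x"
  shows "1 \<le> bessel_series a x"
  using bessel_series_mono[OF assms(1) _ assms(2)] bessel_series_ode[OF assms(1)] by (metis order_refl)

text \<open>The function F(z) = H(z^2), with parameter b + 1/2, solves F'' + (2 b / z) F' = F. The
  factor z^b removes the first-order term and leaves the potential b (b - 1) / z^2.\<close>

lemma dominant_ode:
  assumes "b \<ge> 0"
  obtains w1 where "\<And>z. z > 0 \<Longrightarrow> (dominant b has_real_derivative w1 z) (at z)"
    "\<And>z. z > 0 \<Longrightarrow> (w1 has_real_derivative (1 + b * (b - 1) / z\<^sup>2) * dominant b z) (at z)"
    "\<And>z. z > 0 \<Longrightarrow> 0 < dominant b z" "\<And>z. z > 0 \<Longrightarrow> 0 \<le> w1 z"
    "\<And>z. z > 0 \<Longrightarrow> w1 z \<le> (1 + b / z) * dominant b z" "smooth_on (dominant b) {0<..}"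
proof -
  define a where "a = b + 1/2"
  have a: "a > 0" using assms by (simp add: a_def)
  have a4: "4 * a * x = 4 * b * x + 2 * x" for x :: real by (simp add: a_def algebra_simps)
  obtain H1 H2 where H: "\<And>z. (bessel_series a has_real_derivative H1 z) (at z)"
    "\<And>z. (H1 has_real_derivative H2 z) (at z)"
    "\<And>z. 4 * z * H2 z + 4 * a * H1 z = bessel_series a z"
    "\<And>z. 0 \<le> z \<Longrightarrow> 0 \<le> H1 z" "bessel_series a 0 = 1" "smooth_on (bessel_series a) UNIV"
    using bessel_series_ode[OF a] by blast
  define F where "F z = bessel_series a (z\<^sup>2)" for z
  define F1 where "F1 z = 2 * z * H1 (z\<^sup>2)" for z
  have sq: "((\<lambda>z. z\<^sup>2) has_real_derivative 2 * z) (at z)" for z :: real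
    by (auto intro!: derivative_eq_intros)
  have dF: "(F has_real_derivative F1 z) (at z)" for z
    using DERIV_chain2[OF H(1) sq, of z] by (simp add: F_def[abs_def] F1_def mult_ac)
  \<comment> \<open>The term 2 b F' / z is written as 4 b H'(z^2), which is regular at 0, where the
    energy argument for \<open>F1_le\<close> starts.\<close>
  have dF1: "(F1 has_real_derivative F z - 4 * b * H1 (z\<^sup>2)) (at z)" for z
  proof -
    have "(F1 has_real_derivative 2 * H1 (z\<^sup>2) + 2 * z * (H2 (z\<^sup>2) * (2 * z))) (at z)"
      using DERIV_mult[OF DERIV_cmult[OF DERIV_ident, of 2 z] DERIV_chain2[OF H(2) sq, of z]]
      by (simp add: F1_def[abs_def] algebra_simps)
    moreover have "2 * H1 (z\<^sup>2) + 2 * z * (H2 (z\<^sup>2) * (2 * z)) = F z - 4 * b * H1 (z\<^sup>2)"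
      using H(3)[of "z\<^sup>2", unfolded a4] unfolding F_def by (simp add: power2_eq_square algebra_simps)
    ultimately show ?thesis by simp
  qed
  have F1_nonneg: "F1 z \<ge> 0" if "z \<ge> 0" for z using that H(4)[of "z\<^sup>2"] by (simp add: F1_def)
  have F_ge: "F z \<ge> 1" for z unfolding F_def by (rule bessel_series_ge_1[OF a]) simp
  have F1_le: "F1 z \<le> F z" if "z \<ge> 0" for z
  proof -
    \<comment> \<open>F^2 - F'^2 has the value 1 at 0 and the nonnegative derivative 8 b F' H'(z^2),
      which yields F' \<le> F.\<close>
    have "(F 0)\<^sup>2 - (F1 0)\<^sup>2 \<le> (F z)\<^sup>2 - (F1 z)\<^sup>2"
    proof (rule DERIV_nonneg_imp_nondecreasing[OF that])
      fix x :: real assume "0 \<le> x" "x \<le> z"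
      have "((\<lambda>x. (F x)\<^sup>2 - (F1 x)\<^sup>2) has_real_derivative 2 * F1 x * (4 * b * H1 (x\<^sup>2))) (at x)"
        by (auto intro!: derivative_eq_intros dF dF1 simp: algebra_simps)
      moreover have "2 * F1 x * (4 * b * H1 (x\<^sup>2)) \<ge> 0" using F1_nonneg[OF \<open>0 \<le> x\<close>] assms H(4)[of "x\<^sup>2"] by simp
      ultimately show "\<exists>y. ((\<lambda>x. (F x)\<^sup>2 - (F1 x)\<^sup>2) has_real_derivative y) (at x) \<and> y \<ge> 0" by blast
    qed
    moreover have "F1 0 = 0" "F 0 = 1" by (auto simp: F1_def F_def H(5))
    ultimately have "(F1 z)\<^sup>2 \<le> (F z)\<^sup>2" by simp
    moreover have "0 \<le> F z" using F_ge[of z] by linarith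
    ultimately show ?thesis by (rule power2_le_imp_le)
  qed
  have dom: "dominant b = (\<lambda>z. z powr b * F z)" by (rule ext) (simp only: dominant_def F_def a_def)
  define w1 where "w1 z = b * z powr (b - 1) * F z + z powr b * F1 z" for z
  show ?thesis
  proof (rule that[of w1])
    fix z :: real assume z: "z > 0"
    show "(dominant b has_real_derivative w1 z) (at z)"
      unfolding dom w1_def[abs_def] using z by (auto intro!: derivative_eq_intros dF simp: field_simps)
    have "(w1 has_real_derivative b * ((b - 1) * z powr (b - 2)) * F z + b * z powr (b - 1) * F1 z
        + (b * z powr (b - 1) * F1 z + z powr b * (F z - 4 * b * H1 (z\<^sup>2)))) (at z)"
      unfolding w1_def[abs_def] using z by (auto intro!: derivative_eq_intros dF dF1 simp: field_simps)
    moreover have "z powr (b - 1) * z = z powr b" "z powr (b - 2) = z powr b / z\<^sup>2"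
      using z by (auto simp: powr_diff powr_numeral)
    then have "b * ((b - 1) * z powr (b - 2)) * F z + b * z powr (b - 1) * F1 z
        + (b * z powr (b - 1) * F1 z + z powr b * (F z - 4 * b * H1 (z\<^sup>2))) = (1 + b * (b - 1) / z\<^sup>2) * dominant b z"
      unfolding dom F1_def by (simp add: field_simps)
    ultimately show "(w1 has_real_derivative (1 + b * (b - 1) / z\<^sup>2) * dominant b z) (at z)" by simp
    show "0 < dominant b z" unfolding dom using z F_ge[of z] by simp
    show "0 \<le> w1 z" unfolding w1_def using z F_ge[of z] F1_nonneg[of z] assms by simp
    have "w1 z = z powr b * F1 z + b / z * dominant b z"
      unfolding w1_def dom using z by (simp add: powr_diff field_simps)
    moreover have "z powr b * F1 z \<le> dominant b z" unfolding dom using F1_le[of z] z by (intro mult_left_mono) auto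
    ultimately show "w1 z \<le> (1 + b / z) * dominant b z" by (simp add: distrib_right)
  next
    have "smooth_on (\<lambda>x::real. x) {0<..}" by (intro smooth_on_linear bounded_linear_ident) auto
    then show "smooth_on (dominant b) {0<..}" unfolding dominant_def a_def[symmetric]
      by (intro smooth_on_mult smooth_on_powr smooth_on_compose_real[OF _ _ H(6)] smooth_on_power) auto
  qed
qed

text \<open>The growth lemma asks for w' \<le> B w with a constant; on z \<ge> z0 the factor 1 + b /
  z is at most 1 + b / z0.\<close>

lemma dominant_growth:
  assumes "b \<ge> 0" "z0 > 0"
  obtains a C where "a > 0" "C > 0" "\<And>z. z \<ge> z0 \<Longrightarrow> a * exp z \<le> dominant b z"
    "\<And>z. z \<ge> z0 \<Longrightarrow> dominant b z \<le> C * exp z"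
proof -
  obtain w1 where w1: "\<And>z. z > 0 \<Longrightarrow> (dominant b has_real_derivative w1 z) (at z)"
    "\<And>z. z > 0 \<Longrightarrow> (w1 has_real_derivative (1 + b * (b - 1) / z\<^sup>2) * dominant b z) (at z)"
    "\<And>z. z > 0 \<Longrightarrow> 0 < dominant b z" "\<And>z. z > 0 \<Longrightarrow> 0 \<le> w1 z"
    "\<And>z. z > 0 \<Longrightarrow> w1 z \<le> (1 + b / z) * dominant b z"
    using dominant_ode[OF assms(1)] by metis
  have w1_le: "w1 z \<le> (1 + b / z0) * dominant b z" if "z \<ge> z0" for z
  proof -
    have "(1 + b / z) * dominant b z \<le> (1 + b / z0) * dominant b z"
      using w1(3)[of z] that assms by (intro mult_right_mono add_left_mono divide_left_mono) auto
    then show ?thesis using w1(5)[of z] that assms by linarith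
  qed
  show ?thesis
  proof (rule exp_growth_of_ode[of z0 "1 + b / z0" "dominant b" w1 "b * (b - 1)" thesis])
    show "0 \<le> 1 + b / z0" using assms by simp
  qed (use w1 w1_le assms that in auto)
qed

text \<open>Reduction of order turns the growing solution into the decaying one.\<close>

lemma decaying_solution:
  assumes "b \<ge> 1/2"
  obtains m m1 where "smooth_on m {0<..}"
    "\<And>z. z > 0 \<Longrightarrow> (m has_real_derivative m1 z) (at z)"
    "\<And>z. z > 0 \<Longrightarrow> (m1 has_real_derivative (1 + b * (b - 1) / z\<^sup>2) * m z) (at z)"
    "\<And>z. z > 0 \<Longrightarrow> m z > 0" "\<And>z. z > 0 \<Longrightarrow> 2 * z * m1 z < m z"
    "\<And>z0. z0 > 0 \<Longrightarrow> \<exists>C>0. \<forall>z\<ge>z0. m z \<le> C * exp (- z) \<and> \<bar>m1 z\<bar> \<le> C * exp (- z)"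
proof -
  have b0: "b \<ge> 0" using assms by simp
  define w where "w = dominant b"
  obtain w1 where w: "\<And>z. z > 0 \<Longrightarrow> (w has_real_derivative w1 z) (at z)"
    "\<And>z. z > 0 \<Longrightarrow> (w1 has_real_derivative (1 + b * (b - 1) / z\<^sup>2) * w z) (at z)"
    "\<And>z. z > 0 \<Longrightarrow> 0 < w z" "\<And>z. z > 0 \<Longrightarrow> 0 \<le> w1 z"
    "\<And>z. z > 0 \<Longrightarrow> w1 z \<le> (1 + b / z) * w z" "smooth_on w {0<..}"
    using dominant_ode[OF b0] unfolding w_def by blast
  \<comment> \<open>A second solution is \<open>w\<close> times an integral of 1 / w^2. Integrating
    from z to infinity selects the solution that decays, since f is of order e^(-2z).\<close>
  define f where "f z = 1 / (w z)\<^sup>2" for z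
  have fpos: "f z > 0" if "z > 0" for z using w(3)[OF that] by (simp add: f_def)
  have fc: "continuous_on {0<..} f"
  proof -
    have "continuous_on {0<..} w" using smooth_on_imp_continuous_on[OF w(6)] .
    moreover have "\<forall>x\<in>{0<..}. (w x)\<^sup>2 \<noteq> 0" using w(3) by fastforce
    ultimately show ?thesis unfolding f_def by (intro continuous_intros) auto
  qed
  have fbound: "\<exists>A>0. \<forall>z\<ge>z0. f z \<le> A * exp (- 2 * z)" if z0: "z0 > 0" for z0
  proof -
    obtain a C where a: "a > 0" "\<And>z. z \<ge> z0 \<Longrightarrow> a * exp z \<le> w z"
      using dominant_growth[OF b0 z0] unfolding w_def by metis
    have "f z \<le> (1 / a\<^sup>2) * exp (- 2 * z)" if "z \<ge> z0" for z
    proof -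
      have "(a * exp z)\<^sup>2 \<le> (w z)\<^sup>2" using a that by (intro power_mono) auto
      moreover have "0 < (w z)\<^sup>2 * (a * exp z)\<^sup>2" using w(3)[of z] a(1) that z0 by simp
      ultimately have "f z \<le> 1 / (a * exp z)\<^sup>2" unfolding f_def by (intro divide_left_mono) auto
      also have "\<dots> = (1 / a\<^sup>2) * exp (- 2 * z)" by (simp add: power_mult_distrib exp_minus field_simps flip: exp_double)
      finally show ?thesis .
    qed
    then show ?thesis using a by (intro exI[of _ "1 / a\<^sup>2"]) auto
  qed
  have fint: "f integrable_on {z..}" if z: "z > 0" for z
  proof -
    obtain A where A: "A > 0" "\<forall>x\<ge>z. f x \<le> A * exp (- 2 * x)" using fbound[OF z] by blast
    show ?thesis
    proof (rule measurable_bounded_by_integrable_imp_integrable)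
      show "f \<in> borel_measurable (lebesgue_on {z..})"
        using fc z by (intro continuous_imp_measurable_on_sets_lebesgue) (auto intro: continuous_on_subset)
      have "((\<lambda>x. exp (- 2 * x)) has_integral exp (- 2 * z) / 2) {z..}"
        by (rule has_integral_exp_minus_to_infinity) simp
      then have "(\<lambda>x. exp (- 2 * x)) integrable_on {z..}" by (rule has_integral_integrable)
      then show "(\<lambda>x. A * exp (- 2 * x)) integrable_on {z..}" by (rule integrable_on_mult_right)
      show "norm (f x) \<le> A * exp (- 2 * x)" if "x \<in> {z..}" for x
        using that A(2) fpos[of x] z by auto
    qed auto
  qed
  define J where "J z = integral {z..} f" for z
  have Jup: "\<exists>A>0. \<forall>z\<ge>z0. J z \<le> A * exp (- 2 * z)" if z0: "z0 > 0" for z0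
  proof -
    obtain A where A: "A > 0" "\<forall>x\<ge>z0. f x \<le> A * exp (- 2 * x)" using fbound[OF z0] by blast
    have "J z \<le> A * exp (- 2 * z)" if "z \<ge> z0" for z
    proof -
      have "((\<lambda>x. A * exp (- 2 * x)) has_integral A * (exp (- 2 * z) / 2)) {z..}"
        by (intro has_integral_mult_right has_integral_exp_minus_to_infinity) auto
      then have "J z \<le> A * (exp (- 2 * z) / 2)" unfolding J_def
        using A(2) that z0 by (intro has_integral_le[OF integrable_integral[OF fint]]) auto
      also have "\<dots> \<le> A * exp (- 2 * z)" using A(1) by simp
      finally show ?thesis .
    qed
    then show ?thesis using A(1) by blast
  qed
  have Jsplit: "J x = integral {x..y} f + J y" if "0 < x" "x \<le> y" for x y
  proof -
    have "(f has_integral (integral {x..y} f + J y)) ({x..y} \<union> {y..})"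
    proof (rule has_integral_Un)
      show "(f has_integral integral {x..y} f) {x..y}"
        using fc that by (intro integrable_integral integrable_continuous_real) (auto intro: continuous_on_subset)
      show "(f has_integral J y) {y..}" unfolding J_def using that by (intro integrable_integral fint) auto
      have "{x..y} \<inter> {y..} \<subseteq> {y}" by auto
      then show "negligible ({x..y} \<inter> {y..})" using negligible_subset negligible_sing by blast
    qed
    moreover have "{x..y} \<union> {y..} = {x..}" using that by auto
    ultimately show ?thesis unfolding J_def by (simp add: integral_unique)
  qed
  \<comment> \<open>Near \<open>z\<close> the improper integral is the constant
    \<open>J (z/2)\<close> minus a proper integral, to which the fundamental theorem
    applies.\<close>
  have dJ: "(J has_real_derivative - f z) (at z)" if z: "z > 0" for z
  proof -
    have "((\<lambda>x. integral {z/2..x} f) has_real_derivative f z) (at z within {z/2..z+1})"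
      using fc z by (intro integral_has_real_derivative) (auto intro: continuous_on_subset)
    then have "((\<lambda>x. integral {z/2..x} f) has_real_derivative f z) (at z)"
      using z by (simp add: at_within_Icc_at)
    then have "((\<lambda>x. J (z/2) - integral {z/2..x} f) has_real_derivative - f z) (at z)"
      by (auto intro!: derivative_eq_intros)
    note * = this
    have eq: "J (z/2) - integral {z/2..x} f = J x" if "x \<in> {z/2<..}" for x
      using Jsplit[of "z/2" x] that z by simp
    show ?thesis
      using z by (intro has_field_derivative_transform_within_open[OF * open_greaterThan[of "z/2"] _ eq]) auto
  qed
  have Jnn: "J z \<ge> 0" if "z > 0" for z
    unfolding J_def using that fpos by (intro integral_nonneg fint) (auto intro!: less_imp_le)
  have Jpos: "J z > 0" if z: "z > 0" for z
  proof -
    have "J z > J (z + 1)"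
    proof (rule DERIV_neg_imp_decreasing[of z "z + 1" J])
      show "\<exists>y. (J has_real_derivative y) (at x) \<and> y < 0" if "z \<le> x" for x
        using dJ[of x] fpos[of x] that z by (intro exI[of _ "- f x"]) auto
    qed auto
    then show ?thesis using Jnn[of "z + 1"] z by linarith
  qed
  define m where "m z = w z * J z" for z
  define m1 where "m1 z = w1 z * J z - 1 / w z" for z
  have dm: "(m has_real_derivative m1 z) (at z)" if z: "z > 0" for z
  proof -
    have "(m has_real_derivative w1 z * J z + - f z * w z) (at z)"
      unfolding m_def[abs_def] using DERIV_mult[OF w(1)[OF z] dJ[OF z]] .
    moreover have "w1 z * J z + - f z * w z = m1 z" using w(3)[OF z] by (simp add: m1_def f_def power2_eq_square)
    ultimately show ?thesis by simp
  qed
  \<comment> \<open>The contributions w' / w^2 from J' and from the derivative of 1 / w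
    cancel.\<close>
  have dm1: "(m1 has_real_derivative (1 + b * (b - 1) / z\<^sup>2) * m z) (at z)" if z: "z > 0" for z
  proof -
    have "((\<lambda>z. 1 / w z) has_real_derivative - (w1 z * f z)) (at z)"
      using w(3)[OF z] by (auto intro!: derivative_eq_intros w(1) z simp: f_def power2_eq_square)
    from DERIV_diff[OF DERIV_mult[OF w(2)[OF z] dJ[OF z]] this]
    show ?thesis unfolding m1_def[abs_def] m_def by (simp add: algebra_simps)
  qed
  have mpos: "m z > 0" if "z > 0" for z unfolding m_def using w(3)[OF that] Jpos[OF that] by simp
  \<comment> \<open>Both \<open>w\<close> and \<open>w1\<close> are O(e^z) while J is O(e^(-2z));
    the remaining term 1 / w of \<open>m1\<close> is O(e^(-z)) by the lower growth bound.\<close>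
  have mbound: "\<exists>C>0. \<forall>z\<ge>z0. m z \<le> C * exp (- z) \<and> \<bar>m1 z\<bar> \<le> C * exp (- z)" if z0: "z0 > 0" for z0
  proof -
    obtain a C where a: "a > 0" "C > 0" "\<And>z. z \<ge> z0 \<Longrightarrow> a * exp z \<le> w z" "\<And>z. z \<ge> z0 \<Longrightarrow> w z \<le> C * exp z"
      using dominant_growth[OF b0 z0] unfolding w_def by metis
    obtain A where A: "A > 0" "\<And>z. z \<ge> z0 \<Longrightarrow> J z \<le> A * exp (- 2 * z)" using Jup[OF z0] by blast
    define D where "D = (1 + b / z0) * C * A + 1 / a"
    have e: "exp z * exp (- 2 * z) = exp (- z)" for z :: real by (simp flip: exp_add)
    have b1: "0 < w z * J z" "w z * J z \<le> C * A * exp (- z)" if z: "z \<ge> z0" for z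
    proof -
      show "0 < w z * J z" using mpos[of z] z z0 by (simp add: m_def)
      have "w z * J z \<le> (C * exp z) * (A * exp (- 2 * z))"
        using a A z z0 Jnn[of z] w(3)[of z] by (intro mult_mono) auto
      also have "\<dots> = C * A * exp (- z)" using e[of z] by (simp add: mult_ac)
      finally show "w z * J z \<le> C * A * exp (- z)" .
    qed
    have iw: "0 < 1 / w z" "1 / w z \<le> 1 / a * exp (- z)" if z: "z \<ge> z0" for z
    proof -
      show "0 < 1 / w z" using w(3)[of z] z z0 by simp
      have "1 / w z \<le> 1 / (a * exp z)" using a z z0 by (intro divide_left_mono mult_pos_pos) (auto intro: w(3))
      then show "1 / w z \<le> 1 / a * exp (- z)" by (simp add: exp_minus divide_inverse)
    qed
    have w1J: "0 \<le> w1 z * J z" "w1 z * J z \<le> (1 + b / z0) * C * A * exp (- z)" if z: "z \<ge> z0" for z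
    proof -
      show "0 \<le> w1 z * J z" using w(4)[of z] Jnn[of z] z z0 by simp
      have "w1 z \<le> (1 + b / z0) * w z"
      proof -
        have "(1 + b / z) * w z \<le> (1 + b / z0) * w z"
          using w(3)[of z] z z0 b0 by (intro mult_right_mono add_left_mono divide_left_mono) auto
        then show ?thesis using w(5)[of z] z z0 by linarith
      qed
      then have "w1 z * J z \<le> (1 + b / z0) * w z * J z" using Jnn[of z] z z0 by (intro mult_right_mono) auto
      also have "\<dots> = (1 + b / z0) * (w z * J z)" by simp
      also have "\<dots> \<le> (1 + b / z0) * (C * A * exp (- z))" using b1[OF z] z0 b0 by (intro mult_left_mono) auto
      finally show "w1 z * J z \<le> (1 + b / z0) * C * A * exp (- z)" by (simp only: mult.assoc)
    qed
    have "C * A * exp (- z) \<le> (1 + b / z0) * C * A * exp (- z)" for z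
      using a A z0 b0 by (intro mult_right_mono) auto
    then have "m z \<le> D * exp (- z) \<and> \<bar>m1 z\<bar> \<le> D * exp (- z)" if z: "z \<ge> z0" for z
      using b1[OF z] iw[OF z] w1J[OF z] a(1) unfolding m_def m1_def D_def distrib_right
      by (smt (verit) divide_pos_pos exp_gt_zero mult_pos_pos)
    moreover have "D > 0" unfolding D_def using a A z0 b0 by (intro add_nonneg_pos mult_nonneg_nonneg) auto
    ultimately show ?thesis by blast
  qed
  text \<open>\<open>Q\<close> is \<open>z k'(z)\<close> for \<open>k = m / sqrt z\<close>; were it nonnegative somewhere, \<open>k\<close> would increase from there on.\<close>
  define Q where "Q z = sqrt z * m1 z - m z / (2 * sqrt z)" for z
  define k where "k z = m z / sqrt z" for z
  have dk: "(k has_real_derivative Q z / z) (at z)" if z: "z > 0" for z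
  proof -
    have "(k has_real_derivative (m1 z * sqrt z - m z * (inverse (sqrt z) / 2)) / (sqrt z * sqrt z)) (at z)"
      unfolding k_def[abs_def] using z by (intro DERIV_divide dm DERIV_real_sqrt) auto
    then show ?thesis using z by (simp add: Q_def field_simps)
  qed
  \<comment> \<open>As b (b - 1) + 1/4 = (b - 1/2)^2, this is the modified Bessel equation of order
    b - 1/2 for m / sqrt z. Its right side is positive, so \<open>Q\<close> increases.\<close>
  have dQ: "(Q has_real_derivative sqrt z * (1 + (b - 1/2)\<^sup>2 / z\<^sup>2) * m z) (at z)" if z: "z > 0" for z
  proof -
    define s where "s = sqrt z"
    have s: "s > 0" "z = s * s" using z by (auto simp: s_def)
    have ds: "(sqrt has_real_derivative inverse s / 2) (at z)" unfolding s_def using DERIV_real_sqrt[OF z] .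
    have 1: "((\<lambda>x. sqrt x * m1 x) has_real_derivative inverse s / 2 * m1 z + (1 + b * (b - 1) / z\<^sup>2) * m z * s) (at z)"
      using DERIV_mult[OF ds dm1[OF z]] by (simp add: s_def)
    have 2: "((\<lambda>x. 2 * sqrt x) has_real_derivative inverse s) (at z)"
      using DERIV_cmult[OF ds, of 2] by simp
    have 3: "((\<lambda>x. m x / (2 * sqrt x)) has_real_derivative
        (m1 z * (2 * s) - m z * inverse s) / ((2 * s) * (2 * s))) (at z)"
      using DERIV_divide[OF dm[OF z] 2] s(1) by (simp add: s_def)
    have "(Q has_real_derivative (inverse s / 2 * m1 z + (1 + b * (b - 1) / z\<^sup>2) * m z * s)
        - (m1 z * (2 * s) - m z * inverse s) / ((2 * s) * (2 * s))) (at z)"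
      unfolding Q_def[abs_def] by (rule DERIV_diff[OF 1 3])
    moreover have "(inverse s / 2 * m1 z + (1 + b * (b - 1) / z\<^sup>2) * m z * s)
        - (m1 z * (2 * s) - m z * inverse s) / ((2 * s) * (2 * s)) = sqrt z * (1 + (b - 1/2)\<^sup>2 / z\<^sup>2) * m z"
      unfolding s_def[symmetric] using s(1) unfolding s(2)
      by (simp add: field_simps power2_eq_square)
    ultimately show ?thesis by simp
  qed
  have Qneg: "Q z < 0" if z: "z > 0" for z
  proof (rule ccontr)
    assume "\<not> Q z < 0"
    then have Qz: "Q z \<ge> 0" by simp
    have Qx: "Q x \<ge> 0" if "z \<le> x" for x
    proof -
      have "Q z \<le> Q x"
      proof (rule DERIV_nonneg_imp_nondecreasing[OF that])
        fix y assume "z \<le> y" "y \<le> x"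
        then have y: "y > 0" using z by linarith
        then show "\<exists>d. (Q has_real_derivative d) (at y) \<and> d \<ge> 0"
          using dQ[OF y] mpos[OF y] by (intro exI[of _ "sqrt y * (1 + (b - 1/2)\<^sup>2 / y\<^sup>2) * m y"]) auto
      qed
      then show ?thesis using Qz by linarith
    qed
    have kx: "k z \<le> k x" if "z \<le> x" for x
    proof (rule DERIV_nonneg_imp_nondecreasing[OF that])
      fix y assume "z \<le> y" "y \<le> x"
      then show "\<exists>d. (k has_real_derivative d) (at y) \<and> d \<ge> 0"
        using dk[of y] z Qx[of y] by (intro exI[of _ "Q y / y"]) auto
    qed
    obtain C where C: "C > 0" "\<forall>x\<ge>z. m x \<le> C * exp (- x)" using mbound[OF z] by blast
    have "k z \<le> C * exp (- x) / sqrt z" if "z \<le> x" for x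
    proof -
      have "k x \<le> C * exp (- x) / sqrt z"
        unfolding k_def using C that z mpos[of x] by (intro frac_le) auto
      then show ?thesis using kx[OF that] by linarith
    qed
    moreover have "((\<lambda>x. C * exp (- x) / sqrt z) \<longlongrightarrow> 0) at_top"
      using z by real_asymp
    ultimately have "k z \<le> 0"
      by (intro tendsto_lowerbound[of "\<lambda>x. C * exp (- x) / sqrt z" 0 at_top]) (auto intro: eventually_mono[OF eventually_ge_at_top[of z]])
    moreover have "k z > 0" unfolding k_def using mpos[OF z] z by simp
    ultimately show False by simp
  qed
  have sm: "smooth_on m {0<..}"
  proof -
    have sf: "smooth_on f {0<..}"
    proof -
      have "smooth_on (\<lambda>z. inverse (w z ^ 2)) {0<..}"
        by (intro smooth_on_compose_real[OF _ _ smooth_on_inverse] smooth_on_power w(6)) (use less_imp_neq[OF w(3)] in auto)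
      then show ?thesis unfolding f_def by (simp add: divide_inverse)
    qed
    have "smooth_on (\<lambda>z. (-1) * f z) {0<..}" by (intro smooth_on_mult smooth_on_const sf) auto
    then have "smooth_on J {0<..}"
      by (rule smooth_on_real_antideriv[rotated 2]) (auto intro: dJ)
    then show ?thesis unfolding m_def by (intro smooth_on_mult w(6)) auto
  qed
  \<comment> \<open>The sign of \<open>Q\<close> in the form that will make the data functional
    positive.\<close>
  have m2: "2 * z * m1 z < m z" if z: "z > 0" for z
  proof -
    have "sqrt z * m1 z < m z / (2 * sqrt z)" using Qneg[OF z] by (simp add: Q_def)
    then have "(sqrt z * m1 z) * (2 * sqrt z) < m z" using z by (simp add: pos_less_divide_eq)
    moreover have "(sqrt z * m1 z) * (2 * sqrt z) = 2 * (sqrt z * sqrt z) * m1 z" by simp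
    ultimately show ?thesis using z by simp
  qed
  show ?thesis by (rule that[OF sm dm dm1 mpos m2 mbound])
qed

section \<open>The time factor of the exponential weight\<close>

text \<open>Ansatz t^e m(\<zeta>) with \<zeta> = \<open>phi_speed l t\<close>. The exponent
  \<open>e\<close> makes the coefficient of m' vanish, 2 e + l - \<mu> = 0, and \<open>b\<close>
  satisfies (l + 1)^2 b (b - 1) = (\<delta> - (l + 1)^2) / 4, which absorbs the other zero-order
  terms; the Bessel order b - 1/2 is sqrt \<delta> / (2 (l + 1)). The inequality at t = 1 is the
  positivity of the data functional: its factor 1 + (\<mu> - 1 + sqrt \<delta>) / 2 is \<mu> minus
  (\<mu> - 1 - sqrt \<delta>) / 2, the coefficient of \<open>u0\<close> in the sign condition on the
  data.\<close>

lemma adjoint_time_solution: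
  fixes l \<mu> \<nu> \<delta> :: real
  assumes l: "l > -1" and \<delta>: "\<delta> = (\<mu> - 1)\<^sup>2 - 4 * \<nu>\<^sup>2" "\<delta> \<ge> 0"
  obtains lam lam1 lam2 C where "smooth_on lam {0<..}"
    "\<And>t. t > 0 \<Longrightarrow> (lam has_real_derivative lam1 t) (at t)"
    "\<And>t. t > 0 \<Longrightarrow> (lam1 has_real_derivative lam2 t) (at t)"
    "\<And>t. t > 0 \<Longrightarrow> lam2 t - \<mu> * (lam1 t / t - lam t / t\<^sup>2) + \<nu>\<^sup>2 / t\<^sup>2 * lam t - t powr (2 * l) * lam t = 0"
    "\<And>t. t > 0 \<Longrightarrow> lam t > 0" "(1 + (\<mu> - 1 + sqrt \<delta>) / 2) * lam 1 - lam1 1 > 0" "C > 0"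
    "\<And>t. t \<ge> 1 \<Longrightarrow> lam t \<le> C * t powr ((\<mu> - l) / 2) * exp (- phi_speed l t)"
    "\<And>t. t \<ge> 1 \<Longrightarrow> \<bar>lam1 t\<bar> \<le> C * t powr ((\<mu> - l) / 2 + l) * exp (- phi_speed l t)"
proof -
  define L where "L = l + 1"
  have L: "L > 0" "L \<noteq> 0" "l = L - 1" using l by (auto simp: L_def)
  define b where "b = sqrt \<delta> / (2 * L) + 1/2"
  define e where "e = (\<mu> - l) / 2"
  have b: "b \<ge> 1/2" using L \<delta> by (simp add: b_def)
  obtain m m1 where m: "smooth_on m {0<..}"
    "\<And>z. z > 0 \<Longrightarrow> (m has_real_derivative m1 z) (at z)"
    "\<And>z. z > 0 \<Longrightarrow> (m1 has_real_derivative (1 + b * (b - 1) / z\<^sup>2) * m z) (at z)"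
    "\<And>z. z > 0 \<Longrightarrow> m z > 0" "\<And>z. z > 0 \<Longrightarrow> 2 * z * m1 z < m z"
    "\<And>z0. z0 > 0 \<Longrightarrow> \<exists>C>0. \<forall>z\<ge>z0. m z \<le> C * exp (- z) \<and> \<bar>m1 z\<bar> \<le> C * exp (- z)"
    using decaying_solution[OF b] by blast
  define \<zeta> where "\<zeta> = phi_speed l"
  have \<zeta>: "\<zeta> = (\<lambda>t. t powr L / L)" by (auto simp: \<zeta>_def phi_speed_def L_def)
  have \<zeta>pos: "\<zeta> t > 0" if "t > 0" for t using that L by (simp add: \<zeta>)
  have d\<zeta>: "(\<zeta> has_real_derivative t powr l) (at t)" if "t > 0" for t
    unfolding \<zeta> using that L(2) by (auto intro!: derivative_eq_intros simp: L_def)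
  have dpow: "((\<lambda>t. t powr a) has_real_derivative a * t powr (a - 1)) (at t)" if "t > 0" for a t :: real
    using that by (auto intro!: derivative_eq_intros)
  define lam where "lam t = t powr e * m (\<zeta> t)" for t
  define lam1 where "lam1 t = e * t powr (e - 1) * m (\<zeta> t) + t powr (e + l) * m1 (\<zeta> t)" for t
  define m2 where "m2 z = (1 + b * (b - 1) / z\<^sup>2) * m z" for z
  define lam2 where "lam2 t = e * ((e - 1) * t powr (e - 2)) * m (\<zeta> t) + e * t powr (e - 1) * (m1 (\<zeta> t) * t powr l)
     + ((e + l) * t powr (e + l - 1) * m1 (\<zeta> t) + t powr (e + l) * (m2 (\<zeta> t) * t powr l))" for t
  have dm: "((\<lambda>t. m (\<zeta> t)) has_real_derivative m1 (\<zeta> t) * t powr l) (at t)"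
    and dm1: "((\<lambda>t. m1 (\<zeta> t)) has_real_derivative m2 (\<zeta> t) * t powr l) (at t)" if "t > 0" for t
    using DERIV_chain2[OF m(2)[OF \<zeta>pos[OF that]] d\<zeta>[OF that]]
      DERIV_chain2[OF m(3)[OF \<zeta>pos[OF that]] d\<zeta>[OF that]] by (simp_all add: m2_def)
  have d1: "(lam has_real_derivative lam1 t) (at t)" if t: "t > 0" for t
    using DERIV_mult[OF dpow[OF t, of e] dm[OF t]] t unfolding lam_def[abs_def] lam1_def
    by (simp add: powr_add algebra_simps)
  have d2: "(lam1 has_real_derivative lam2 t) (at t)" if t: "t > 0" for t
  proof -
    have "((\<lambda>t. e * t powr (e - 1)) has_real_derivative e * ((e - 1) * t powr (e - 2))) (at t)"
      using DERIV_cmult[OF dpow[OF t, of "e - 1"], of e] by simp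
    from DERIV_add[OF DERIV_mult[OF this dm[OF t]] DERIV_mult[OF dpow[OF t, of "e + l"] dm1[OF t]]]
    show ?thesis unfolding lam1_def[abs_def] lam2_def by (simp add: algebra_simps)
  qed
  have ode: "lam2 t - \<mu> * (lam1 t / t - lam t / t\<^sup>2) + \<nu>\<^sup>2 / t\<^sup>2 * lam t - t powr (2 * l) * lam t = 0" if t: "t > 0" for t
  proof -
    define X where "X = t powr e"
    define Y where "Y = t powr l"
    define M where "M = m (\<zeta> t)"
    define N where "N = m1 (\<zeta> t)"
    have Y: "Y > 0" "X > 0" using t by (auto simp: X_def Y_def)
    have p: "t powr (e - 1) = X / t" "t powr (e - 2) = X / t\<^sup>2" "t powr (e + l) = X * Y" "t powr (e + l - 1) = X * Y / t"
      "t powr (2 * l) = Y\<^sup>2"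
      using t by (auto simp: X_def Y_def powr_diff powr_add powr_numeral power2_eq_square) (simp flip: powr_add)
    have z: "\<zeta> t = Y * t / L" using t by (simp add: \<zeta> Y_def L(3) powr_diff)
    have cb: "b * (b - 1) = \<delta> / (4 * L\<^sup>2) - 1 / 4"
      using \<delta>(2) L(2) by (simp add: b_def field_simps power2_eq_square)
    have m2: "m2 (\<zeta> t) * (Y\<^sup>2 * t\<^sup>2) = (Y\<^sup>2 * t\<^sup>2 + (\<delta> - L\<^sup>2) / 4) * M"
      unfolding m2_def M_def[symmetric] unfolding z cb using t Y L(2)
      by (simp add: field_simps power2_eq_square)
    have c: "e * (e - 1) - \<mu> * e + \<mu> + \<nu>\<^sup>2 + (\<delta> - L\<^sup>2) / 4 = 0"
      unfolding \<delta>(1) e_def L_def by (simp add: field_simps power2_eq_square)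
    have e2: "2 * e + l - \<mu> = 0" by (simp add: e_def field_simps)
    have "(lam2 t - \<mu> * (lam1 t / t - lam t / t\<^sup>2) + \<nu>\<^sup>2 / t\<^sup>2 * lam t - t powr (2 * l) * lam t) * t\<^sup>2
      = X * M * (e * (e - 1) - \<mu> * e + \<mu> + \<nu>\<^sup>2) + X * Y * t * N * (2 * e + l - \<mu>)
        + X * (m2 (\<zeta> t) * (Y\<^sup>2 * t\<^sup>2)) - Y\<^sup>2 * t\<^sup>2 * X * M"
      unfolding lam2_def lam1_def lam_def p M_def[symmetric] N_def[symmetric] X_def[symmetric] Y_def[symmetric]
      using t by (simp add: field_simps power2_eq_square)
    also have "\<dots> = X * M * (e * (e - 1) - \<mu> * e + \<mu> + \<nu>\<^sup>2 + (\<delta> - L\<^sup>2) / 4) + X * Y * t * N * (2 * e + l - \<mu>)"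
      unfolding m2 by (simp add: algebra_simps)
    also have "\<dots> = 0" unfolding c e2 by simp
    finally show ?thesis using t by simp
  qed
  \<comment> \<open>At \<zeta>(1) = 1 / (l + 1) the bound 2 z m' < m reads 2 m' < (l + 1) m.
    Expanding the left side leaves half of (l + 1) m - 2 m' plus sqrt \<delta> m.\<close>
  have data: "(1 + (\<mu> - 1 + sqrt \<delta>) / 2) * lam 1 - lam1 1 > 0"
  proof -
    define z where "z = \<zeta> 1"
    have z: "z > 0" "z = 1 / L" using \<zeta>pos[of 1] by (auto simp: z_def \<zeta>)
    have "2 * z * m1 z < m z" using m(5)[OF z(1)] .
    then have "(2 * z * m1 z) * L < m z * L" using L by (intro mult_strict_right_mono) auto
    then have "2 * m1 z < L * m z" using z(2) L by (simp add: mult_ac)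
    moreover have "0 \<le> sqrt \<delta> * m z" using m(4)[OF z(1)] \<delta>(2) by simp
    moreover have "(1 + (\<mu> - 1 + sqrt \<delta>) / 2) * lam 1 - lam1 1 = (sqrt \<delta> * m z + (L * m z - 2 * m1 z)) / 2"
      unfolding lam_def lam1_def z_def[symmetric] e_def L_def by (simp add: field_simps)
    moreover have "0 < (s + (x - y)) / 2" if "y < x" "0 \<le> s" for s x y :: real
      using that by simp
    ultimately show ?thesis by metis
  qed
  obtain C where C: "C > 0" "\<And>z. z \<ge> \<zeta> 1 \<Longrightarrow> m z \<le> C * exp (- z) \<and> \<bar>m1 z\<bar> \<le> C * exp (- z)"
    using m(6)[OF \<zeta>pos[of 1]] by auto
  have \<zeta>ge: "\<zeta> t \<ge> \<zeta> 1" if "t \<ge> 1" for t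
    unfolding \<zeta> using that L by (intro divide_right_mono powr_mono2) auto
  have b1: "lam t \<le> C * t powr e * exp (- \<zeta> t)" if t: "t \<ge> 1" for t
    unfolding lam_def using C(2)[OF \<zeta>ge[OF t]] mult_left_mono[of "m (\<zeta> t)" "C * exp (- \<zeta> t)" "t powr e"] by (simp add: mult_ac)
  have b2: "\<bar>lam1 t\<bar> \<le> (\<bar>e\<bar> + 1) * C * t powr (e + l) * exp (- \<zeta> t)" if t: "t \<ge> 1" for t
  proof -
    have M: "0 < m (\<zeta> t)" "m (\<zeta> t) \<le> C * exp (- \<zeta> t)" "\<bar>m1 (\<zeta> t)\<bar> \<le> C * exp (- \<zeta> t)"
      using C(2)[OF \<zeta>ge[OF t]] m(4)[OF \<zeta>pos[of t]] t by auto
    \<comment> \<open>Because l > -1, the derivative of the power t^e is of lower order than the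
      derivative of m(\<zeta>).\<close>
    have tp: "t powr (e - 1) \<le> t powr (e + l)" using t l by (intro powr_mono) auto
    have "\<bar>lam1 t\<bar> \<le> \<bar>e\<bar> * t powr (e - 1) * m (\<zeta> t) + t powr (e + l) * \<bar>m1 (\<zeta> t)\<bar>"
      unfolding lam1_def using M(1) by (intro order_trans[OF abs_triangle_ineq]) (simp add: abs_mult)
    also have "\<dots> \<le> \<bar>e\<bar> * t powr (e + l) * (C * exp (- \<zeta> t)) + t powr (e + l) * (C * exp (- \<zeta> t))"
      using M tp by (intro add_mono mult_mono mult_left_mono) auto
    also have "\<dots> = (\<bar>e\<bar> + 1) * C * t powr (e + l) * exp (- \<zeta> t)" by (simp add: algebra_simps)
    finally show ?thesis .
  qed
  have sm: "smooth_on lam {0<..}"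
  proof -
    have "smooth_on \<zeta> {0<..}" unfolding \<zeta> divide_inverse
      by (intro smooth_on_mult smooth_on_powr smooth_on_const) auto
    then have "smooth_on (\<lambda>t. m (\<zeta> t)) {0<..}"
      by (intro smooth_on_compose_real[OF _ _ m(1)]) (use \<zeta>pos in auto)
    then show ?thesis unfolding lam_def by (intro smooth_on_mult smooth_on_powr) auto
  qed
  show ?thesis
  proof (rule that[OF sm d1 d2 ode _ data, of "(\<bar>e\<bar> + 1) * C"])
    show "lam t > 0" if "t > 0" for t using m(4)[OF \<zeta>pos[OF that]] that by (simp add: lam_def)
    show "0 < (\<bar>e\<bar> + 1) * C" using C(1) by (intro mult_pos_pos) auto
    show "lam t \<le> (\<bar>e\<bar> + 1) * C * t powr ((\<mu> - l) / 2) * exp (- phi_speed l t)" if "t \<ge> 1" for t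
    proof -
      have "C * t powr e * exp (- \<zeta> t) \<le> (\<bar>e\<bar> + 1) * C * t powr e * exp (- \<zeta> t)"
        using C(1) by (intro mult_right_mono) (auto simp: distrib_right)
      then show ?thesis using b1[OF that] unfolding \<zeta>_def e_def by linarith
    qed
    show "\<bar>lam1 t\<bar> \<le> (\<bar>e\<bar> + 1) * C * t powr ((\<mu> - l) / 2 + l) * exp (- phi_speed l t)" if "t \<ge> 1" for t
      using b2[OF that] unfolding \<zeta>_def e_def .
  qed
qed

subsection \<open>Radial eigenfunction of the Laplacian\<close>

definition laplacian :: "(real ^ 'n \<Rightarrow> real) \<Rightarrow> real ^ 'n \<Rightarrow> real" where
  "laplacian f x = (\<Sum>i\<in>UNIV. frechet_derivative (\<lambda>y. frechet_derivative f (at y) (axis i 1)) (at x) (axis i 1))"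

lemma frechet_derivative_cong_open:
  assumes "open U" "x \<in> U" "\<And>y. y \<in> U \<Longrightarrow> f y = g y" "g differentiable (at x)"
  shows "frechet_derivative f (at x) = frechet_derivative g (at x)"
  using frechet_derivative_transform_within_open[OF assms(4,1,2), of f] assms(3) by simp

lemma laplacian_cong_open:
  assumes "open U" "x \<in> U" "\<And>y. y \<in> U \<Longrightarrow> f y = g y" "smooth_on g U"
  shows "laplacian f x = laplacian g x"
  unfolding laplacian_def
proof (intro sum.cong refl)
  fix i
  have 1: "frechet_derivative f (at y) (axis i 1) = frechet_derivative g (at y) (axis i 1)" if "y \<in> U" for y
    by (simp add: frechet_derivative_cong_open[OF assms(1) that assms(3) smooth_on_imp_differentiable[OF assms(4) that]])
  have "axis i (1::real) \<in> Basis" by (simp add: axis_in_Basis_iff)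
  then have d: "(\<lambda>y. frechet_derivative g (at y) (axis i 1)) differentiable (at x)"
    by (rule smooth_on_imp_differentiable[OF smooth_on_frechet_derivative[OF assms(4)] assms(2)])
  show "frechet_derivative (\<lambda>y. frechet_derivative f (at y) (axis i 1)) (at x) (axis i 1) =
      frechet_derivative (\<lambda>y. frechet_derivative g (at y) (axis i 1)) (at x) (axis i 1)"
    by (simp only: frechet_derivative_cong_open[OF assms(1,2) 1 d])
qed

lemma laplacian_const: "laplacian (\<lambda>x. c) x = 0"
  by (simp add: laplacian_def)

text \<open>This is the mean of exp(x . w) over unit vectors w; in dimension one it is cosh |x|. The
  series in |x|^2 makes smoothness at the origin evident and treats all dimensions alike.\<close>

definition radial_eigenfunction :: "real ^ 'n \<Rightarrow> real" where
  "radial_eigenfunction x = bessel_series (real CARD('n) / 2) (x \<bullet> x)"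

lemma radial_eigenfunction_ge_1: "radial_eigenfunction (x :: real ^ 'n) \<ge> 1"
  unfolding radial_eigenfunction_def by (rule bessel_series_ge_1) auto

lemma smooth_on_norm_sq: "smooth_on (\<lambda>x :: real ^ 'n. x \<bullet> x) UNIV"
  unfolding inner_vec_def inner_real_def
  by (rule smooth_on_sum, simp, simp, rule smooth_on_mult) (auto intro: smooth_on_linear bounded_linear_vec_nth)

lemma smooth_on_radial_eigenfunction: "smooth_on (radial_eigenfunction :: real ^ 'n \<Rightarrow> real) UNIV"
proof -
  have "smooth_on (bessel_series (real CARD('n) / 2)) UNIV"
    using bessel_series_ode[of "real CARD('n) / 2"] by (metis zero_less_card_finite of_nat_0_less_iff half_gt_zero)
  then show ?thesis unfolding radial_eigenfunction_def[abs_def]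
    by (intro smooth_on_compose_real[OF _ _ _ smooth_on_norm_sq]) auto
qed

text \<open>The Laplacian of H(|x|^2) is 4 |x|^2 H'' + 2 n H', the left side of the equation for H
  exactly when the parameter is n / 2.\<close>

lemma laplacian_radial_eigenfunction: "laplacian radial_eigenfunction (x :: real ^ 'n) = radial_eigenfunction x"
proof -
  define a where "a = real CARD('n) / 2"
  have a: "a > 0" by (simp add: a_def)
  obtain H1 H2 where H: "\<And>z. (bessel_series a has_real_derivative H1 z) (at z)"
    "\<And>z. (H1 has_real_derivative H2 z) (at z)"
    "\<And>z. 4 * z * H2 z + 4 * a * H1 z = bessel_series a z"
    "\<And>z. 0 \<le> z \<Longrightarrow> 0 \<le> H1 z" "bessel_series a 0 = 1" "smooth_on (bessel_series a) UNIV"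
    using bessel_series_ode[OF a] by blast
  have sq: "((\<lambda>x. x \<bullet> x) has_derivative (\<lambda>v. 2 * (x \<bullet> v))) (at x)" for x :: "real ^ 'n"
    by (auto intro!: derivative_eq_intros simp: inner_commute)
  have d1: "(radial_eigenfunction has_derivative (\<lambda>v. H1 (x \<bullet> x) * (2 * (x \<bullet> v)))) (at x)" for x :: "real ^ 'n"
    unfolding radial_eigenfunction_def[abs_def] a_def[symmetric]
    using has_derivative_compose[OF sq H(1)[unfolded has_field_derivative_def]] .
  have f1: "frechet_derivative radial_eigenfunction (at x) (axis i 1) = 2 * x $ i * H1 (x \<bullet> x)" for x :: "real ^ 'n" and i
    using frechet_derivative_at[OF d1[of x]] by (metis inner_axis mult.commute mult.left_commute mult_1 real_inner_1_right)
  have d2: "((\<lambda>y. 2 * y $ i * H1 (y \<bullet> y)) has_derivative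
      (\<lambda>v. (2 * x $ i) * (H2 (x \<bullet> x) * (2 * (x \<bullet> v))) + (2 * v $ i) * H1 (x \<bullet> x))) (at x)" for x :: "real ^ 'n" and i
  proof -
    have "((\<lambda>y. 2 * y $ i) has_derivative (\<lambda>v. 2 * v $ i)) (at x)"
      by (intro bounded_linear_imp_has_derivative bounded_linear_const_mult bounded_linear_vec_nth)
    from has_derivative_mult[OF this has_derivative_compose[OF sq H(2)[unfolded has_field_derivative_def]]]
    show ?thesis .
  qed
  have f2: "frechet_derivative (\<lambda>y. frechet_derivative radial_eigenfunction (at y) (axis i 1)) (at x) (axis i 1)
      = 4 * H2 (x \<bullet> x) * (x $ i * x $ i) + 2 * H1 (x \<bullet> x)" for i
  proof -
    have "x \<bullet> axis i 1 = x $ i" "axis i 1 $ i = (1::real)" by (simp_all add: inner_axis)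
    then show ?thesis unfolding f1 frechet_derivative_at[OF d2, symmetric] by simp
  qed
  have "laplacian radial_eigenfunction x = 4 * H2 (x \<bullet> x) * (\<Sum>i\<in>UNIV. x $ i * x $ i) + (\<Sum>i\<in>(UNIV::'n set). 2 * H1 (x \<bullet> x))"
    unfolding laplacian_def f2 by (simp add: sum.distrib sum_distrib_left)
  also have "(\<Sum>i\<in>UNIV. x $ i * x $ i) = x \<bullet> x" by (simp add: inner_vec_def)
  also have "4 * H2 (x \<bullet> x) * (x \<bullet> x) + (\<Sum>i\<in>(UNIV::'n set). 2 * H1 (x \<bullet> x)) = bessel_series a (x \<bullet> x)"
    unfolding H(3)[symmetric] by (simp add: a_def)
  finally show ?thesis by (simp only: radial_eigenfunction_def[of x] a_def)
qed

text \<open>For b = (n - 1) / 2 the series parameter b + 1/2 is n / 2, so |x|^b times the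
  eigenfunction is \<open>dominant b\<close> at |x|, of known growth. Replacing |x| by 1 + |x| costs
  a factor 2^b for |x| \<ge> 1 and makes the bound meaningful at the origin; on the unit ball the
  series is at most its value at 1.\<close>

lemma radial_eigenfunction_bound:
  obtains C where "C > 0" "\<And>x :: real ^ 'n. radial_eigenfunction x \<le>
    C * (1 + norm x) powr (- ((real CARD('n) - 1) / 2)) * exp (norm x)"
proof -
  define b where "b = (real CARD('n) - 1) / 2"
  have b: "b \<ge> 0" "b + 1/2 = real CARD('n) / 2" by (auto simp: b_def field_simps Suc_leI)
  obtain a C where C: "C > 0" "\<And>z. z \<ge> 1 \<Longrightarrow> dominant b z \<le> C * exp z"
    using dominant_growth[OF b(1), of 1] by (metis zero_less_one)
  define B where "B = bessel_series (real CARD('n) / 2) 1"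
  have B: "B \<ge> 1" unfolding B_def by (rule bessel_series_ge_1) auto
  define D where "D = (C + B) * 2 powr b"
  have "radial_eigenfunction x \<le> D * (1 + norm x) powr (- b) * exp (norm x)" for x :: "real ^ 'n"
  proof (cases "norm x \<ge> 1")
    case True
    define r where "r = norm x"
    have r: "r \<ge> 1" using True by (simp add: r_def)
    have "dominant b r = r powr b * radial_eigenfunction x"
      unfolding dominant_def radial_eigenfunction_def b(2) r_def by (simp add: power2_norm_eq_inner)
    then have "r powr b * radial_eigenfunction x \<le> C * exp r" using C(2)[OF r] by simp
    then have "r powr (- b) * (r powr b * radial_eigenfunction x) \<le> r powr (- b) * (C * exp r)" by (intro mult_left_mono) auto
    moreover have "r powr (- b) * (r powr b * radial_eigenfunction x) = radial_eigenfunction x"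
      using r by (simp add: powr_minus)
    ultimately have 1: "radial_eigenfunction x \<le> r powr (- b) * (C * exp r)" by simp
    have "r powr (- b) \<le> ((1 + r) / 2) powr (- b)"  using r b by (intro powr_mono2') auto
    also have "\<dots> = (1 + r) powr (- b) / 2 powr (- b)" by (rule powr_divide)
    also have "\<dots> = 2 powr b * (1 + r) powr (- b)" by (simp add: powr_minus[of 2 b] divide_inverse)
    finally have "r powr (- b) * (C * exp r) \<le> 2 powr b * (1 + r) powr (- b) * ((C + B) * exp r)"
      using C B by (intro mult_mono) auto
    from order_trans[OF 1 this] show ?thesis unfolding D_def r_def[symmetric] by (simp only: mult_ac)
  next
    case False
    define r where "r = norm x"
    have r: "r < 1" "0 \<le> r" using False by (auto simp: r_def)
    have "x \<bullet> x \<le> 1" using False by (simp add: dot_square_norm abs_square_le_1)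
    then have 1: "radial_eigenfunction x \<le> B" unfolding radial_eigenfunction_def B_def by (intro bessel_series_mono) auto
    have "2 powr (- b) \<le> (1 + r) powr (- b)" using r b by (intro powr_mono2') auto
    then have "2 powr b * 2 powr (- b) \<le> 2 powr b * (1 + r) powr (- b)" by (intro mult_left_mono) auto
    then have "1 \<le> 2 powr b * (1 + r) powr (- b)" by (simp flip: powr_add)
    moreover have "1 \<le> exp r" using r by simp
    ultimately have "1 * 1 \<le> 2 powr b * (1 + r) powr (- b) * exp r" by (intro mult_mono) auto
    then have "(C + B) * 1 \<le> (C + B) * (2 powr b * (1 + r) powr (- b) * exp r)" using C B by (intro mult_left_mono) auto
    moreover have "radial_eigenfunction x \<le> (C + B) * 1" using 1 C by simp
    ultimately have "radial_eigenfunction x \<le> (C + B) * (2 powr b * (1 + r) powr (- b) * exp r)" by linarith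
    then show ?thesis unfolding D_def r_def[symmetric] by (simp only: mult_ac)
  qed
  moreover have "D > 0" using C B by (simp add: D_def)
  ultimately show ?thesis using that unfolding b_def by blast
qed

lemma test_functionI:
  assumes "smooth_on f UNIV" "\<And>x. f x \<noteq> 0 \<Longrightarrow> norm x \<le> r"
  shows "test_function f"
proof -
  have "{x. f x \<noteq> 0} \<subseteq> cball 0 r" using assms(2) by auto
  then have "bounded {x. f x \<noteq> 0}" using bounded_subset bounded_cball by blast
  then show ?thesis using assms(1) by (simp add: test_function_def compact_closure)
qed

lemma test_function_partial:
  fixes f :: "real ^ 'n \<Rightarrow> real"
  assumes "test_function f"
  shows "test_function (\<lambda>x. frechet_derivative f (at x) (axis i 1))"
proof -
  have s: "smooth_on f UNIV" and c: "compact (closure {x. f x \<noteq> 0})" using assms by (auto simp: test_function_def)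
  have "frechet_derivative f (at x) (axis i 1) = 0" if "x \<notin> closure {x. f x \<noteq> 0}" for x
  proof -
    have "f y = 0" if "y \<in> - closure {x. f x \<noteq> 0}" for y using that closure_subset[of "{x. f x \<noteq> 0}"] by auto
    note * = frechet_derivative_cong_open[OF open_Compl[OF closed_closure] _ this]
    have "frechet_derivative f (at x) = frechet_derivative (\<lambda>x. 0) (at x)"
      by (rule *) (use that in simp_all)
    then show ?thesis by simp
  qed
  then have sub: "{x. frechet_derivative f (at x) (axis i 1) \<noteq> 0} \<subseteq> closure {x. f x \<noteq> 0}" by auto
  have "bounded {x. frechet_derivative f (at x) (axis i 1) \<noteq> 0}"
    using bounded_subset[OF compact_imp_bounded[OF c] sub] .
  moreover have "smooth_on (\<lambda>x. frechet_derivative f (at x) (axis i 1)) UNIV"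
    by (rule smooth_on_frechet_derivative[OF s]) (simp add: axis_in_Basis_iff)
  ultimately show ?thesis by (simp add: test_function_def compact_closure)
qed

text \<open>Test functions need compact support, which the spatial weights lack. The argument |x|^2
  / (2 r^2) of the step is at most 1/2 on the ball, so nothing changes where the solution lives, and
  the ball is open, so the Laplacian is unchanged there as well.\<close>

lemma localized_test_function:
  fixes f :: "real ^ 'n \<Rightarrow> real"
  assumes "smooth_on f UNIV" "\<And>x. 0 \<le> f x" "r > 0"
  obtains b where "test_function b" "\<And>x. x \<in> ball 0 r \<Longrightarrow> b x = f x" "\<And>x. 0 \<le> b x"
    "\<And>x. x \<in> ball 0 r \<Longrightarrow> laplacian b x = laplacian f x"
proof -
  obtain h :: "real \<Rightarrow> real" where h: "smooth_on h UNIV" "\<And>x. x \<le> 1/2 \<Longrightarrow> h x = 1"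
    "\<And>x. 1 \<le> x \<Longrightarrow> h x = 0" "\<And>x. 0 \<le> h x" "\<And>x. h x \<le> 1"
    using smooth_step_exists by blast
  define b where "b x = f x * h (inverse (2 * r\<^sup>2) * (x \<bullet> x))" for x
  have s: "smooth_on b UNIV" unfolding b_def
    by (intro smooth_on_mult assms(1) smooth_on_compose_real[OF _ _ h(1)] smooth_on_const smooth_on_norm_sq) auto
  have eq: "b x = f x" if "x \<in> ball 0 r" for x
  proof -
    have "norm x < r" using that by simp
    then have "x \<bullet> x \<le> r\<^sup>2" by (simp add: dot_square_norm power_mono)
    then have "inverse (2 * r\<^sup>2) * (x \<bullet> x) \<le> 1/2" using assms(3) by (simp add: field_simps)
    then show ?thesis using h(2) by (simp add: b_def)
  qed
  have "norm x \<le> 2 * r" if "b x \<noteq> 0" for x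
  proof (rule ccontr)
    assume "\<not> norm x \<le> 2 * r"
    then have "(2 * r)\<^sup>2 \<le> (norm x)\<^sup>2" using assms(3) by (intro power_mono) auto
    then have "x \<bullet> x \<ge> 4 * r\<^sup>2" by (simp add: dot_square_norm power_mult_distrib)
    then have "x \<bullet> x \<ge> 2 * r\<^sup>2" using zero_le_power2[of r] by linarith
    then have "inverse (2 * r\<^sup>2) * (x \<bullet> x) \<ge> 1" using assms(3) by (simp add: field_simps)
    then show False using that h(3) by (simp add: b_def)
  qed
  then have "test_function b" by (rule test_functionI[OF s])
  moreover have "0 \<le> b x" for x using assms(2) h(4) by (simp add: b_def)
  moreover have "laplacian b x = laplacian f x" if "x \<in> ball 0 r" for x
    by (rule laplacian_cong_open[OF open_ball that eq smooth_on_subset[OF open_ball open_UNIV _ assms(1)]]) auto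
  ultimately show ?thesis using that eq by blast
qed

section \<open>Integrals of radial exponentials over balls\<close>

lemma measure_ball_lebesgue: "r \<ge> 0 \<Longrightarrow> measure lebesgue (ball (0 :: real ^ 'n) r) = unit_ball_vol (real CARD('n)) * r ^ CARD('n)"
  using content_ball[of r "0 :: real ^ 'n"] by simp

lemma power_diff_le_mult:
  fixes x y :: real
  assumes "0 \<le> x" "x \<le> y"
  shows "y ^ n - x ^ n \<le> real n * (y - x) * y ^ (n - 1)"
proof (induction n)
  case (Suc n)
  have "y ^ Suc n - x ^ Suc n = y * (y ^ n - x ^ n) + x ^ n * (y - x)" by (simp add: algebra_simps)
  also have "\<dots> \<le> y * (real n * (y - x) * y ^ (n - 1)) + y ^ n * (y - x)"
    using assms Suc by (intro add_mono mult_left_mono mult_right_mono power_mono) auto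
  also have "\<dots> = real (Suc n) * (y - x) * y ^ (Suc n - 1)"
    by (cases n) (auto simp: algebra_simps)
  finally show ?case .
qed simp

text \<open>The exponential concentrates the integral near the sphere, so the bound is the volume (1
  + r)^(n - 1) of a shell of fixed width times the integrand there. Shells of a fixed width
  \<open>d\<close> are added one at a time: the proposed bound \<open>K\<close> at least doubles
  from r to r + d, which pays for the new shell.\<close>

lemma integral_exp_weight_ball:
  fixes q s :: real
  assumes "q \<ge> 0" "s > 0"
  obtains C where "C > 0" "\<And>r. r \<ge> 0 \<Longrightarrow>
    (LINT x:ball (0 :: real ^ 'n) r|lebesgue. (1 + norm x) powr (- q) * exp (s * norm x))
      \<le> C * (1 + r) powr (real CARD('n) - 1 - q) * exp (s * r)"
proof -
  define f where "f x = (1 + norm x) powr (- q) * exp (s * norm x)" for x :: "real ^ 'n"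
  define I where "I r = (LINT x:ball (0 :: real ^ 'n) r|lebesgue. f x)" for r
  define n where "n = CARD('n)"
  define m where "m = real n - 1 - q"
  define K where "K r = (1 + r) powr m * exp (s * r)" for r
  define u where "u = unit_ball_vol (real n)"
  have n: "n \<ge> 1" by (simp add: n_def Suc_leI)
  have u: "u \<ge> 0" by (simp add: u_def)
  have fc: "continuous_on S f" for S unfolding f_def by (intro continuous_intros) (auto simp: add_nonneg_eq_0_iff)
  have fint: "set_integrable lebesgue (cball 0 r) f" for r
  proof -
    have "integrable lborel (\<lambda>x. indicator (cball 0 r) x *\<^sub>R f x)"
      by (rule borel_integrable_compact[OF compact_cball fc])
    then show ?thesis unfolding set_integrable_def by (simp add: integrable_completion)
  qed
  have fint': "set_integrable lebesgue S f" if "S \<in> sets lebesgue" "S \<subseteq> cball 0 r" for S r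
    using set_integrable_subset[OF fint that] .
  \<comment> \<open>Widening the ball by \<open>d\<close> changes (1 + r)^m by at most a factor (1 +
    d)^|m| in either direction; \<open>d\<close> is so large that e^(s d) beats this and still
    leaves a factor 2.\<close>
  obtain d where d: "d > 0" "exp (s * d) \<ge> 2 * (1 + d) powr \<bar>m\<bar>"
  proof -
    have "eventually (\<lambda>d. exp (s * d) \<ge> 2 * (1 + d) powr \<bar>m\<bar>) at_top" using assms(2) by real_asymp
    then have "eventually (\<lambda>d. exp (s * d) \<ge> 2 * (1 + d) powr \<bar>m\<bar> \<and> d > 0) at_top"
      using eventually_gt_at_top[of 0] by eventually_elim auto
    then obtain d where "exp (s * d) \<ge> 2 * (1 + d) powr \<bar>m\<bar>" "d > 0"
      using eventually_happens'[OF trivial_limit_at_top_linorder] by blast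
    then show ?thesis using that by blast
  qed
  have Kstep: "2 * K r \<le> K (r + d)" if r: "r \<ge> 0" for r
  proof -
    have "((1 + r) / (1 + (r + d))) powr m \<le> (1 + d) powr \<bar>m\<bar>"
    proof (cases "m \<ge> 0")
      case True
      have "((1 + r) / (1 + (r + d))) powr m \<le> 1 powr m" using r d True by (intro powr_mono2) auto
      also have "\<dots> \<le> (1 + d) powr \<bar>m\<bar>" using d by (simp add: ge_one_powr_ge_zero)
      finally show ?thesis .
    next
      case False
      have "(1 + (r + d)) / (1 + r) \<le> 1 + d" using r d by (simp add: field_simps)
      then have "((1 + (r + d)) / (1 + r)) powr (-m) \<le> (1 + d) powr (-m)" using False r d by (intro powr_mono2) auto
      moreover have "((1 + r) / (1 + (r + d))) powr m = ((1 + (r + d)) / (1 + r)) powr (-m)"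
        unfolding powr_divide by (simp add: powr_minus divide_inverse)
      ultimately show ?thesis using False by simp
    qed
    then have "(1 + r) powr m \<le> (1 + d) powr \<bar>m\<bar> * (1 + (r + d)) powr m"
      using r d unfolding powr_divide by (simp add: pos_divide_le_eq)
    then have "2 * K r \<le> 2 * ((1 + d) powr \<bar>m\<bar> * (1 + (r + d)) powr m) * exp (s * r)"
      unfolding K_def by simp
    also have "\<dots> = (2 * (1 + d) powr \<bar>m\<bar>) * (1 + (r + d)) powr m * exp (s * r)" by simp
    also have "\<dots> \<le> exp (s * d) * (1 + (r + d)) powr m * exp (s * r)"
      using d by (intro mult_right_mono) auto
    also have "\<dots> = K (r + d)" by (simp add: K_def algebra_simps exp_add)
    finally show ?thesis .
  qed
  define C1 where "C1 = exp (s * d) * u * real n * d * (1 + d) ^ (n - 1)"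
  have C1: "C1 \<ge> 0" using u d by (simp add: C1_def)
  have Istep: "I (r + d) \<le> I r + C1 * K r" if r: "r \<ge> 0" for r
  proof -
    define S where "S = ball (0 :: real ^ 'n) (r + d) - ball 0 r"
    have S: "S \<in> sets lebesgue" "S \<in> lmeasurable" "S \<subseteq> cball 0 (r + d)"
      unfolding S_def by (auto intro: fmeasurable_Diff)
    have b: "ball (0 :: real ^ 'n) r \<subseteq> cball 0 (r + d)" using d by auto
    have eq: "ball (0 :: real ^ 'n) (r + d) = ball 0 r \<union> S" using d by (auto simp: S_def)
    define M where "M = (1 + r) powr (- q) * exp (s * (r + d))"
    have fM: "f x \<le> M" if "x \<in> S" for x
    proof -
      have x: "r \<le> norm x" "norm x < r + d" using that by (auto simp: S_def)
      show ?thesis unfolding f_def M_def using x r assms by (intro mult_mono powr_mono2') auto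
    qed
    have "I (r + d) = I r + (LINT x:S|lebesgue. f x)"
      unfolding I_def eq
    proof (rule set_integral_Un)
      show "ball 0 r \<inter> S = {}" by (auto simp: S_def)
      show "set_integrable lebesgue (ball 0 r) f" using fint'[OF _ b] by simp
      show "set_integrable lebesgue S f" by (rule fint'[OF S(1,3)])
    qed
    also have "(LINT x:S|lebesgue. f x) \<le> (LINT x:S|lebesgue. M)"
    proof (rule set_integral_mono)
      show "set_integrable lebesgue S f" by (rule fint'[OF S(1,3)])
      show "set_integrable lebesgue S (\<lambda>x. M)"
      proof -
        have "integrable lebesgue (indicat_real S)"
          using S(2) by (intro integrable_real_indicator) (auto simp: fmeasurable_def)
        then show ?thesis unfolding set_integrable_def by simp
      qed
    qed (rule fM)
    also have "(LINT x:S|lebesgue. M) = M * measure lebesgue S"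
      using S(2) by (simp add: set_lebesgue_integral_def fmeasurable_def)
    also have "measure lebesgue S = u * ((r + d) ^ n - r ^ n)"
    proof -
      have "measure lebesgue S = measure lebesgue (ball (0 :: real ^ 'n) (r + d)) - measure lebesgue (ball (0 :: real ^ 'n) r)"
        unfolding S_def using d by (intro measurable_measure_Diff) auto
      then show ?thesis using r d by (simp only: measure_ball_lebesgue) (simp add: measure_ball_lebesgue u_def n_def algebra_simps)
    qed
    also have "M * (u * ((r + d) ^ n - r ^ n)) \<le> M * (u * (real n * d * ((1 + r) * (1 + d)) ^ (n - 1)))"
    proof -
      have "(r + d) ^ n - r ^ n \<le> real n * d * (r + d) ^ (n - 1)"
        using power_diff_le_mult[of r "r + d" n] r d by simp
      also have "\<dots> \<le> real n * d * ((1 + r) * (1 + d)) ^ (n - 1)"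
        using r d by (intro mult_left_mono power_mono) (auto simp: algebra_simps)
      finally show ?thesis using u by (intro mult_left_mono) (auto simp: M_def)
    qed
    also have "\<dots> = C1 * K r"
    proof -
      have "(1 + r) powr m = (1 + r) powr (- q) * (1 + r) ^ (n - 1)"
      proof -
        have "(1 + r) powr m = (1 + r) powr (- q + real (n - 1))" using n by (simp add: m_def of_nat_diff)
        also have "\<dots> = (1 + r) powr (- q) * (1 + r) ^ (n - 1)" using r by (simp only: powr_add powr_realpow)
        finally show ?thesis .
      qed
      moreover have "exp (s * (r + d)) = exp (s * r) * exp (s * d)" by (simp add: distrib_left exp_add)
      ultimately show ?thesis unfolding M_def C1_def K_def power_mult_distrib by (simp only: mult_ac)
    qed
    finally show ?thesis by simp
  qed
  \<comment> \<open>Start of the induction: on [0, d] the integral is at most \<open>I d\<close>,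
    while the continuous positive function \<open>K\<close> has a positive minimum.\<close>
  obtain C0 where C0: "C0 > 0" "\<And>r. 0 \<le> r \<Longrightarrow> r \<le> d \<Longrightarrow> I r \<le> C0 * K r"
  proof -
    have "compact (K ` {0..d})" unfolding K_def
      by (intro compact_continuous_image continuous_intros) auto
    then obtain x where x: "x \<in> {0..d}" "\<forall>y\<in>{0..d}. K x \<le> K y"
      using continuous_attains_inf[of "{0..d}" K] d unfolding K_def by (fastforce intro!: continuous_intros)
    have Kx: "K x > 0" using x(1) by (simp add: K_def)
    have Imono: "I r \<le> I d" if "0 \<le> r" "r \<le> d" for r
      unfolding I_def set_lebesgue_integral_def
    proof (rule integral_mono)
      have "ball (0 :: real ^ 'n) r \<subseteq> cball 0 d" "ball (0 :: real ^ 'n) d \<subseteq> cball 0 d" using that by auto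
      then show "integrable lebesgue (\<lambda>x. indicator (ball (0 :: real ^ 'n) r) x *\<^sub>R f x)"
        "integrable lebesgue (\<lambda>x. indicator (ball (0 :: real ^ 'n) d) x *\<^sub>R f x)"
        using fint'[of "ball 0 r" d] fint'[of "ball 0 d" d] unfolding set_integrable_def by auto
      show "indicator (ball (0 :: real ^ 'n) r) x *\<^sub>R f x \<le> indicator (ball (0 :: real ^ 'n) d) x *\<^sub>R f x" for x
        using that by (auto simp: f_def indicator_def)
    qed
    have "I r \<le> ((\<bar>I d\<bar> + 1) / K x) * K r" if "0 \<le> r" "r \<le> d" for r
    proof -
      have "I r \<le> (\<bar>I d\<bar> + 1) / K x * K x" using Imono[OF that] Kx by simp
      also have "\<dots> \<le> (\<bar>I d\<bar> + 1) / K x * K r" using x(2) that Kx by (intro mult_left_mono) auto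
      finally show ?thesis .
    qed
    moreover have "(\<bar>I d\<bar> + 1) / K x > 0" using Kx by simp
    ultimately show ?thesis using that by blast
  qed
  define C where "C = C0 + C1"
  \<comment> \<open>The constant survives the step because C1 \<le> C: (C + C1) K(r - d) \<le> C *
    (2 K(r - d)) \<le> C K(r).\<close>
  have main: "I r \<le> C * K r" if "0 \<le> r" "r \<le> real (Suc k) * d" for r k
    using that
  proof (induction k arbitrary: r)
    case 0
    then have "I r \<le> C0 * K r" using C0(2) by simp
    also have "\<dots> \<le> C * K r" unfolding C_def using C1 by (intro mult_right_mono) (auto simp: K_def)
    finally show ?case .
  next
    case (Suc k)
    show ?case
    proof (cases "r \<le> d")
      case True
      then have "I r \<le> C0 * K r" using C0(2) Suc by simp
      also have "\<dots> \<le> C * K r" unfolding C_def using C1 by (intro mult_right_mono) (auto simp: K_def)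
      finally show ?thesis .
    next
      case False
      have "I (r - d) \<le> C * K (r - d)" using Suc.IH[of "r - d"] Suc.prems False by (simp add: algebra_simps)
      then have "I r \<le> (C + C1) * K (r - d)" using Istep[of "r - d"] False by (simp add: distrib_right)
      also have "\<dots> \<le> (2 * C) * K (r - d)" unfolding C_def using C0 by (intro mult_right_mono) (auto simp: K_def)
      also have "\<dots> = C * (2 * K (r - d))" by simp
      also have "\<dots> \<le> C * K r" using Kstep[of "r - d"] False C0(1) C1 by (intro mult_left_mono) (auto simp: C_def)
      finally show ?thesis .
    qed
  qed
  have "I r \<le> C * K r" if "0 \<le> r" for r
  proof -
    obtain k where "r / d \<le> real k" using real_arch_simple by blast
    then have "r \<le> real (Suc k) * d" using d(1) by (simp add: field_simps)
    then show ?thesis by (rule main[OF that])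
  qed
  moreover have "C > 0" using C0 C1 by (simp add: C_def)
  ultimately show ?thesis using that[of C] unfolding I_def K_def f_def m_def n_def by (simp add: mult.assoc)
qed

subsection \<open>Pairings with test functions\<close>

lemma test_functionE:
  fixes b :: "real ^ 'n \<Rightarrow> real"
  assumes "test_function b"
  obtains K B where "continuous_on UNIV b" "compact K" "\<And>x. x \<notin> K \<Longrightarrow> b x = 0" "B > 0" "\<And>x. \<bar>b x\<bar> \<le> B"
proof -
  define K where "K = closure {x. b x \<noteq> 0}"
  have c: "continuous_on UNIV b" using assms smooth_on_imp_continuous_on by (auto simp: test_function_def)
  have K: "compact K" using assms by (simp add: K_def test_function_def)
  have z: "b x = 0" if "x \<notin> K" for x using that closure_subset[of "{x. b x \<noteq> 0}"] by (auto simp: K_def)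
  have "compact (b ` K)" using c K by (intro compact_continuous_image) (auto intro: continuous_on_subset)
  then obtain M where M: "\<forall>y\<in>b ` K. norm y \<le> M" using compact_imp_bounded bounded_iff by metis
  have "\<bar>b x\<bar> \<le> max M 1" for x
  proof (cases "x \<in> K")
    case True
    then have "\<bar>b x\<bar> \<le> M" using M by force
    then show ?thesis by simp
  qed (simp add: z)
  then show ?thesis using that[OF c K z, of "max M 1"] by auto
qed

lemma test_function_measurable: "test_function b \<Longrightarrow> b \<in> borel_measurable lebesgue"
  by (rule measurable_completion) (auto simp: test_function_def intro: borel_measurable_continuous_onI smooth_on_imp_continuous_on)

lemma integrable_L1_loc_times_test:
  fixes v :: "real ^ 'n \<Rightarrow> real"
  assumes "L1_loc v" "test_function b"
  shows "integrable lebesgue (\<lambda>x. v x * b x)"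
proof -
  obtain K B where b: "continuous_on UNIV b" "compact K" "\<And>x. x \<notin> K \<Longrightarrow> b x = 0" "B > 0" "\<And>x. \<bar>b x\<bar> \<le> B"
    using test_functionE[OF assms(2)] by blast
  have "(\<lambda>x. b x * v x) absolutely_integrable_on K"
  proof (rule absolutely_integrable_bounded_measurable_product[OF bilinear_times])
    show "b \<in> borel_measurable (lebesgue_on K)"
      by (rule measurable_restrict_space1[OF test_function_measurable[OF assms(2)]])
    show "K \<in> sets lebesgue" using b(2) by (simp add: lmeasurable_compact fmeasurableD)
    show "bounded (b ` K)" using b(5) by (auto simp: bounded_iff)
    show "v absolutely_integrable_on K" using assms(1) b(2) by (simp add: L1_loc_def)
  qed
  moreover have "indicator K x *\<^sub>R (b x * v x) = v x * b x" for x using b(3)[of x] by (cases "x \<in> K") auto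
  ultimately show ?thesis unfolding set_integrable_def by (simp only:)
qed

lemma abs_integral_L1_loc_times_test:
  fixes v :: "real ^ 'n \<Rightarrow> real"
  assumes "L1_loc v" "test_function b" "compact K" "\<And>x. x \<notin> K \<Longrightarrow> b x = 0" "\<And>x. \<bar>b x\<bar> \<le> B"
  shows "\<bar>LINT x|lebesgue. v x * b x\<bar> \<le> B * (LINT x:K|lebesgue. \<bar>v x\<bar>)"
proof -
  have vK: "v absolutely_integrable_on K" using assms by (simp add: L1_loc_def)
  have iv: "integrable lebesgue (\<lambda>x. indicator K x *\<^sub>R \<bar>v x\<bar>)"
    using set_integrable_abs[OF vK] by (simp add: set_integrable_def)
  have "\<bar>LINT x|lebesgue. v x * b x\<bar> \<le> (LINT x|lebesgue. \<bar>v x * b x\<bar>)" by (rule integral_abs_bound)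
  also have "\<dots> \<le> (LINT x|lebesgue. B * (indicator K x *\<^sub>R \<bar>v x\<bar>))"
  proof (rule integral_mono)
    show "integrable lebesgue (\<lambda>x. \<bar>v x * b x\<bar>)" using integrable_L1_loc_times_test[OF assms(1,2)] by simp
    show "integrable lebesgue (\<lambda>x. B * (indicator K x *\<^sub>R \<bar>v x\<bar>))" using iv by simp
    show "\<bar>v x * b x\<bar> \<le> B * (indicator K x *\<^sub>R \<bar>v x\<bar>)" for x
      using assms(4)[of x] mult_right_mono[OF assms(5)[of x], of "\<bar>v x\<bar>"] by (cases "x \<in> K") (auto simp: abs_mult mult_ac)
  qed
  also have "\<dots> = B * (LINT x:K|lebesgue. \<bar>v x\<bar>)" by (simp add: set_lebesgue_integral_def)
  finally show ?thesis .
qed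

lemma L1_loc_diff_scale:
  fixes v w :: "real ^ 'n \<Rightarrow> real"
  assumes "L1_loc v" "L1_loc w" "L1_loc z"
  shows "L1_loc (\<lambda>x. (v x - w x) / c - z x)" "L1_loc (\<lambda>x. v x - w x)"
  using assms unfolding L1_loc_def by (auto intro!: set_integral_diff)

text \<open>A test function is bounded with compact support, so the pairing is controlled by one of
  the seminorms of \<open>L1_loc\<close>. Continuity of the curve becomes continuity of a real
  function of time.\<close>

lemma cont_L1_loc_pairing:
  fixes v :: "real \<Rightarrow> real ^ 'n \<Rightarrow> real"
  assumes "cont_L1_loc I v" "test_function b"
  shows "continuous_on I (\<lambda>t. LINT x|lebesgue. v t x * b x)"
proof -
  obtain K B where b: "continuous_on UNIV b" "compact K" "\<And>x. x \<notin> K \<Longrightarrow> b x = 0" "B > 0" "\<And>x. \<bar>b x\<bar> \<le> B"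
    using test_functionE[OF assms(2)] by blast
  have L: "L1_loc (v t)" if "t \<in> I" for t using assms(1) that by (simp add: cont_L1_loc_def)
  show ?thesis unfolding continuous_on_def
  proof
    fix t0 assume t0: "t0 \<in> I"
    have "((\<lambda>t. LINT x:K|lebesgue. norm (v t x - v t0 x)) \<longlongrightarrow> 0) (at t0 within I)"
      using assms(1) t0 b(2) by (simp add: cont_L1_loc_def)
    then have "((\<lambda>t. B * (LINT x:K|lebesgue. norm (v t x - v t0 x))) \<longlongrightarrow> 0) (at t0 within I)"
      by (rule tendsto_mult_right_zero)
    then have "((\<lambda>t. (LINT x|lebesgue. v t x * b x) - (LINT x|lebesgue. v t0 x * b x)) \<longlongrightarrow> 0) (at t0 within I)"
    proof (rule Lim_null_comparison[rotated])
      show "\<forall>\<^sub>F t in at t0 within I. norm ((LINT x|lebesgue. v t x * b x) - (LINT x|lebesgue. v t0 x * b x))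
        \<le> B * (LINT x:K|lebesgue. norm (v t x - v t0 x))"
        unfolding eventually_at_filter
      proof (rule always_eventually, intro allI impI)
        fix t assume "t \<in> I"
        have "(LINT x|lebesgue. v t x * b x) - (LINT x|lebesgue. v t0 x * b x) = (LINT x|lebesgue. (v t x - v t0 x) * b x)"
          using integrable_L1_loc_times_test[OF L[OF \<open>t \<in> I\<close>] assms(2)] integrable_L1_loc_times_test[OF L[OF t0] assms(2)]
          by (simp add: left_diff_distrib)
        then show "norm ((LINT x|lebesgue. v t x * b x) - (LINT x|lebesgue. v t0 x * b x))
            \<le> B * (LINT x:K|lebesgue. norm (v t x - v t0 x))"
          using abs_integral_L1_loc_times_test[OF L1_loc_diff_scale(2)[OF L[OF \<open>t \<in> I\<close>] L[OF t0] L[OF t0]] assms(2) b(2,3,5)] by simp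
      qed
    qed
    then show "((\<lambda>t. LINT x|lebesgue. v t x * b x) \<longlongrightarrow> (LINT x|lebesgue. v t0 x * b x)) (at t0 within I)"
      by (simp add: LIM_zero_iff)
  qed
qed

lemma C1_L1_loc_pairing:
  fixes v :: "real \<Rightarrow> real ^ 'n \<Rightarrow> real"
  assumes "C1_L1_loc I v w" "test_function b" "t0 \<in> I"
  shows "((\<lambda>t. LINT x|lebesgue. v t x * b x) has_real_derivative (LINT x|lebesgue. w t0 x * b x)) (at t0 within I)"
proof -
  obtain K B where b: "continuous_on UNIV b" "compact K" "\<And>x. x \<notin> K \<Longrightarrow> b x = 0" "B > 0" "\<And>x. \<bar>b x\<bar> \<le> B"
    using test_functionE[OF assms(2)] by blast
  have L: "L1_loc (v t)" "L1_loc (w t)" if "t \<in> I" for t using assms(1) that by (auto simp: C1_L1_loc_def cont_L1_loc_def)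
  define Y where "Y t = (LINT x|lebesgue. v t x * b x)" for t
  define W where "W = (LINT x|lebesgue. w t0 x * b x)"
  have "((\<lambda>t. LINT x:K|lebesgue. \<bar>(v t x - v t0 x) / (t - t0) - w t0 x\<bar>) \<longlongrightarrow> 0) (at t0 within I)"
    using assms(1,3) b(2) by (simp add: C1_L1_loc_def)
  then have "((\<lambda>t. B * (LINT x:K|lebesgue. \<bar>(v t x - v t0 x) / (t - t0) - w t0 x\<bar>)) \<longlongrightarrow> 0) (at t0 within I)"
    by (rule tendsto_mult_right_zero)
  then have "((\<lambda>t. (Y t - Y t0) / (t - t0) - W) \<longlongrightarrow> 0) (at t0 within I)"
  proof (rule Lim_null_comparison[rotated])
    show "\<forall>\<^sub>F t in at t0 within I. norm ((Y t - Y t0) / (t - t0) - W)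
      \<le> B * (LINT x:K|lebesgue. \<bar>(v t x - v t0 x) / (t - t0) - w t0 x\<bar>)"
      unfolding eventually_at_filter
    proof (rule always_eventually, intro allI impI)
      fix t assume t: "t \<in> I"
      note i = integrable_L1_loc_times_test[OF L(1)[OF t] assms(2)] integrable_L1_loc_times_test[OF L(1)[OF assms(3)] assms(2)]
        integrable_L1_loc_times_test[OF L(2)[OF assms(3)] assms(2)]
      have "(Y t - Y t0) / (t - t0) - W = (LINT x|lebesgue. (v t x * b x - v t0 x * b x) / (t - t0) - w t0 x * b x)"
        using i by (simp add: Y_def W_def)
      also have "\<dots> = (LINT x|lebesgue. ((v t x - v t0 x) / (t - t0) - w t0 x) * b x)"
        by (intro Bochner_Integration.integral_cong refl) (simp add: left_diff_distrib)
      finally show "norm ((Y t - Y t0) / (t - t0) - W)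
          \<le> B * (LINT x:K|lebesgue. \<bar>(v t x - v t0 x) / (t - t0) - w t0 x\<bar>)"
        using abs_integral_L1_loc_times_test[OF L1_loc_diff_scale(1)[OF L(1)[OF t] L(1)[OF assms(3)] L(2)[OF assms(3)]] assms(2) b(2,3,5)] by simp
    qed
  qed
  then show ?thesis unfolding has_field_derivative_iff Y_def[symmetric] W_def[symmetric] by (simp add: LIM_zero_iff)
qed

lemma test_function_sum:
  fixes f :: "'n::finite \<Rightarrow> real ^ 'n \<Rightarrow> real"
  assumes "\<And>i. test_function (f i)"
  shows "test_function (\<lambda>x. \<Sum>i\<in>UNIV. f i x)"
proof -
  have "smooth_on (\<lambda>x. \<Sum>i\<in>UNIV. f i x) UNIV"
    using assms by (intro smooth_on_sum) (auto simp: test_function_def)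
  moreover have "{x. (\<Sum>i\<in>UNIV. f i x) \<noteq> 0} \<subseteq> (\<Union>i. {x. f i x \<noteq> 0})"
    by (auto intro: ccontr sum.neutral)
  moreover have "bounded {x. f i x \<noteq> 0}" for i
    using assms[of i] bounded_subset[OF compact_imp_bounded closure_subset] by (auto simp: test_function_def)
  ultimately show ?thesis
    using bounded_subset[of "\<Union>i. {x. f i x \<noteq> 0}" "{x. (\<Sum>i\<in>UNIV. f i x) \<noteq> 0}"]
    by (auto simp: test_function_def compact_closure bounded_UN)
qed

lemma test_function_laplacian: "test_function b \<Longrightarrow> test_function (laplacian b)"
  unfolding laplacian_def[abs_def] by (intro test_function_sum test_function_partial)

text \<open>The weak gradient is tested with each partial derivative of \<open>b\<close>, keeping
  the matching component of the vector identity; the sum over components is the Laplacian.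
  Integrability is checked separately so that the component may be taken inside the
  integral.\<close>

lemma weak_gradient_pairing:
  fixes f :: "real ^ 'n \<Rightarrow> real"
  assumes "has_weak_gradient f g" "test_function b"
  shows "(LINT x|lebesgue. g x \<bullet> grad b x) = - (LINT x|lebesgue. f x * laplacian b x)"
    "integrable lebesgue (\<lambda>x. g x \<bullet> grad b x)"
proof -
  define \<psi> where "\<psi> i x = frechet_derivative b (at x) (axis i 1)" for i x
  have \<psi>: "test_function (\<psi> i)" for i unfolding \<psi>_def[abs_def] by (rule test_function_partial[OF assms(2)])
  have Lf: "L1_loc f" and Lg: "L1_loc g" using assms(1) by (auto simp: has_weak_gradient_def)
  have Lgi: "L1_loc (\<lambda>x. g x $ i)" for i
    using Lg absolutely_integrable_component[where f = g and b = "axis i 1"] by (auto simp: L1_loc_def inner_axis)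
  have gi: "integrable lebesgue (\<lambda>x. g x $ i * \<psi> i x)" for i by (rule integrable_L1_loc_times_test[OF Lgi \<psi>])
  have lap: "laplacian b x = (\<Sum>i\<in>UNIV. frechet_derivative (\<psi> i) (at x) (axis i 1))" for x
    unfolding laplacian_def \<psi>_def[abs_def] ..
  have gp: "(LINT x|lebesgue. g x $ i * \<psi> i x) = - (LINT x|lebesgue. f x * frechet_derivative (\<psi> i) (at x) (axis i 1))" for i
  proof -
    have "(LINT x|lebesgue. f x *\<^sub>R grad (\<psi> i) x) = - (LINT x|lebesgue. \<psi> i x *\<^sub>R g x)"
      using assms(1) \<psi>[of i] by (simp add: has_weak_gradient_def)
    then have eq: "(LINT x|lebesgue. f x *\<^sub>R grad (\<psi> i) x) \<bullet> axis i 1 = - ((LINT x|lebesgue. \<psi> i x *\<^sub>R g x) \<bullet> axis i 1)" by simp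
    have i1: "integrable lebesgue (\<lambda>x. f x *\<^sub>R grad (\<psi> i) x)"
    proof -
      have "integrable lebesgue (\<lambda>x. \<Sum>c\<in>UNIV. (f x * frechet_derivative (\<psi> i) (at x) (axis c 1)) *\<^sub>R axis c (1::real))"
        by (intro Bochner_Integration.integrable_sum integrable_scaleR_left integrable_L1_loc_times_test[OF Lf] test_function_partial \<psi>)
      moreover have "(\<Sum>c\<in>UNIV. (f x * frechet_derivative (\<psi> i) (at x) (axis c 1)) *\<^sub>R axis c (1::real)) = f x *\<^sub>R grad (\<psi> i) x" for x
        by (simp add: vec_eq_iff grad_def axis_def if_distrib cong: if_cong)
      ultimately show ?thesis by simp
    qed
    have i2: "integrable lebesgue (\<lambda>x. \<psi> i x *\<^sub>R g x)"
    proof -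
      have "integrable lebesgue (\<lambda>x. \<Sum>c\<in>UNIV. (g x $ c * \<psi> i x) *\<^sub>R axis c (1::real))"
        by (intro Bochner_Integration.integrable_sum integrable_scaleR_left integrable_L1_loc_times_test[OF Lgi] \<psi>)
      moreover have "(\<Sum>c\<in>UNIV. (g x $ c * \<psi> i x) *\<^sub>R axis c (1::real)) = \<psi> i x *\<^sub>R g x" for x
        by (simp add: vec_eq_iff axis_def if_distrib mult_ac cong: if_cong)
      ultimately show ?thesis by simp
    qed
    have "(LINT x|lebesgue. f x *\<^sub>R grad (\<psi> i) x) \<bullet> axis i 1 = (LINT x|lebesgue. (f x *\<^sub>R grad (\<psi> i) x) \<bullet> axis i 1)"
      by (rule integral_inner_left[symmetric]) (use i1 in auto)
    moreover have "(LINT x|lebesgue. \<psi> i x *\<^sub>R g x) \<bullet> axis i 1 = (LINT x|lebesgue. (\<psi> i x *\<^sub>R g x) \<bullet> axis i 1)"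
      by (rule integral_inner_left[symmetric]) (use i2 in auto)
    ultimately show ?thesis using eq by (simp add: inner_axis grad_def mult_ac)
  qed
  have gr: "g x \<bullet> grad b x = (\<Sum>i\<in>UNIV. g x $ i * \<psi> i x)" for x
    by (simp add: inner_vec_def grad_def \<psi>_def)
  show "integrable lebesgue (\<lambda>x. g x \<bullet> grad b x)" unfolding gr by (intro Bochner_Integration.integrable_sum gi)
  have "(LINT x|lebesgue. g x \<bullet> grad b x) = (\<Sum>i\<in>UNIV. LINT x|lebesgue. g x $ i * \<psi> i x)"
    unfolding gr by (rule Bochner_Integration.integral_sum) (rule gi)
  also have "\<dots> = - (\<Sum>i\<in>UNIV. LINT x|lebesgue. f x * frechet_derivative (\<psi> i) (at x) (axis i 1))"
    unfolding gp by (simp add: sum_negf)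
  also have "(\<Sum>i\<in>UNIV. LINT x|lebesgue. f x * frechet_derivative (\<psi> i) (at x) (axis i 1)) = (LINT x|lebesgue. f x * laplacian b x)"
    unfolding lap sum_distrib_left
    by (rule Bochner_Integration.integral_sum[symmetric]) (intro integrable_L1_loc_times_test[OF Lf] test_function_partial \<psi>)
  finally show "(LINT x|lebesgue. g x \<bullet> grad b x) = - (LINT x|lebesgue. f x * laplacian b x)" .
qed

section \<open>Supports, time slices and separated test functions\<close>

text \<open>The complement of the essential support is a possibly uncountable union of open sets on
  which \<open>f\<close> vanishes almost everywhere. By Lindelof countably many of them suffice, and
  countably many null sets form a null set.\<close>

lemma AE_zero_outside_ess_support:
  fixes f :: "real ^ 'n \<Rightarrow> real"
  assumes "ess_support f \<subseteq> S"
  shows "AE x in lebesgue. x \<notin> S \<longrightarrow> f x = 0"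
proof -
  define \<F> where "\<F> = {U. open U \<and> (AE x in lebesgue. x \<in> U \<longrightarrow> f x = 0)}"
  obtain \<F>' where F: "\<F>' \<subseteq> \<F>" "countable \<F>'" "\<Union>\<F>' = \<Union>\<F>"
    using Lindelof[of \<F>] by (auto simp: \<F>_def)
  have "AE x in lebesgue. \<forall>U\<in>\<F>'. x \<in> U \<longrightarrow> f x = 0"
    using F by (subst AE_ball_countable) (auto simp: \<F>_def)
  then show ?thesis
  proof (rule eventually_mono)
    fix x assume x: "\<forall>U\<in>\<F>'. x \<in> U \<longrightarrow> f x = 0"
    show "x \<notin> S \<longrightarrow> f x = 0"
    proof
      assume "x \<notin> S"
      then have "x \<in> \<Union>\<F>" using assms by (auto simp: ess_support_def \<F>_def)
      then show "f x = 0" using x F(3) by auto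
    qed
  qed
qed

text \<open>Fubini's theorem applies to the product of Borel measures, while the hypothesis concerns
  the completed measure on the product. A Borel representative \<open>g'\<close> bridges the gap:
  almost every slice of \<open>g\<close> agrees almost everywhere with that of
  \<open>g'\<close>.\<close>

lemma absolutely_integrable_slices:
  fixes f :: "real \<times> (real ^ 'n) \<Rightarrow> real"
  assumes "f absolutely_integrable_on (A \<times> UNIV)"
  shows "AE s in lebesgue. s \<in> A \<longrightarrow> integrable lebesgue (\<lambda>x. f (s, x))"
    and "(\<lambda>s. LINT x|lebesgue. f (s, x)) absolutely_integrable_on A"
proof -
  define g where "g z = indicator (A \<times> UNIV) z *\<^sub>R f z" for z
  have g: "integrable lebesgue g" using assms by (simp add: set_integrable_def g_def[abs_def])
  obtain g' where g': "g' \<in> borel_measurable lborel" "AE z in lborel. g z = g' z"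
    using completion_ex_borel_measurable_real borel_measurable_integrable[OF g] by blast
  have g'm: "g' \<in> borel_measurable lebesgue" using g'(1) by (rule measurable_completion)
  have "integrable lebesgue g'"
    using g g'm AE_completion[OF g'(2)] by (subst integrable_cong_AE[of g' lebesgue g]) (auto elim: eventually_mono)
  then have "integrable lborel g'" using g'(1) by (simp add: integrable_completion)
  then have gi: "integrable (lborel \<Otimes>\<^sub>M lborel) g'" by (simp only: lborel_prod)
  have a1: "AE s in lborel. integrable lborel (\<lambda>x. g' (s, x))" by (rule lborel_pair.AE_integrable_fst'[OF gi])
  have i1: "integrable lborel (\<lambda>s. LINT x|lborel. g' (s, x))" by (rule lborel_pair.integrable_fst'[OF gi])
  have "AE z in lborel \<Otimes>\<^sub>M lborel. g z = g' z" using g'(2) by (simp only: lborel_prod)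
  then have a2: "AE s in lborel. AE x in lborel. g (s, x) = g' (s, x)" by (rule lborel_pair.AE_pair)
  have good: "integrable lebesgue (\<lambda>x. g (s, x)) \<and> (LINT x|lebesgue. g (s, x)) = (LINT x|lborel. g' (s, x))"
    if s: "integrable lborel (\<lambda>x. g' (s, x))" "AE x in lborel. g (s, x) = g' (s, x)" for s
  proof -
    have m: "(\<lambda>x. g' (s, x)) \<in> borel_measurable lborel" using s(1) by simp
    have m': "(\<lambda>x. g' (s, x)) \<in> borel_measurable lebesgue" using m by (rule measurable_completion)
    have ae: "AE x in lebesgue. g (s, x) = g' (s, x)" using s(2) by (rule AE_completion)
    have mg: "(\<lambda>x. g (s, x)) \<in> borel_measurable lebesgue"
      by (rule borel_measurable_AE[OF m']) (use ae in \<open>auto elim: eventually_mono\<close>)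
    have "integrable lebesgue (\<lambda>x. g' (s, x))" using s(1) m by (simp add: integrable_completion)
    then have "integrable lebesgue (\<lambda>x. g (s, x))" using integrable_cong_AE[OF mg m' ae] by simp
    moreover have "(LINT x|lebesgue. g (s, x)) = (LINT x|lebesgue. g' (s, x))" by (rule integral_cong_AE[OF mg m' ae])
    moreover have "\<dots> = (LINT x|lborel. g' (s, x))" by (rule integral_completion[OF m])
    ultimately show ?thesis by simp
  qed
  have ae: "AE s in lborel. integrable lebesgue (\<lambda>x. g (s, x)) \<and> (LINT x|lebesgue. g (s, x)) = (LINT x|lborel. g' (s, x))"
    using a1 a2 by eventually_elim (rule good)
  show "AE s in lebesgue. s \<in> A \<longrightarrow> integrable lebesgue (\<lambda>x. f (s, x))"
    using AE_completion[OF ae] by eventually_elim (auto simp: g_def indicator_def)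
  have "integrable lebesgue (\<lambda>s. LINT x|lborel. g' (s, x))"
    using i1 borel_measurable_integrable[OF i1] by (simp add: integrable_completion)
  moreover have "AE s in lebesgue. (LINT x|lborel. g' (s, x)) = (LINT x|lebesgue. g (s, x))"
    using AE_completion[OF ae] by eventually_elim simp
  moreover from this have "(\<lambda>s. LINT x|lebesgue. g (s, x)) \<in> borel_measurable lebesgue"
    by (rule borel_measurable_AE[rotated]) (use i1 in \<open>auto intro: measurable_completion\<close>)
  ultimately have "integrable lebesgue (\<lambda>s. LINT x|lebesgue. g (s, x))"
    using integrable_cong_AE[of "\<lambda>s. LINT x|lborel. g' (s, x)" lebesgue "\<lambda>s. LINT x|lebesgue. g (s, x)"] by simp
  moreover have "(LINT x|lebesgue. g (s, x)) = indicator A s *\<^sub>R (LINT x|lebesgue. f (s, x))" for s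
    by (cases "s \<in> A") (auto simp: g_def)
  ultimately show "(\<lambda>s. LINT x|lebesgue. f (s, x)) absolutely_integrable_on A" by (simp add: set_integrable_def)
qed

text \<open>Smoothness of \<open>a\<close> on t > 0 provides the open neighbourhood of [1,T). The
  support lies in [1, \<tau>] times that of \<open>b\<close>, a compact set inside the domain
  because \<tau> < T.\<close>

lemma spacetime_test_function_product:
  fixes b :: "real ^ 'n \<Rightarrow> real"
  assumes "smooth_on a {0<..}" "test_function b" "ereal \<tau> < T" "\<And>s. s \<ge> \<tau> \<Longrightarrow> a s = 0"
  shows "spacetime_test_function T (\<lambda>z. a (fst z) * b (snd z))"
proof -
  define U where "U = {0::real<..} \<times> (UNIV :: (real ^ 'n) set)"
  have U: "open U" by (auto simp: U_def intro: open_Times)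
  have sm: "smooth_on (\<lambda>z. a (fst z) * b (snd z)) U"
  proof (intro smooth_on_mult[OF U])
    show "smooth_on (\<lambda>z. a (fst z)) U"
      by (rule smooth_on_compose_linear[OF U _ bounded_linear_fst _ assms(1)]) (auto simp: U_def)
    show "smooth_on (\<lambda>z. b (snd z)) U"
      by (rule smooth_on_compose_linear[OF U open_UNIV bounded_linear_snd]) (use assms(2) in \<open>auto simp: test_function_def\<close>)
  qed
  have dom: "time_dom T \<times> UNIV \<subseteq> U" by (auto simp: time_dom_def U_def)
  define S where "S = closure {z \<in> time_dom T \<times> UNIV. a (fst z) * b (snd z) \<noteq> 0}"
  have S: "S \<subseteq> {1..\<tau>} \<times> closure {x. b x \<noteq> 0}" unfolding S_def
  proof (rule closure_minimal)
    show "{z \<in> time_dom T \<times> UNIV. a (fst z) * b (snd z) \<noteq> 0} \<subseteq> {1..\<tau>} \<times> closure {x. b x \<noteq> 0}"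
      using assms(4) closure_subset[of "{x. b x \<noteq> 0}"] by (auto simp: time_dom_def not_le intro: less_imp_le ccontr)
    show "closed ({1..\<tau>} \<times> closure {x. b x \<noteq> 0})" by (intro closed_Times) auto
  qed
  have "compact ({1..\<tau>} \<times> closure {x. b x \<noteq> 0})"
    using assms(2) by (intro compact_Times) (auto simp: test_function_def)
  moreover have "closed S" by (simp add: S_def)
  ultimately have cS: "compact S" using S compact_Int_closed[of "{1..\<tau>} \<times> closure {x. b x \<noteq> 0}" S] by (simp add: Int_absorb1)
  have "S \<subseteq> time_dom T \<times> UNIV"
  proof
    fix z assume "z \<in> S"
    then have "1 \<le> fst z" "fst z \<le> \<tau>" using S by auto
    then have "ereal (fst z) < T" using assms(3) by (meson ereal_less_eq(3) le_less_trans)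
    then show "z \<in> time_dom T \<times> UNIV" using \<open>1 \<le> fst z\<close> by (cases z) (auto simp: time_dom_def)
  qed
  then show ?thesis
    unfolding spacetime_test_function_def Let_def S_def[symmetric] using U dom sm cS by (intro conjI exI[of _ U]) simp_all
qed

lemma grad_scaled:
  assumes "smooth_on b UNIV"
  shows "grad (\<lambda>y. c * b y) x = c *\<^sub>R grad b x"
proof -
  have "(b has_derivative frechet_derivative b (at x)) (at x)"
    using smooth_on_imp_differentiable[OF assms, of x] by (simp add: frechet_derivative_works)
  then have "((\<lambda>y. c * b y) has_derivative (\<lambda>v. c * frechet_derivative b (at x) v)) (at x)"
    by (rule has_derivative_mult_right)
  from frechet_derivative_at[OF this, symmetric] show ?thesis by (simp add: grad_def vec_eq_iff)
qed

text \<open>The two integrations by parts: in space through the weak gradient, in time through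
  \<open>C\<^sup>1([1,T), L\<^sup>1\<^sub>l\<^sub>o\<^sub>c)\<close>.\<close>

lemma weak_solution_separated_test:
  fixes u :: "real \<Rightarrow> real ^ 'n \<Rightarrow> real" and l \<mu> \<nu> p R \<epsilon> \<tau> :: real
  assumes sol: "weak_solution l \<mu> \<nu> p R u0 u1 \<epsilon> T u" and \<tau>: "1 < \<tau>" "ereal \<tau> < T"
    and b: "test_function b" and a: "smooth_on a {0<..}" "\<And>s. s \<ge> \<tau> \<Longrightarrow> a s = 0"
    and da: "\<And>s. s > 0 \<Longrightarrow> (a has_real_derivative a1 s) (at s)"
    and da1: "\<And>s. s > 0 \<Longrightarrow> (a1 has_real_derivative a2 s) (at s)"
    and a2: "continuous_on {0<..} a2"
    and u0: "L1_loc u0"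
  defines "Y \<equiv> \<lambda>s. LINT x|lebesgue. u s x * b x"
    and "Z \<equiv> \<lambda>s. LINT x|lebesgue. u s x * laplacian b x"
  shows "AE s in lebesgue. s \<in> {1..\<tau>} \<longrightarrow> integrable lebesgue (\<lambda>x. \<bar>u s x\<bar> powr p * (a s * b x))"
    "(\<lambda>s. LINT x|lebesgue. \<bar>u s x\<bar> powr p * (a s * b x)) absolutely_integrable_on {1..\<tau>}"
    "continuous_on {1..\<tau>} Y" "continuous_on {1..\<tau>} Z"
    "\<epsilon> * (a 1 * (LINT x|lebesgue. u1 x * b x) + (\<mu> * a 1 - a1 1) * (LINT x|lebesgue. u0 x * b x))
      + (LINT s:{1..\<tau>}|lebesgue. LINT x|lebesgue. \<bar>u s x\<bar> powr p * (a s * b x))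
      = (LINT s:{1..\<tau>}|lebesgue. Y s * (a2 s - \<mu> * (a1 s / s - a s / s\<^sup>2) + \<nu>\<^sup>2 / s\<^sup>2 * a s) - s powr (2 * l) * a s * Z s)"
proof -
  have bs: "smooth_on b UNIV" using b by (simp add: test_function_def)
  have pos: "s > 0" if "s \<in> {1..\<tau>}" for s :: real using that by simp
  have tfun: "spacetime_test_function T (\<lambda>z. a (fst z) * b (snd z))"
    by (rule spacetime_test_function_product[OF a(1) b \<tau>(2) a(2)])
  obtain ut gu where sol1: "cont_W11_loc (time_dom T) u gu" "C1_L1_loc (time_dom T) u ut"
    "AE x in lebesgue. u 1 x = \<epsilon> * u0 x"
    and sol2: "\<And>t \<phi>. 1 < t \<Longrightarrow> ereal t < T \<Longrightarrow> spacetime_test_function T \<phi> \<Longrightarrow>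
           (\<lambda>(s, x). \<bar>u s x\<bar> powr p * \<phi> (s, x)) absolutely_integrable_on ({1..t} \<times> UNIV) \<and>
           (LINT x|lebesgue. ut t x * \<phi> (t, x))
           + (LINT s:{1..t}|lebesgue. (LINT x|lebesgue.
                - ut s x * deriv (\<lambda>r. \<phi> (r, x)) s
                + s powr (2 * l) * (gu s x \<bullet> grad (\<lambda>y. \<phi> (s, y)) x)))
           + (LINT s:{1..t}|lebesgue. (LINT x|lebesgue.
                \<mu> / s * ut s x * \<phi> (s, x) + \<nu>\<^sup>2 / s\<^sup>2 * u s x * \<phi> (s, x)))
           = \<epsilon> * (LINT x|lebesgue. u1 x * \<phi> (1, x))
             + (LINT s:{1..t}|lebesgue. (LINT x|lebesgue. \<bar>u s x\<bar> powr p * \<phi> (s, x)))"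
    using sol unfolding weak_solution_def by blast
  \<comment> \<open>The weak identity is used at the final time \<tau>, where \<open>a\<close>
    vanishes and with it the term containing \<open>ut\<close> at that time.\<close>
  note main = sol2[OF \<tau> tfun, simplified]
  have ai: "(\<lambda>z. \<bar>u (fst z) (snd z)\<bar> powr p * (a (fst z) * b (snd z))) absolutely_integrable_on ({1..\<tau>} \<times> UNIV)"
    using main by (simp add: case_prod_beta')
  show "AE s in lebesgue. s \<in> {1..\<tau>} \<longrightarrow> integrable lebesgue (\<lambda>x. \<bar>u s x\<bar> powr p * (a s * b x))"
    "(\<lambda>s. LINT x|lebesgue. \<bar>u s x\<bar> powr p * (a s * b x)) absolutely_integrable_on {1..\<tau>}"
    using absolutely_integrable_slices[OF ai] by simp_all
  have sub: "{1..\<tau>} \<subseteq> time_dom T"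
  proof
    fix s assume "s \<in> {1..\<tau>}"
    then have "1 \<le> s" "ereal s \<le> ereal \<tau>" by auto
    then show "s \<in> time_dom T" using le_less_trans[OF _ \<tau>(2)] by (simp add: time_dom_def)
  qed
  define Y1 where "Y1 s = (LINT x|lebesgue. ut s x * b x)" for s
  have Lu: "L1_loc (u s)" and Lut: "L1_loc (ut s)" and wg: "has_weak_gradient (u s) (gu s)" if "s \<in> {1..\<tau>}" for s
    using sol1(1,2) sub that by (auto simp: cont_W11_loc_def C1_L1_loc_def cont_L1_loc_def)
  have cu: "cont_L1_loc (time_dom T) u" "cont_L1_loc (time_dom T) ut"
    using sol1(2) by (auto simp: C1_L1_loc_def)
  show cY: "continuous_on {1..\<tau>} Y" unfolding Y_def
    by (rule continuous_on_subset[OF cont_L1_loc_pairing[OF cu(1) b] sub])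
  show cZ: "continuous_on {1..\<tau>} Z" unfolding Z_def
    by (rule continuous_on_subset[OF cont_L1_loc_pairing[OF cu(1) test_function_laplacian[OF b]] sub])
  have cY1: "continuous_on {1..\<tau>} Y1" unfolding Y1_def[abs_def]
    by (rule continuous_on_subset[OF cont_L1_loc_pairing[OF cu(2) b] sub])
  have ca: "continuous_on {1..\<tau>} a" and ca1: "continuous_on {1..\<tau>} a1"
    using DERIV_isCont[OF da] DERIV_isCont[OF da1] pos by (auto intro!: continuous_at_imp_continuous_on)
  have ca2: "continuous_on {1..\<tau>} a2" using a2 by (rule continuous_on_subset) auto
  have dY: "(Y has_real_derivative Y1 s) (at s within {1..\<tau>})" if "s \<in> {1..\<tau>}" for s
    unfolding Y_def Y1_def
    by (rule has_field_derivative_subset[OF C1_L1_loc_pairing[OF sol1(2) b] sub]) (use that sub in auto)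
  have i1: "(LINT x|lebesgue. s powr (2 * l) * (gu s x \<bullet> grad (\<lambda>y. a s * b y) x) - ut s x * deriv (\<lambda>r. a r * b x) s)
      = - (a1 s * Y1 s) - s powr (2 * l) * a s * Z s" if s: "s \<in> {1..\<tau>}" for s
  proof -
    have "deriv (\<lambda>r. a r * b x) s = a1 s * b x" for x
      using da[OF pos[OF s]] by (intro DERIV_imp_deriv DERIV_cmult_right)
    then have "(LINT x|lebesgue. s powr (2 * l) * (gu s x \<bullet> grad (\<lambda>y. a s * b y) x) - ut s x * deriv (\<lambda>r. a r * b x) s)
      = (LINT x|lebesgue. (s powr (2 * l) * a s) * (gu s x \<bullet> grad b x) - a1 s * (ut s x * b x))"
      by (simp add: grad_scaled[OF bs] mult_ac)
    also have "\<dots> = (s powr (2 * l) * a s) * (LINT x|lebesgue. gu s x \<bullet> grad b x) - a1 s * (LINT x|lebesgue. ut s x * b x)"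
      using weak_gradient_pairing(2)[OF wg[OF s] b] integrable_L1_loc_times_test[OF Lut[OF s] b] by simp
    finally show ?thesis unfolding weak_gradient_pairing(1)[OF wg[OF s] b] by (simp add: Y1_def Z_def)
  qed
  have i2: "(LINT x|lebesgue. \<mu> * ut s x * (a s * b x) / s + \<nu>\<^sup>2 * u s x * (a s * b x) / s\<^sup>2)
      = \<mu> * a s / s * Y1 s + \<nu>\<^sup>2 * a s / s\<^sup>2 * Y s" if s: "s \<in> {1..\<tau>}" for s
  proof -
    have "(LINT x|lebesgue. \<mu> * ut s x * (a s * b x) / s + \<nu>\<^sup>2 * u s x * (a s * b x) / s\<^sup>2)
      = (LINT x|lebesgue. (\<mu> * a s / s) * (ut s x * b x) + (\<nu>\<^sup>2 * a s / s\<^sup>2) * (u s x * b x))"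
      by (intro Bochner_Integration.integral_cong refl) (simp add: mult_ac)
    also have "\<dots> = \<mu> * a s / s * Y1 s + \<nu>\<^sup>2 * a s / s\<^sup>2 * Y s"
      using integrable_L1_loc_times_test[OF Lut[OF s] b] integrable_L1_loc_times_test[OF Lu[OF s] b]
      by (simp add: Y1_def Y_def)
    finally show ?thesis .
  qed
  define A where "A s = - (a1 s * Y1 s) - s powr (2 * l) * a s * Z s" for s
  define B where "B s = \<mu> * a s / s * Y1 s + \<nu>\<^sup>2 * a s / s\<^sup>2 * Y s" for s
  define D where "D s = Y s * (a2 s - \<mu> * (a1 s / s - a s / s\<^sup>2) + \<nu>\<^sup>2 / s\<^sup>2 * a s) - s powr (2 * l) * a s * Z s" for s
  \<comment> \<open>\<open>P\<close> is the boundary expression of the integration by parts in time.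
    The integrand splits as P' + D, where \<open>D\<close> contains no time derivative of
    \<open>u\<close> and is the adjoint operator applied to \<open>a\<close>. At \<tau> it vanishes,
    and at 1 it yields the \<open>u0\<close> part of the data.\<close>
  define P where "P s = Y s * (\<mu> * (a s / s) - a1 s)" for s
  define P1 where "P1 s = Y1 s * (\<mu> * (a s / s) - a1 s) + Y s * (\<mu> * (a1 s / s - a s / s\<^sup>2) - a2 s)" for s
  have AB: "A s + B s = P1 s + D s" for s
    by (simp add: A_def B_def P1_def D_def algebra_simps)
  have nz: "\<forall>s\<in>{1..\<tau>}. s \<noteq> 0" by auto
  have cA: "continuous_on {1..\<tau>} A" unfolding A_def[abs_def] using cY1 cZ ca ca1 nz by (auto intro!: continuous_intros)
  have cB: "continuous_on {1..\<tau>} B" unfolding B_def[abs_def] using cY1 cY ca nz by (auto intro!: continuous_intros)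
  have cD: "continuous_on {1..\<tau>} D" unfolding D_def[abs_def] using cY cZ ca ca1 ca2 nz by (auto intro!: continuous_intros)
  have cP1: "continuous_on {1..\<tau>} P1" unfolding P1_def[abs_def] using cY cY1 ca ca1 ca2 nz by (auto intro!: continuous_intros)
  have LI: "(LINT s:{1..\<tau>}|lebesgue. f s) = integral {1..\<tau>} f" if "continuous_on {1..\<tau>} f" for f :: "real \<Rightarrow> real"
    by (rule set_lebesgue_integral_eq_integral(2)[OF absolutely_integrable_continuous_real[OF that]])
  have dP: "(P has_real_derivative P1 s) (at s within {1..\<tau>})" if s: "s \<in> {1..\<tau>}" for s
  proof -
    have "((\<lambda>s. a s / s) has_real_derivative a1 s / s - a s / s\<^sup>2) (at s)"
      using DERIV_divide[OF da[OF pos[OF s]] DERIV_ident] pos[OF s] by (simp add: power2_eq_square diff_divide_distrib)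
    from DERIV_diff[OF DERIV_cmult[OF this, of \<mu>] da1[OF pos[OF s]]]
    have "((\<lambda>s. \<mu> * (a s / s) - a1 s) has_real_derivative \<mu> * (a1 s / s - a s / s\<^sup>2) - a2 s) (at s within {1..\<tau>})"
      by (rule has_field_derivative_at_within)
    from DERIV_mult[OF dY[OF s] this] show ?thesis unfolding P_def[abs_def] P1_def by (simp add: algebra_simps)
  qed
  have "(P1 has_integral (P \<tau> - P 1)) {1..\<tau>}"
    using \<tau>(1) dP by (intro fundamental_theorem_of_calculus) (auto simp: has_real_derivative_iff_has_vector_derivative)
  then have IP: "integral {1..\<tau>} P1 = P \<tau> - P 1" by (rule integral_unique)
  have a\<tau>: "a \<tau> = 0" using a(2) by simp
  \<comment> \<open>The derivative at \<tau> exists and agrees with the one from the right, which is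
    0 because \<open>a\<close> vanishes there.\<close>
  have a1\<tau>: "a1 \<tau> = 0"
  proof -
    have "(a has_real_derivative a1 \<tau>) (at_right \<tau>)"
      by (rule has_field_derivative_at_within[OF da]) (use \<tau>(1) in simp)
    moreover have "((\<lambda>x. 0) has_real_derivative 0) (at \<tau> within {\<tau>..})" by simp
    then have "(a has_real_derivative 0) (at \<tau> within {\<tau>..})"
      by (rule has_field_derivative_transform_within[where d = 1]) (simp_all add: a(2))
    then have "(a has_real_derivative 0) (at_right \<tau>)" by (simp only: at_within_Ici_at_right)
    ultimately show ?thesis
      unfolding has_field_derivative_iff by (rule tendsto_unique[OF trivial_limit_at_right_real])
  qed
  have P\<tau>: "P \<tau> = 0" by (simp add: P_def a\<tau> a1\<tau>)
  have P1': "P 1 = \<epsilon> * (\<mu> * a 1 - a1 1) * (LINT x|lebesgue. u0 x * b x)"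
  proof -
    have "Y 1 = (LINT x|lebesgue. \<epsilon> * (u0 x * b x))" unfolding Y_def
    proof (rule integral_cong_AE)
      have "1 \<in> {1..\<tau>}" using \<tau>(1) by simp
      then show "(\<lambda>x. u 1 x * b x) \<in> borel_measurable lebesgue"
        using integrable_L1_loc_times_test[OF Lu b] by blast
      show "(\<lambda>x. \<epsilon> * (u0 x * b x)) \<in> borel_measurable lebesgue"
        using integrable_L1_loc_times_test[OF u0 b] by simp
      show "AE x in lebesgue. u 1 x * b x = \<epsilon> * (u0 x * b x)"
        using sol1(3) by eventually_elim simp
    qed
    then show ?thesis by (simp add: P_def)
  qed
  have E1: "(LINT s:{1..\<tau>}|lebesgue. LINT x|lebesgue. s powr (2 * l) * (gu s x \<bullet> grad (\<lambda>y. a s * b y) x) - ut s x * deriv (\<lambda>r. a r * b x) s)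
      = integral {1..\<tau>} A"
    unfolding LI[OF cA, symmetric] by (intro set_lebesgue_integral_cong) (auto simp: i1 A_def)
  have E2: "(LINT s:{1..\<tau>}|lebesgue. LINT x|lebesgue. \<mu> * ut s x * (a s * b x) / s + \<nu>\<^sup>2 * u s x * (a s * b x) / s\<^sup>2)
      = integral {1..\<tau>} B"
    unfolding LI[OF cB, symmetric] by (intro set_lebesgue_integral_cong) (auto simp: i2 B_def)
  have "integral {1..\<tau>} A + integral {1..\<tau>} B = integral {1..\<tau>} (\<lambda>s. A s + B s)"
    using cA cB by (intro Henstock_Kurzweil_Integration.integral_add[symmetric] integrable_continuous_real)
  also have "\<dots> = integral {1..\<tau>} P1 + integral {1..\<tau>} D" unfolding AB
    using cP1 cD by (intro Henstock_Kurzweil_Integration.integral_add integrable_continuous_real)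
  finally have "integral {1..\<tau>} A + integral {1..\<tau>} B = - \<epsilon> * (\<mu> * a 1 - a1 1) * (LINT x|lebesgue. u0 x * b x) + integral {1..\<tau>} D"
    unfolding IP P\<tau> P1' by simp
  moreover have "integral {1..\<tau>} A + integral {1..\<tau>} B = \<epsilon> * (LINT x|lebesgue. u1 x * (a 1 * b x))
      + (LINT s:{1..\<tau>}|lebesgue. LINT x|lebesgue. \<bar>u s x\<bar> powr p * (a s * b x))"
    using main unfolding a\<tau> E1[symmetric] E2[symmetric] by simp
  moreover have "(LINT x|lebesgue. u1 x * (a 1 * b x)) = a 1 * (LINT x|lebesgue. u1 x * b x)"
    by (simp add: mult.left_commute)
  ultimately show "\<epsilon> * (a 1 * (LINT x|lebesgue. u1 x * b x) + (\<mu> * a 1 - a1 1) * (LINT x|lebesgue. u0 x * b x))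
      + (LINT s:{1..\<tau>}|lebesgue. LINT x|lebesgue. \<bar>u s x\<bar> powr p * (a s * b x))
      = (LINT s:{1..\<tau>}|lebesgue. Y s * (a2 s - \<mu> * (a1 s / s - a s / s\<^sup>2) + \<nu>\<^sup>2 / s\<^sup>2 * a s) - s powr (2 * l) * a s * Z s)"
    unfolding D_def[symmetric] LI[OF cD] by (simp add: algebra_simps)
qed

section \<open>Young's inequality on a time slice\<close>

lemma conjugate_exponent:
  fixes p q :: real
  assumes "p > 1" "q = p / (p - 1)"
  shows "q > 1" "1 / p + 1 / q = 1" "q / p = q - 1"
  unfolding assms(2) using assms(1) by (simp_all add: field_simps)

lemma localized_one:
  assumes "r > 0"
  obtains b :: "real ^ 'n \<Rightarrow> real" where "test_function b" "\<And>x. x \<in> ball 0 r \<Longrightarrow> b x = 1"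
proof (rule localized_test_function[OF smooth_on_const[OF open_UNIV, of 1] _ assms])
  fix b :: "real ^ 'n \<Rightarrow> real"
  assume "test_function b" "\<And>x. x \<in> ball 0 r \<Longrightarrow> b x = 1"
  then show thesis by (rule that)
qed simp

text \<open>Young's inequality for X^(1/p) a and X^(-1/p) b with the factors 1/p and 1/q dropped; as
  q / p = q - 1, the second weight is X^(1 - q). The free weight \<open>X\<close> will carry the
  power of the cutoff and the parameter to be optimised.\<close>

lemma Young_weighted:
  fixes a b X p q :: real
  assumes "a \<ge> 0" "b \<ge> 0" "X > 0" "p > 1" "q = p / (p - 1)"
  shows "a * b \<le> X * a powr p + X powr (1 - q) * b powr q"
proof -
  note q = conjugate_exponent[OF assms(4,5)]
  define Z where "Z = X powr (1 / p)"
  have Z: "Z > 0" using assms by (simp add: Z_def)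
  have Zp: "Z powr p = X" using assms by (simp add: Z_def powr_powr)
  have Zq: "inverse Z powr q = X powr (1 - q)"
    using assms q by (simp add: Z_def powr_powr inverse_powr flip: powr_minus)
  have "a * b = (Z * a) * (inverse Z * b)" using Z by simp
  also have "\<dots> \<le> (Z * a) powr p / p + (inverse Z * b) powr q / q"
    using assms q Z by (intro Youngs_inequality) auto
  also have "\<dots> \<le> (Z * a) powr p + (inverse Z * b) powr q"
  proof (intro add_mono)
    have *: "y / c \<le> y" if "y \<ge> 0" "c > 1" for y c :: real
      using divide_left_mono[of 1 c y] that by simp
    show "(Z * a) powr p / p \<le> (Z * a) powr p" "(inverse Z * b) powr q / q \<le> (inverse Z * b) powr q"
      using assms(4) q(1) by (auto intro!: *)
  qed
  also have "\<dots> = X * a powr p + X powr (1 - q) * b powr q"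
    using assms(1,2) Z by (simp add: powr_mult Zp Zq)
  finally show ?thesis .
qed

lemma phi_speed_mono: "l > -1 \<Longrightarrow> 0 \<le> s \<Longrightarrow> s \<le> t \<Longrightarrow> phi_speed l s \<le> phi_speed l t"
  unfolding phi_speed_def by (intro divide_right_mono powr_mono2) auto

lemma AE_ball_mono:
  assumes "AE x in lebesgue. x \<notin> ball 0 r \<longrightarrow> f x = (0::real)" "r \<le> r'"
  shows "AE x in lebesgue. x \<notin> ball 0 r' \<longrightarrow> f x = 0"
  using assms(1) by eventually_elim (use assms(2) in auto)

lemma integral_cong_support:
  fixes f b \<Phi> :: "real ^ 'n \<Rightarrow> real"
  assumes "AE x in lebesgue. x \<notin> ball 0 r \<longrightarrow> f x = 0" "\<And>x. x \<in> ball 0 r \<Longrightarrow> b x = \<Phi> x"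
    and "integrable lebesgue (\<lambda>x. f x * b x)"
  shows "integrable lebesgue (\<lambda>x. f x * \<Phi> x)" "(LINT x|lebesgue. f x * \<Phi> x) = (LINT x|lebesgue. f x * b x)"
proof -
  have ae: "AE x in lebesgue. f x * b x = f x * \<Phi> x"
    using assms(1) by eventually_elim (use assms(2) in auto)
  have m: "(\<lambda>x. f x * b x) \<in> borel_measurable lebesgue" using assms(3) by simp
  have m': "(\<lambda>x. f x * \<Phi> x) \<in> borel_measurable lebesgue" by (rule borel_measurable_AE[OF m ae])
  show "integrable lebesgue (\<lambda>x. f x * \<Phi> x)" using integrable_cong_AE[OF m m' ae] assms(3) by simp
  show "(LINT x|lebesgue. f x * \<Phi> x) = (LINT x|lebesgue. f x * b x)" using integral_cong_AE[OF m m' ae] by simp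
qed

text \<open>Local integrability together with bounded support gives measurability on the whole
  space: multiplying by a test function that is 1 on the support does not change \<open>u s\<close>
  almost everywhere.\<close>

lemma weak_solution_slice:
  fixes u :: "real \<Rightarrow> real ^ 'n \<Rightarrow> real"
  assumes sol: "weak_solution l \<mu> \<nu> p R u0 u1 \<epsilon> T u" and "l > -1" "R > 0" "ess_support u0 \<subseteq> ball 0 R"
    and s: "1 \<le> s" "ereal s < T"
  shows "L1_loc (u s)" "AE x in lebesgue. x \<notin> ball 0 (R + phi_speed l s - phi_speed l 1) \<longrightarrow> u s x = 0"
    "u s \<in> borel_measurable lebesgue"
proof -
  obtain ut where sol1: "C1_L1_loc (time_dom T) u ut" "AE x in lebesgue. u 1 x = \<epsilon> * u0 x"
    and supp: "\<forall>t. 1 < t \<and> ereal t < T \<longrightarrow> ess_support (u t) \<subseteq> ball 0 (R + phi_speed l t - phi_speed l 1)"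
    using sol unfolding weak_solution_def by auto
  show L: "L1_loc (u s)" using sol1(1) s by (auto simp: C1_L1_loc_def cont_L1_loc_def time_dom_def)
  show ae: "AE x in lebesgue. x \<notin> ball 0 (R + phi_speed l s - phi_speed l 1) \<longrightarrow> u s x = 0"
  \<comment> \<open>The support condition of a weak solution covers t > 1 only. At s = 1 the radius
    is \<open>R\<close> and the support is inherited from the initial datum.\<close>
  proof (cases "s = 1")
    case True
    show ?thesis using sol1(2) AE_zero_outside_ess_support[OF assms(4)] unfolding True
      by eventually_elim auto
  next
    case False
    then show ?thesis using s supp by (intro AE_zero_outside_ess_support) auto
  qed
  have r: "0 < R + phi_speed l s - phi_speed l 1" using phi_speed_mono[OF assms(2), of 1 s] s assms(3) by simp
  obtain b :: "real ^ 'n \<Rightarrow> real" where b: "test_function b" "\<And>x. x \<in> ball 0 (R + phi_speed l s - phi_speed l 1) \<Longrightarrow> b x = 1"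
    using localized_one[OF r] by blast
  have "integrable lebesgue (\<lambda>x. u s x * 1)"
    by (rule integral_cong_support(1)[OF ae _ integrable_L1_loc_times_test[OF L b(1)]]) (use b(2) in simp)
  then show "u s \<in> borel_measurable lebesgue" by simp
qed

text \<open>Outside the ball \<open>v\<close> vanishes and inside \<open>b\<close> equals \<Phi>, so
  the spatial weight enters only through the integral of \<Phi>^q over the ball. The factor
  \<open>D\<close> will be the size of the error made by the time cutoff.\<close>

lemma young_slice:
  fixes v b \<Phi> :: "real ^ 'n \<Rightarrow> real"
  assumes v: "L1_loc v" "v \<in> borel_measurable lebesgue" "AE x in lebesgue. x \<notin> ball 0 r \<longrightarrow> v x = 0"
    "integrable lebesgue (\<lambda>x. \<bar>v x\<bar> powr p)"
    and b: "test_function b" "\<And>x. x \<in> ball 0 r \<Longrightarrow> b x = \<Phi> x"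
    and \<Phi>: "continuous_on UNIV \<Phi>" "\<And>x. 0 \<le> \<Phi> x"
    and X: "X > 0" "D \<ge> 0" "p > 1" "q = p / (p - 1)"
  shows "\<bar>LINT x|lebesgue. v x * b x\<bar> * D \<le> X * (LINT x|lebesgue. \<bar>v x\<bar> powr p)
    + X powr (1 - q) * (D powr q * (LINT x:ball 0 r|lebesgue. \<Phi> x powr q))"
proof -
  have q: "q > 1" by (rule conjugate_exponent[OF X(3,4)])
  have i1: "integrable lebesgue (\<lambda>x. v x * b x)" by (rule integrable_L1_loc_times_test[OF v(1) b(1)])
  have i2: "integrable lebesgue (\<lambda>x. indicator (ball 0 r) x *\<^sub>R (\<Phi> x powr q))"
  proof -
    have "integrable lborel (\<lambda>x. indicator (cball 0 r) x *\<^sub>R (\<Phi> x powr q))"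
    proof (rule borel_integrable_compact[OF compact_cball])
      show "continuous_on (cball 0 r) (\<lambda>x. \<Phi> x powr q)"
        by (rule continuous_on_powr'[OF continuous_on_subset[OF \<Phi>(1)] continuous_on_const]) (use \<Phi>(2) q in auto)
    qed
    then have "set_integrable lebesgue (cball 0 r) (\<lambda>x. \<Phi> x powr q)"
      unfolding set_integrable_def by (simp add: integrable_completion)
    then have "set_integrable lebesgue (ball 0 r) (\<lambda>x. \<Phi> x powr q)"
      by (rule set_integrable_subset) auto
    then show ?thesis by (simp add: set_integrable_def)
  qed
  have "\<bar>LINT x|lebesgue. v x * b x\<bar> * D \<le> (LINT x|lebesgue. \<bar>v x * b x\<bar>) * D"
    using X(2) by (intro mult_right_mono integral_abs_bound)
  also have "\<dots> = (LINT x|lebesgue. \<bar>v x * b x\<bar> * D)" by simp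
  also have "\<dots> \<le> (LINT x|lebesgue. X * \<bar>v x\<bar> powr p + X powr (1 - q) * D powr q * (indicator (ball 0 r) x *\<^sub>R (\<Phi> x powr q)))"
  proof (rule integral_mono_AE)
    show "integrable lebesgue (\<lambda>x. \<bar>v x * b x\<bar> * D)" using i1 by auto
    show "integrable lebesgue (\<lambda>x. X * \<bar>v x\<bar> powr p + X powr (1 - q) * D powr q * (indicator (ball 0 r) x *\<^sub>R (\<Phi> x powr q)))"
      using v(4) i2 by (intro Bochner_Integration.integrable_add integrable_mult_right)
    show "AE x in lebesgue. \<bar>v x * b x\<bar> * D \<le> X * \<bar>v x\<bar> powr p + X powr (1 - q) * D powr q * (indicator (ball 0 r) x *\<^sub>R (\<Phi> x powr q))"
      using v(3)
    proof eventually_elim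
      case (elim x)
      show ?case
      proof (cases "x \<in> ball 0 r")
        case True
        have "\<bar>v x * b x\<bar> * D = \<bar>v x\<bar> * (D * \<Phi> x)" using b(2)[OF True] \<Phi>(2)[of x] by (simp add: abs_mult)
        also have "\<dots> \<le> X * \<bar>v x\<bar> powr p + X powr (1 - q) * (D * \<Phi> x) powr q"
          using X \<Phi>(2)[of x] by (intro Young_weighted) auto
        finally show ?thesis using True X(2) \<Phi>(2)[of x] by (simp add: powr_mult)
      next
        case False
        then show ?thesis using elim X by simp
      qed
    qed
  qed
  also have "\<dots> = X * (LINT x|lebesgue. \<bar>v x\<bar> powr p) + X powr (1 - q) * D powr q * (LINT x|lebesgue. indicator (ball 0 r) x *\<^sub>R (\<Phi> x powr q))"
    by (simp only: Bochner_Integration.integral_add[OF integrable_mult_right[OF v(4)] integrable_mult_right[OF i2]] integral_mult_right_zero)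
  finally show ?thesis by (simp only: set_lebesgue_integral_def mult.assoc)
qed

lemma smooth_on_rescaled:
  assumes "smooth_on (h :: real \<Rightarrow> real) UNIV"
  shows "smooth_on (\<lambda>s. h (s / \<tau>)) {0<..}"
  by (rule smooth_on_compose_linear[OF _ open_UNIV bounded_linear_divide _ assms]) auto

text \<open>A weak solution provides integrability of |u|^p against test functions. A spatial factor
  equal to 1 on the support of \<open>u\<close> can be removed; the time factor can be divided out
  only at times where it is nonzero, whence the restriction in the first claim.\<close>

lemma weak_solution_power_integrable:
  fixes u :: "real \<Rightarrow> real ^ 'n \<Rightarrow> real"
  assumes sol: "weak_solution l \<mu> \<nu> p R u0 u1 \<epsilon> T u" and l: "l > -1" and R: "R > 0"
    and u0: "L1_loc u0" "ess_support u0 \<subseteq> ball 0 R"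
    and \<tau>: "2 \<le> \<tau>" "ereal \<tau> < T"
    and h: "smooth_on h UNIV" "\<And>x. 1 \<le> x \<Longrightarrow> h x = 0" and k: "k \<ge> (1::nat)"
  shows "AE s in lebesgue. s \<in> {1..\<tau>} \<and> h (s / \<tau>) \<noteq> 0 \<longrightarrow> integrable lebesgue (\<lambda>x. \<bar>u s x\<bar> powr p)"
    "(\<lambda>s. h (s / \<tau>) ^ k * (LINT x|lebesgue. \<bar>u s x\<bar> powr p)) absolutely_integrable_on {1..\<tau>}"
proof -
  define \<rho> where "\<rho> s = R + phi_speed l s - phi_speed l 1" for s
  have \<rho>: "\<rho> s \<le> \<rho> \<tau>" if "s \<in> {1..\<tau>}" for s using phi_speed_mono[OF l, of s \<tau>] that by (simp add: \<rho>_def)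
  have \<rho>0: "0 < \<rho> \<tau>" using phi_speed_mono[OF l, of 1 \<tau>] \<tau> R by (simp add: \<rho>_def)
  define a where "a s = h (s / \<tau>) ^ k" for s
  have sa: "smooth_on a {0<..}" unfolding a_def[abs_def]
    by (intro smooth_on_power smooth_on_rescaled h(1)) auto
  have a0: "a s = 0" if "s \<ge> \<tau>" for s using that h(2)[of "s / \<tau>"] \<tau> k by (simp add: a_def)
  obtain a1 where a1: "\<And>s. s \<in> {0<..} \<Longrightarrow> (a has_real_derivative a1 s) (at s)" "smooth_on a1 {0<..}"
    using smooth_on_real_derivE[OF open_greaterThan sa] by blast
  obtain a2 where a2: "\<And>s. s \<in> {0<..} \<Longrightarrow> (a1 has_real_derivative a2 s) (at s)" "smooth_on a2 {0<..}"
    using smooth_on_real_derivE[OF open_greaterThan a1(2)] by blast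
  obtain b :: "real ^ 'n \<Rightarrow> real" where b: "test_function b" "\<And>x. x \<in> ball 0 (\<rho> \<tau>) \<Longrightarrow> b x = 1"
    using localized_one[OF \<rho>0] by blast
  have \<tau>1: "1 < \<tau>" using \<tau> by simp
  note W = weak_solution_separated_test[OF sol \<tau>1 \<tau>(2) b(1) sa a0 a1(1) a2(1) smooth_on_imp_continuous_on[OF a2(2)] u0(1), simplified]
  have T: "ereal s < T" if "s \<in> {1..\<tau>}" for s using that \<tau>(2) by (meson atLeastAtMost_iff ereal_less_eq(3) le_less_trans)
  have slice: "AE x in lebesgue. x \<notin> ball 0 (\<rho> \<tau>) \<longrightarrow> a s * \<bar>u s x\<bar> powr p = 0" if s: "s \<in> {1..\<tau>}" for s
    using AE_ball_mono[OF weak_solution_slice(2)[OF sol l R u0(2) _ T[OF s], folded \<rho>_def] \<rho>[OF s]] s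
    by (auto elim!: eventually_mono)
  have eq: "(a s * \<bar>u s x\<bar> powr p) * b x = \<bar>u s x\<bar> powr p * (a s * b x)" for s x by simp
  show "AE s in lebesgue. s \<in> {1..\<tau>} \<and> h (s / \<tau>) \<noteq> 0 \<longrightarrow> integrable lebesgue (\<lambda>x. \<bar>u s x\<bar> powr p)"
    using W(1)
  proof eventually_elim
    case (elim s)
    show ?case
    proof
      assume s: "s \<in> {1..\<tau>} \<and> h (s / \<tau>) \<noteq> 0"
      then have "integrable lebesgue (\<lambda>x. (a s * \<bar>u s x\<bar> powr p) * b x)" using elim unfolding eq by simp
      then have "integrable lebesgue (\<lambda>x. (a s * \<bar>u s x\<bar> powr p) * 1)"
        using s by (intro integral_cong_support(1)[OF slice b(2)]) auto
      then show "integrable lebesgue (\<lambda>x. \<bar>u s x\<bar> powr p)" using s by (simp add: a_def)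
    qed
  qed
  have W2: "(\<lambda>s. LINT x|lebesgue. \<bar>u s x\<bar> powr p * (a s * b x)) absolutely_integrable_on {1..\<tau>}" by (rule W(2))
  have ae: "AE s in lebesgue. indicator {1..\<tau>} s *\<^sub>R (LINT x|lebesgue. \<bar>u s x\<bar> powr p * (a s * b x))
      = indicator {1..\<tau>} s *\<^sub>R (a s * (LINT x|lebesgue. \<bar>u s x\<bar> powr p))"
    using W(1)
  proof eventually_elim
    case (elim s)
    show ?case
    proof (cases "s \<in> {1..\<tau>}")
      case True
      then have "integrable lebesgue (\<lambda>x. (a s * \<bar>u s x\<bar> powr p) * b x)" using elim unfolding eq by simp
      from integral_cong_support(2)[OF slice[OF True] b(2) this]
      show ?thesis unfolding eq by simp
    qed simp
  qed
  from W2 have i: "integrable lebesgue (\<lambda>s. indicator {1..\<tau>} s *\<^sub>R (LINT x|lebesgue. \<bar>u s x\<bar> powr p * (a s * b x)))"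
    by (simp only: set_integrable_def)
  have m: "(\<lambda>s. indicator {1..\<tau>} s *\<^sub>R (a s * (LINT x|lebesgue. \<bar>u s x\<bar> powr p))) \<in> borel_measurable lebesgue"
    by (rule borel_measurable_AE[OF borel_measurable_integrable[OF i] ae])
  show "(\<lambda>s. h (s / \<tau>) ^ k * (LINT x|lebesgue. \<bar>u s x\<bar> powr p)) absolutely_integrable_on {1..\<tau>}"
    unfolding set_integrable_def using integrable_cong_AE[OF borel_measurable_integrable[OF i] m ae] i
    by (simp only: a_def)
qed

subsection \<open>The test function argument\<close>

text \<open>A majorant for the terms 2 \<alpha>' (h^k)', \<alpha> (h^k)'' and \<mu> \<alpha> (h^k)'
  / s in which a derivative falls on the cutoff, with a factor 1/\<tau> for each such derivative.
  The common factor h^(k - 2) is split off, and \<open>C\<close> is the constant of the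
  cutoff.\<close>

definition cutoff_error :: "real \<Rightarrow> real \<Rightarrow> real \<Rightarrow> (real \<Rightarrow> real) \<Rightarrow> (real \<Rightarrow> real) \<Rightarrow> real \<Rightarrow> real" where
  "cutoff_error C \<mu> \<tau> \<alpha> \<alpha>1 s = C * (2 * \<bar>\<alpha>1 s\<bar> / \<tau> + \<bar>\<alpha> s\<bar> / \<tau>\<^sup>2 + \<mu> * \<bar>\<alpha> s\<bar> / (\<tau> * s))"

lemma cutoff_error_nonneg: "C > 0 \<Longrightarrow> \<mu> \<ge> 0 \<Longrightarrow> \<tau> > 0 \<Longrightarrow> s > 0 \<Longrightarrow> 0 \<le> cutoff_error C \<mu> \<tau> \<alpha> \<alpha>1 s"
  unfolding cutoff_error_def by (intro mult_nonneg_nonneg add_nonneg_nonneg divide_nonneg_nonneg) auto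

text \<open>If \<alpha> is of size \<tau>^2 Z and \<alpha>' of size \<tau> Z, every term is of size
  Z. The coefficients are 2, 1 and 2 \<mu>, the last because s \<ge> \<tau>/2.\<close>

lemma cutoff_error_le:
  assumes "C > 0" "\<mu> \<ge> 0" "\<tau> > 0" "s \<in> {\<tau>/2..\<tau>}" and b: "\<bar>\<alpha> s\<bar> \<le> \<tau>\<^sup>2 * Z" "\<bar>\<alpha>1 s\<bar> \<le> \<tau> * Z"
  shows "cutoff_error C \<mu> \<tau> \<alpha> \<alpha>1 s \<le> C * ((3 + 2 * \<mu>) * Z)"
proof -
  have "0 \<le> \<tau> * Z" using b(2) abs_ge_zero order_trans by blast
  then have Z: "0 \<le> Z" using assms(3) by (simp add: zero_le_mult_iff)
  have "2 * \<bar>\<alpha>1 s\<bar> / \<tau> \<le> 2 * (\<tau> * Z) / \<tau>" using b assms by (intro divide_right_mono) auto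
  then have 1: "2 * \<bar>\<alpha>1 s\<bar> / \<tau> \<le> 2 * Z" using assms by simp
  have "\<bar>\<alpha> s\<bar> / \<tau>\<^sup>2 \<le> (\<tau>\<^sup>2 * Z) / \<tau>\<^sup>2" using b assms by (intro divide_right_mono) auto
  then have 2: "\<bar>\<alpha> s\<bar> / \<tau>\<^sup>2 \<le> Z" using assms by simp
  have "\<mu> * \<bar>\<alpha> s\<bar> / (\<tau> * s) \<le> \<mu> * (\<tau>\<^sup>2 * Z) / (\<tau> * (\<tau> / 2))"
    using b assms Z by (intro frac_le mult_left_mono mult_nonneg_nonneg) auto
  then have 3: "\<mu> * \<bar>\<alpha> s\<bar> / (\<tau> * s) \<le> 2 * \<mu> * Z" using assms by (simp add: power2_eq_square mult_ac)
  have "2 * \<bar>\<alpha>1 s\<bar> / \<tau> + \<bar>\<alpha> s\<bar> / \<tau>\<^sup>2 + \<mu> * \<bar>\<alpha> s\<bar> / (\<tau> * s) \<le> (3 + 2 * \<mu>) * Z"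
    using 1 2 3 by (simp add: distrib_right)
  then show ?thesis unfolding cutoff_error_def using assms by (intro mult_left_mono) auto
qed

text \<open>Testing with \<open>\<alpha>(t) h(t/\<tau>)^k \<Phi>(x)\<close>, where \<open>\<alpha> \<Phi>\<close> solves the adjoint linear equation: only the terms in
  which a derivative hits the cutoff survive, so the right-hand side lives on \<open>[\<tau>/2, \<tau>]\<close>.\<close>

lemma weak_solution_adjoint_test:
  fixes u :: "real \<Rightarrow> real ^ 'n \<Rightarrow> real" and l \<mu> \<nu> p q R \<epsilon> \<tau> \<kappa> M x0 Cg :: real and k :: nat
  assumes sol: "weak_solution l \<mu> \<nu> p R u0 u1 \<epsilon> T u" and l: "l > -1" and R: "R > 0" and \<mu>: "\<mu> \<ge> 0"
    and p: "p > 1" "q = p / (p - 1)" and k: "real k \<ge> 2 * q"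
    and u0: "L1_loc u0" "ess_support u0 \<subseteq> ball 0 R" and u1: "L1_loc u1" "ess_support u1 \<subseteq> ball 0 R"
    and \<tau>: "2 \<le> \<tau>" "ereal \<tau> < T"
    and cut: "is_cutoff k h g1 g2 Cg"
    and \<Phi>: "smooth_on \<Phi> UNIV" "\<And>x. 0 \<le> \<Phi> x" "\<And>x :: real ^ 'n. laplacian \<Phi> x = \<kappa> * \<Phi> x"
    and \<alpha>: "smooth_on \<alpha> {0<..}" "\<And>t. t > 0 \<Longrightarrow> (\<alpha> has_real_derivative \<alpha>1 t) (at t)"
      "\<And>t. t > 0 \<Longrightarrow> (\<alpha>1 has_real_derivative \<alpha>2 t) (at t)"
      "\<And>t. t > 0 \<Longrightarrow> \<alpha>2 t - \<mu> * (\<alpha>1 t / t - \<alpha> t / t\<^sup>2) + \<nu>\<^sup>2 / t\<^sup>2 * \<alpha> t - \<kappa> * t powr (2 * l) * \<alpha> t = 0"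
      "\<And>t. t \<in> {1..\<tau>} \<Longrightarrow> 0 \<le> \<alpha> t"
    and M: "\<And>s. s \<in> {\<tau>/2..\<tau>} \<Longrightarrow> (cutoff_error Cg \<mu> \<tau> \<alpha> \<alpha>1 s) powr q
      * (LINT x:ball 0 (R + phi_speed l s - phi_speed l 1)|lebesgue. \<Phi> x powr q) \<le> M"
    and x0: "x0 > 0"
  defines "Ah \<equiv> LINT s:{\<tau>/2..\<tau>}|lebesgue. h (s / \<tau>) ^ k * (LINT x|lebesgue. \<bar>u s x\<bar> powr p)"
  shows "\<epsilon> * (\<alpha> 1 * (LINT x|lebesgue. u1 x * \<Phi> x) + (\<mu> * \<alpha> 1 - \<alpha>1 1) * (LINT x|lebesgue. u0 x * \<Phi> x))
      \<le> x0 * Ah + \<tau> * (x0 powr (1 - q) * M)" (is ?A)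
    and "\<lbrakk>\<And>x. \<Phi> x = 1; c \<ge> 0; \<And>s. s \<in> {\<tau>/2..\<tau>} \<Longrightarrow> c \<le> \<alpha> s\<rbrakk> \<Longrightarrow>
      \<epsilon> * (\<alpha> 1 * (LINT x|lebesgue. u1 x * \<Phi> x) + (\<mu> * \<alpha> 1 - \<alpha>1 1) * (LINT x|lebesgue. u0 x * \<Phi> x)) + c * Ah
      \<le> x0 * Ah + \<tau> * (x0 powr (1 - q) * M)"
proof -
  note h = is_cutoffD(1-5)[OF cut] and g = is_cutoffD(6-12)[OF cut]
  define data where "data = \<alpha> 1 * (LINT x|lebesgue. u1 x * \<Phi> x) + (\<mu> * \<alpha> 1 - \<alpha>1 1) * (LINT x|lebesgue. u0 x * \<Phi> x)"
  define \<rho> where "\<rho> s = R + phi_speed l s - phi_speed l 1" for s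
  have \<rho>: "\<rho> s \<le> \<rho> \<tau>" if "s \<in> {1..\<tau>}" for s using phi_speed_mono[OF l, of s \<tau>] that by (simp add: \<rho>_def)
  have \<rho>R: "R \<le> \<rho> \<tau>" using phi_speed_mono[OF l, of 1 \<tau>] \<tau> by (simp add: \<rho>_def)
  have \<rho>0: "0 < \<rho> \<tau>" using \<rho>R R by simp
  have q: "q > 1" by (rule conjugate_exponent[OF p])
  have k2: "k \<ge> 2" using k q by linarith
  have \<tau>1: "1 < \<tau>" using \<tau> by simp
  have T: "ereal s < T" if "s \<in> {1..\<tau>}" for s using that \<tau>(2) by (meson atLeastAtMost_iff ereal_less_eq(3) le_less_trans)
  have half: "{\<tau>/2..\<tau>} \<subseteq> {1..\<tau>}" using \<tau> by auto
  obtain b where b: "test_function b" "\<And>x. x \<in> ball 0 (\<rho> \<tau>) \<Longrightarrow> b x = \<Phi> x" "\<And>x. 0 \<le> b x"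
    "\<And>x. x \<in> ball 0 (\<rho> \<tau>) \<Longrightarrow> laplacian b x = laplacian \<Phi> x"
    using localized_test_function[OF \<Phi>(1,2) \<rho>0] by blast
  define Y where "Y s = (LINT x|lebesgue. u s x * b x)" for s
  define Z where "Z s = (LINT x|lebesgue. u s x * laplacian b x)" for s
  define G where "G s = (LINT x|lebesgue. \<bar>u s x\<bar> powr p)" for s
  define \<eta> where "\<eta> s = h (s / \<tau>)" for s
  have \<eta>: "0 \<le> \<eta> s" "\<eta> s \<le> 1" for s using h(4,5) by (auto simp: \<eta>_def)
  define a where "a s = \<alpha> s * \<eta> s ^ k" for s
  define a1 where "a1 s = \<alpha>1 s * \<eta> s ^ k + \<alpha> s * (g1 (s / \<tau>) / \<tau>)" for s
  define a2 where "a2 s = \<alpha>2 s * \<eta> s ^ k + \<alpha>1 s * (g1 (s / \<tau>) / \<tau>) + (\<alpha>1 s * (g1 (s / \<tau>) / \<tau>) + \<alpha> s * (g2 (s / \<tau>) / \<tau> / \<tau>))" for s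
  have lin: "((\<lambda>s. s / \<tau>) has_real_derivative 1 / \<tau>) (at s)" for s
    by (rule DERIV_cdivide[OF DERIV_ident])
  have d\<eta>: "((\<lambda>s. \<eta> s ^ k) has_real_derivative g1 (s / \<tau>) / \<tau>) (at s)" for s
    using DERIV_chain2[OF g(1) lin, of s] by (simp add: \<eta>_def)
  have dg1: "((\<lambda>s. g1 (s / \<tau>) / \<tau>) has_real_derivative g2 (s / \<tau>) / \<tau> / \<tau>) (at s)" for s
    using DERIV_cdivide[OF DERIV_chain2[OF g(2) lin, of s], of \<tau>] by simp
  have da: "(a has_real_derivative a1 s) (at s)" if "s > 0" for s
    unfolding a_def[abs_def] a1_def using DERIV_mult[OF \<alpha>(2)[OF that] d\<eta>] by (simp add: algebra_simps)
  have da1: "(a1 has_real_derivative a2 s) (at s)" if "s > 0" for s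
    unfolding a1_def[abs_def] a2_def
    using DERIV_add[OF DERIV_mult[OF \<alpha>(3)[OF that] d\<eta>] DERIV_mult[OF \<alpha>(2)[OF that] dg1]] by (simp add: algebra_simps)
  have sa: "smooth_on a {0<..}" unfolding a_def[abs_def] \<eta>_def
    by (intro smooth_on_mult \<alpha>(1) smooth_on_power smooth_on_rescaled h(1)) auto
  have sa1: "smooth_on a1 {0<..}" by (rule smooth_on_real_derivative[OF open_greaterThan sa]) (use da in auto)
  have sa2: "smooth_on a2 {0<..}" by (rule smooth_on_real_derivative[OF open_greaterThan sa1]) (use da1 in auto)
  have a0: "a s = 0" if "s \<ge> \<tau>" for s using that h(2)[of "s / \<tau>"] \<tau> k2 by (simp add: a_def \<eta>_def)
  note W = weak_solution_separated_test[OF sol \<tau>1 \<tau>(2) b(1) sa a0 da da1 smooth_on_imp_continuous_on[OF sa2] u0(1), folded Y_def Z_def, simplified]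
  have supp: "AE x in lebesgue. x \<notin> ball 0 (\<rho> s) \<longrightarrow> u s x = 0" if "s \<in> {1..\<tau>}" for s
    using weak_solution_slice(2)[OF sol l R u0(2) _ T[OF that]] that by (simp add: \<rho>_def)
  have supp': "AE x in lebesgue. x \<notin> ball 0 (\<rho> \<tau>) \<longrightarrow> u s x = 0" if "s \<in> {1..\<tau>}" for s
    by (rule AE_ball_mono[OF supp[OF that] \<rho>[OF that]])
  have Lu: "L1_loc (u s)" and mu: "u s \<in> borel_measurable lebesgue" if "s \<in> {1..\<tau>}" for s
    using weak_solution_slice(1,3)[OF sol l R u0(2) _ T[OF that]] that by auto
  \<comment> \<open>On the support of \<open>u s\<close> the localised function has the Laplacian
    \<kappa> \<Phi>. The value \<kappa> = 0 belongs to the constant weight, \<kappa> = 1 to the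
    exponential one.\<close>
  have Zeq: "Z s = \<kappa> * Y s" if "s \<in> {1..\<tau>}" for s
  proof -
    have "(LINT x|lebesgue. u s x * (\<kappa> * b x)) = (LINT x|lebesgue. u s x * laplacian b x)"
      by (rule integral_cong_support(2)[OF supp'[OF that] _ integrable_L1_loc_times_test[OF Lu[OF that] test_function_laplacian[OF b(1)]]])
        (use b(2,4) \<Phi>(3) in auto)
    moreover have "(LINT x|lebesgue. u s x * (\<kappa> * b x)) = \<kappa> * Y s" unfolding Y_def
      by (simp add: mult.left_commute)
    ultimately show ?thesis by (simp add: Z_def)
  qed
  have init: "(LINT x|lebesgue. v x * \<Phi> x) = (LINT x|lebesgue. v x * b x)" if "L1_loc v" "ess_support v \<subseteq> ball 0 R" for v
    by (rule integral_cong_support(2)[OF AE_ball_mono[OF AE_zero_outside_ess_support[OF that(2)] \<rho>R] b(2) integrable_L1_loc_times_test[OF that(1) b(1)]])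
  have a_1: "a 1 = \<alpha> 1" "a1 1 = \<alpha>1 1 + \<alpha> 1 * (g1 (1 / \<tau>) / \<tau>)" using h(3)[of "1 / \<tau>"] \<tau> by (auto simp: a_def a1_def \<eta>_def field_simps)
  \<comment> \<open>For \<tau> = 2 the initial time sits at 1/\<tau> = 1/2, the end of the plateau,
    where \<open>is_cutoff\<close> records nothing; continuity of \<open>g1\<close> closes the gap.
    Thus the cutoff does not affect the data term.\<close>
  have g1half: "g1 x = 0" if "x \<le> 1/2" for x
  proof (cases "x = 1/2")
    case True
    have "(g1 \<longlongrightarrow> g1 (1/2)) (at_left (1/2))"
      using DERIV_isCont[OF g(2), of "1/2"] by (auto simp: isCont_def intro: filterlim_mono at_le)
    moreover have "(g1 \<longlongrightarrow> 0) (at_left (1/2))"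
      by (rule Lim_transform_eventually[OF tendsto_const]) (auto simp: eventually_at_filter g(5))
    ultimately have "g1 (1/2) = 0" using tendsto_unique[OF trivial_limit_at_left_real] by blast
    then show ?thesis by (simp only: True)
  qed (use that g(5) in auto)
  have a1_1: "a1 1 = \<alpha>1 1" using a_1(2) g1half[of "1 / \<tau>"] \<tau> by (simp add: field_simps)
  \<comment> \<open>What remains of the adjoint operator applied to \<alpha> h^k after the equation
    for \<alpha> has removed the terms in which no derivative hits the cutoff.\<close>
  define E where "E s = 2 * \<alpha>1 s * (g1 (s / \<tau>) / \<tau>) + \<alpha> s * (g2 (s / \<tau>) / \<tau> / \<tau>) - \<mu> * \<alpha> s * (g1 (s / \<tau>) / \<tau>) / s" for s
  define D where "D s = cutoff_error Cg \<mu> \<tau> \<alpha> \<alpha>1 s" for s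
  have D0: "0 \<le> D s" if "s \<in> {1..\<tau>}" for s unfolding D_def using that g(7) \<tau> \<mu> by (intro cutoff_error_nonneg) auto
  have DE: "Y s * (a2 s - \<mu> * (a1 s / s - a s / s\<^sup>2) + \<nu>\<^sup>2 / s\<^sup>2 * a s) - s powr (2 * l) * a s * Z s = Y s * E s" if s: "s \<in> {1..\<tau>}" for s
  proof -
    have s0: "s > 0" using s by simp
    have "a2 s - \<mu> * (a1 s / s - a s / s\<^sup>2) + \<nu>\<^sup>2 / s\<^sup>2 * a s - \<kappa> * s powr (2 * l) * a s
      = \<eta> s ^ k * (\<alpha>2 s - \<mu> * (\<alpha>1 s / s - \<alpha> s / s\<^sup>2) + \<nu>\<^sup>2 / s\<^sup>2 * \<alpha> s - \<kappa> * s powr (2 * l) * \<alpha> s) + E s"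
      by (simp add: a2_def a1_def a_def E_def algebra_simps add_divide_distrib)
    then have *: "a2 s - \<mu> * (a1 s / s - a s / s\<^sup>2) + \<nu>\<^sup>2 / s\<^sup>2 * a s = E s + \<kappa> * s powr (2 * l) * a s"
      unfolding \<alpha>(4)[OF s0] by simp
    show ?thesis unfolding * Zeq[OF s] by (simp add: algebra_simps)
  qed
  have Ebound: "\<bar>E s\<bar> \<le> \<eta> s ^ (k - 2) * D s" if s: "s \<in> {1..\<tau>}" for s
  proof -
    have s0: "s > 0" using s by simp
    define X where "X = Cg * \<eta> s ^ (k - 2)"
    have gx: "\<bar>g1 (s / \<tau>)\<bar> \<le> X" "\<bar>g2 (s / \<tau>)\<bar> \<le> X" using g(3,4)[of "s / \<tau>"] by (auto simp: X_def \<eta>_def)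
    have "\<bar>E s\<bar> \<le> \<bar>2 * \<alpha>1 s * (g1 (s / \<tau>) / \<tau>)\<bar> + \<bar>\<alpha> s * (g2 (s / \<tau>) / \<tau> / \<tau>)\<bar> + \<bar>\<mu> * \<alpha> s * (g1 (s / \<tau>) / \<tau>) / s\<bar>"
      unfolding E_def by linarith
    also have "\<dots> = (2 * \<bar>\<alpha>1 s\<bar> / \<tau>) * \<bar>g1 (s / \<tau>)\<bar> + (\<bar>\<alpha> s\<bar> / \<tau>\<^sup>2) * \<bar>g2 (s / \<tau>)\<bar> + (\<mu> * \<bar>\<alpha> s\<bar> / (\<tau> * s)) * \<bar>g1 (s / \<tau>)\<bar>"
      using \<tau> \<mu> s0 by (simp add: abs_mult power2_eq_square)
    also have "\<dots> \<le> (2 * \<bar>\<alpha>1 s\<bar> / \<tau>) * X + (\<bar>\<alpha> s\<bar> / \<tau>\<^sup>2) * X + (\<mu> * \<bar>\<alpha> s\<bar> / (\<tau> * s)) * X"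
      using gx \<tau> \<mu> s0 by (intro add_mono mult_left_mono) auto
    also have "\<dots> = \<eta> s ^ (k - 2) * D s" by (simp add: X_def D_def cutoff_error_def distrib_left distrib_right mult_ac)
    finally show ?thesis .
  qed
  have E0: "E s = 0" if "s < \<tau> / 2" for s using g(5,6)[of "s / \<tau>"] that \<tau> by (simp add: E_def field_simps)
  have k1: "(1::nat) \<le> k" using k2 by simp
  have PI: "AE s in lebesgue. s \<in> {1..\<tau>} \<and> h (s / \<tau>) \<noteq> 0 \<longrightarrow> integrable lebesgue (\<lambda>x. \<bar>u s x\<bar> powr p)"
    "(\<lambda>s. h (s / \<tau>) ^ k * (LINT x|lebesgue. \<bar>u s x\<bar> powr p)) absolutely_integrable_on {1..\<tau>}"
    by (rule weak_solution_power_integrable[OF sol l R u0 \<tau> h(1) _ k1], rule h(2), assumption)+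
  have Gi: "set_integrable lebesgue {\<tau>/2..\<tau>} (\<lambda>s. \<eta> s ^ k * G s)"
    by (rule set_integrable_subset[OF _ _ half]) (use PI(2) in \<open>auto simp: \<eta>_def G_def\<close>)
  have Ah: "Ah = (LINT s:{\<tau>/2..\<tau>}|lebesgue. \<eta> s ^ k * G s)" by (simp add: Ah_def \<eta>_def G_def)
  have Gnn: "G s \<ge> 0" for s by (simp add: G_def)
  have pt: "AE s in lebesgue. s \<in> {1..\<tau>} \<longrightarrow> \<bar>Y s\<bar> * \<bar>E s\<bar> \<le> indicator {\<tau>/2..\<tau>} s * (x0 * (\<eta> s ^ k * G s) + x0 powr (1 - q) * M)"
    using PI(1)
  proof eventually_elim
    case (elim s)
    show ?case
    proof
      assume s: "s \<in> {1..\<tau>}"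
      show "\<bar>Y s\<bar> * \<bar>E s\<bar> \<le> indicator {\<tau>/2..\<tau>} s * (x0 * (\<eta> s ^ k * G s) + x0 powr (1 - q) * M)"
      proof (cases "s < \<tau> / 2")
        case True
        then show ?thesis using E0[OF True] by simp
      next
        case False
        then have s2: "s \<in> {\<tau>/2..\<tau>}" using s by auto
        define V where "V = (LINT x:ball 0 (\<rho> s)|lebesgue. \<Phi> x powr q)"
        have V0: "V \<ge> 0" unfolding V_def set_lebesgue_integral_def by (intro integral_nonneg_AE) auto
        have DV: "D s powr q * V \<le> M" using M[OF s2] by (simp add: D_def V_def \<rho>_def)
        then have M0: "M \<ge> 0" using V0 by (meson mult_nonneg_nonneg order_trans powr_ge_zero)
        show ?thesis
        \<comment> \<open>Young's inequality is applied with the weight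
          \<open>x0 * \<eta> s ^ k\<close>, which must be positive. Where \<eta> vanishes the error
          vanishes too, as k > 2.\<close>
        proof (cases "\<eta> s = 0")
          case True
          have "\<bar>Y s\<bar> * \<bar>E s\<bar> \<le> \<bar>Y s\<bar> * (\<eta> s ^ (k - 2) * D s)" by (intro mult_left_mono Ebound[OF s]) auto
          also have "\<dots> = 0" using True k q by (simp add: zero_power)
          also have "0 \<le> x0 powr (1 - q) * M" using M0 by simp
          finally show ?thesis using True k2 s2 by (simp add: zero_power)
        next
          case False
          then have e: "\<eta> s > 0" using \<eta>(1)[of s] by simp
          have vp: "integrable lebesgue (\<lambda>x. \<bar>u s x\<bar> powr p)" using elim s False by (simp add: \<eta>_def)
          have X: "x0 * \<eta> s ^ k > 0" using x0 e by simp
          have bs: "b x = \<Phi> x" if "x \<in> ball 0 (\<rho> s)" for x using that \<rho>[OF s] by (intro b(2)) auto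
          have "\<bar>Y s\<bar> * \<bar>E s\<bar> \<le> \<bar>Y s\<bar> * (\<eta> s ^ (k - 2) * D s)" by (intro mult_left_mono Ebound[OF s]) auto
          also have "\<dots> \<le> (x0 * \<eta> s ^ k) * G s + (x0 * \<eta> s ^ k) powr (1 - q) * ((\<eta> s ^ (k - 2) * D s) powr q * V)"
            unfolding Y_def G_def V_def
            by (rule young_slice[OF Lu[OF s] mu[OF s] supp[OF s] vp b(1) bs smooth_on_imp_continuous_on[OF \<Phi>(1)] \<Phi>(2) X _ p])
              (use e D0[OF s] in auto)
          also have "(x0 * \<eta> s ^ k) powr (1 - q) * ((\<eta> s ^ (k - 2) * D s) powr q * V)
              = x0 powr (1 - q) * (\<eta> s powr (real k - 2 * q) * (D s powr q * V))"
          proof -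
            \<comment> \<open>The total power of the cutoff is k - 2 q, nonnegative by the choice of
              \<open>k\<close>, so the factor is at most 1.\<close>
            have "(\<eta> s ^ k) powr (1 - q) * (\<eta> s ^ (k - 2)) powr q = \<eta> s powr (real k * (1 - q) + real (k - 2) * q)"
              using e by (simp add: powr_powr powr_add flip: powr_realpow)
            also have "real k * (1 - q) + real (k - 2) * q = real k - 2 * q" using k2 by (simp add: algebra_simps of_nat_diff)
            finally have *: "(\<eta> s ^ k) powr (1 - q) * (\<eta> s ^ (k - 2)) powr q = \<eta> s powr (real k - 2 * q)" .
            show ?thesis using e x0 D0[OF s] unfolding *[symmetric] by (simp add: powr_mult mult_ac)
          qed
          also have "\<dots> \<le> x0 powr (1 - q) * (1 * M)"
            using DV V0 \<eta>[of s] k e by (intro mult_left_mono mult_mono) (auto intro: powr_le1)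
          finally show ?thesis using s2 by (simp add: mult.assoc)
        qed
      qed
    qed
  qed
  have cE: "continuous_on {1..\<tau>} (\<lambda>s. Y s * (a2 s - \<mu> * (a1 s / s - a s / s\<^sup>2) + \<nu>\<^sup>2 / s\<^sup>2 * a s) - s powr (2 * l) * a s * Z s)"
  proof -
    have sub: "{1..\<tau>} \<subseteq> {0<..}" by auto
    have "continuous_on {1..\<tau>} a" "continuous_on {1..\<tau>} a1" "continuous_on {1..\<tau>} a2"
      using sa sa1 sa2 by (auto intro: continuous_on_subset[OF smooth_on_imp_continuous_on sub])
    then show ?thesis using W(3,4) by (auto intro!: continuous_intros)
  qed
  have fin: "M' \<ge> 0 \<Longrightarrow> (LINT s:{\<tau>/2..\<tau>}|lebesgue. M') \<le> \<tau> * M'" for M' :: real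
    using \<tau> by (simp add: set_lebesgue_integral_def mult_right_mono)
  have Mnn: "M \<ge> 0"
  proof -
    have "0 \<le> (LINT x:ball 0 (R + phi_speed l \<tau> - phi_speed l 1)|lebesgue. \<Phi> x powr q)"
      unfolding set_lebesgue_integral_def by (intro integral_nonneg_AE) auto
    moreover have "\<tau> \<in> {\<tau>/2..\<tau>}" using \<tau> by simp
    ultimately show ?thesis by (rule order_trans[OF mult_nonneg_nonneg[OF powr_ge_zero] M])
  qed
  have I: "(LINT s:{1..\<tau>}|lebesgue. Y s * (a2 s - \<mu> * (a1 s / s - a s / s\<^sup>2) + \<nu>\<^sup>2 / s\<^sup>2 * a s) - s powr (2 * l) * a s * Z s)
      \<le> x0 * Ah + \<tau> * (x0 powr (1 - q) * M)"
  proof -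
    have i1: "set_integrable lebesgue {\<tau>/2..\<tau>} (\<lambda>s. x0 * (\<eta> s ^ k * G s))" using Gi by simp
    have i2: "set_integrable lebesgue {\<tau>/2..\<tau>} (\<lambda>s. x0 powr (1 - q) * M)"
      by (rule absolutely_integrable_continuous_real) (rule continuous_on_const)
    have "(LINT s:{1..\<tau>}|lebesgue. Y s * (a2 s - \<mu> * (a1 s / s - a s / s\<^sup>2) + \<nu>\<^sup>2 / s\<^sup>2 * a s) - s powr (2 * l) * a s * Z s)
      \<le> (LINT s:{\<tau>/2..\<tau>}|lebesgue. x0 * (\<eta> s ^ k * G s) + x0 powr (1 - q) * M)"
      unfolding set_lebesgue_integral_def
    proof (rule integral_mono_AE)
      show "integrable lebesgue (\<lambda>s. indicator {1..\<tau>} s *\<^sub>R (Y s * (a2 s - \<mu> * (a1 s / s - a s / s\<^sup>2) + \<nu>\<^sup>2 / s\<^sup>2 * a s) - s powr (2 * l) * a s * Z s))"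
        using absolutely_integrable_continuous_real[OF cE] by (simp only: set_integrable_def)
      show "integrable lebesgue (\<lambda>s. indicator {\<tau>/2..\<tau>} s *\<^sub>R (x0 * (\<eta> s ^ k * G s) + x0 powr (1 - q) * M))"
        using set_integral_add(1)[OF i1 i2] by (simp only: set_integrable_def)
      show "AE s in lebesgue. indicator {1..\<tau>} s *\<^sub>R (Y s * (a2 s - \<mu> * (a1 s / s - a s / s\<^sup>2) + \<nu>\<^sup>2 / s\<^sup>2 * a s) - s powr (2 * l) * a s * Z s)
          \<le> indicator {\<tau>/2..\<tau>} s *\<^sub>R (x0 * (\<eta> s ^ k * G s) + x0 powr (1 - q) * M)"
        using pt
      proof eventually_elim
        case (elim s)
        show ?case
        proof (cases "s \<in> {1..\<tau>}")
          case True
          have "Y s * E s \<le> \<bar>Y s\<bar> * \<bar>E s\<bar>" by (metis abs_ge_self abs_mult)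
          then show ?thesis using elim True DE[OF True] by simp
        next
          case False
          then have "s \<notin> {\<tau>/2..\<tau>}" using half by blast
          then show ?thesis using False by simp
        qed
      qed
    qed
    also have "\<dots> = x0 * Ah + (LINT s:{\<tau>/2..\<tau>}|lebesgue. x0 powr (1 - q) * M)"
      unfolding set_integral_add(2)[OF i1 i2] Ah by simp
    also have "\<dots> \<le> x0 * Ah + \<tau> * (x0 powr (1 - q) * M)"
      using fin[of "x0 powr (1 - q) * M"] Mnn by simp
    finally show ?thesis .
  qed
  have id: "\<epsilon> * data + (LINT s:{1..\<tau>}|lebesgue. LINT x|lebesgue. \<bar>u s x\<bar> powr p * (a s * b x)) \<le> x0 * Ah + \<tau> * (x0 powr (1 - q) * M)"
    using W(5) I unfolding data_def init[OF u0] init[OF u1] a_1(1) a1_1 by simp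
  have inn: "0 \<le> (LINT x|lebesgue. \<bar>u s x\<bar> powr p * (a s * b x))" if "s \<in> {1..\<tau>}" for s
    using \<alpha>(5)[OF that] \<eta>(1) b(3) by (intro integral_nonneg_AE) (auto simp: a_def)
  have "0 \<le> (LINT s:{1..\<tau>}|lebesgue. LINT x|lebesgue. \<bar>u s x\<bar> powr p * (a s * b x))"
    unfolding set_lebesgue_integral_def using inn by (intro integral_nonneg_AE) (auto simp: indicator_def)
  then show ?A using id by (simp add: data_def)
  show "\<epsilon> * (\<alpha> 1 * (LINT x|lebesgue. u1 x * \<Phi> x) + (\<mu> * \<alpha> 1 - \<alpha>1 1) * (LINT x|lebesgue. u0 x * \<Phi> x)) + c * Ah
      \<le> x0 * Ah + \<tau> * (x0 powr (1 - q) * M)" if one: "\<And>x. \<Phi> x = 1" and c: "c \<ge> 0" "\<And>s. s \<in> {\<tau>/2..\<tau>} \<Longrightarrow> c \<le> \<alpha> s"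
  proof -
    \<comment> \<open>The nonlinear term, dropped as nonnegative in the first claim, is kept here:
      for \<Phi> = 1 its part over [\<tau>/2, \<tau>] is at least c times \<open>Ah\<close>.\<close>
    have "c * Ah = (LINT s:{\<tau>/2..\<tau>}|lebesgue. c * (\<eta> s ^ k * G s))" by (simp add: Ah)
    also have "\<dots> \<le> (LINT s:{1..\<tau>}|lebesgue. LINT x|lebesgue. \<bar>u s x\<bar> powr p * (a s * b x))"
      unfolding set_lebesgue_integral_def
    proof (rule integral_mono)
      have "set_integrable lebesgue {\<tau>/2..\<tau>} (\<lambda>s. c * (\<eta> s ^ k * G s))" using Gi by simp
      then show "integrable lebesgue (\<lambda>s. indicator {\<tau>/2..\<tau>} s *\<^sub>R (c * (\<eta> s ^ k * G s)))" by (simp only: set_integrable_def)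
      show "integrable lebesgue (\<lambda>s. indicator {1..\<tau>} s *\<^sub>R (LINT x|lebesgue. \<bar>u s x\<bar> powr p * (a s * b x)))"
        using W(2) by (simp only: set_integrable_def)
      show "indicator {\<tau>/2..\<tau>} s *\<^sub>R (c * (\<eta> s ^ k * G s)) \<le> indicator {1..\<tau>} s *\<^sub>R (LINT x|lebesgue. \<bar>u s x\<bar> powr p * (a s * b x))" for s
      proof (cases "s \<in> {\<tau>/2..\<tau>}")
        case True
        then have s: "s \<in> {1..\<tau>}" using half by blast
        have ae: "AE x in lebesgue. a s * \<bar>u s x\<bar> powr p = \<bar>u s x\<bar> powr p * (a s * b x)"
          using supp'[OF s] by eventually_elim (use b(2) one in auto)
        have m: "(\<lambda>x. a s * \<bar>u s x\<bar> powr p) \<in> borel_measurable lebesgue" using mu[OF s] by measurable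
        have "a s * G s = (LINT x|lebesgue. \<bar>u s x\<bar> powr p * (a s * b x))"
          using integral_cong_AE[OF m borel_measurable_AE[OF m ae] ae] by (simp add: G_def)
        moreover have "c * (\<eta> s ^ k * G s) \<le> a s * G s"
          unfolding a_def using mult_right_mono[OF c(2)[OF True], of "\<eta> s ^ k * G s"] \<eta>(1)[of s] Gnn[of s] by (simp add: mult.assoc)
        ultimately show ?thesis using True s by simp
      next
        case False
        then show ?thesis using inn[of s] by (simp add: indicator_def)
      qed
    qed
    finally show ?thesis using id by (simp add: data_def)
  qed
qed

subsection \<open>Lifespan estimates\<close>

text \<open>On [\<tau>/2, \<tau>] a power of s is comparable to that of \<tau>; the constants 2^|x|
  and 2^(-|x|) serve exponents of either sign.\<close>

lemma powr_half_bounds: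
  fixes s x \<tau> :: real
  assumes "\<tau> > 0" "s \<in> {\<tau>/2..\<tau>}"
  shows "s powr x \<le> 2 powr \<bar>x\<bar> * \<tau> powr x" "2 powr (- \<bar>x\<bar>) * \<tau> powr x \<le> s powr x"
proof -
  define y where "y = s / \<tau>"
  have y: "1/2 \<le> y" "y \<le> 1" "s = y * \<tau>" using assms by (auto simp: y_def field_simps)
  have two: "(1/2) powr x = 2 powr (- x)" unfolding powr_minus_divide powr_divide by simp
  have "y powr x \<le> 2 powr \<bar>x\<bar> \<and> 2 powr (- \<bar>x\<bar>) \<le> y powr x"
  proof (cases "x \<ge> 0")
    case True
    have "y powr x \<le> 1 powr x" "(1/2) powr x \<le> y powr x" by (rule powr_mono2; use y True in linarith)+
    moreover have "1 \<le> 2 powr \<bar>x\<bar>" by (simp add: ge_one_powr_ge_zero)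
    ultimately show ?thesis using True two by simp
  next
    case False
    have "y powr x \<le> (1/2) powr x" "1 powr x \<le> y powr x" by (rule powr_mono2'; use y False in linarith)+
    moreover have "2 powr (- \<bar>x\<bar>) \<le> 2 powr (0::real)" by (intro powr_mono) auto
    ultimately show ?thesis using False two by simp
  qed
  moreover have "s powr x = y powr x * \<tau> powr x" unfolding y(3) using y assms by (simp add: powr_mult)
  ultimately show "s powr x \<le> 2 powr \<bar>x\<bar> * \<tau> powr x" "2 powr (- \<bar>x\<bar>) * \<tau> powr x \<le> s powr x"
    by (auto intro: mult_right_mono)
qed

text \<open>The extremal end of the interval for Y depends on the sign of \<open>m\<close>; adding
  both constants covers the two cases.\<close>

lemma powr_comparable:
  fixes X Y c1 c2 m :: real
  assumes "c1 > 0" "X > 0" "c1 * X \<le> Y" "Y \<le> c2 * X"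
  shows "Y powr m \<le> (c1 powr m + c2 powr m) * X powr m"
proof -
  have "c1 * X \<le> c2 * X" using assms by linarith
  then have c2: "c2 > 0" using assms by simp
  have "c1 * X > 0" using assms by simp
  then have Y: "Y > 0" using assms by linarith
  have "Y powr m \<le> (c1 * X) powr m + (c2 * X) powr m"
  proof (cases "m \<ge> 0")
    case True
    then have "Y powr m \<le> (c2 * X) powr m" using assms Y by (intro powr_mono2) auto
    then show ?thesis by (smt (verit) powr_ge_zero)
  next
    case False
    then have "Y powr m \<le> (c1 * X) powr m" using assms Y by (intro powr_mono2') auto
    then show ?thesis by (smt (verit) powr_ge_zero)
  qed
  then show ?thesis using assms c2 by (simp add: powr_mult distrib_right)
qed

text \<open>The radius of the support compared with s^(l + 1). The lower bound concerns 1 plus the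
  radius, the quantity raised to a power of unknown sign in the integral over the ball.\<close>

lemma cone_radius_bounds:
  fixes l R s :: real
  assumes "l > -1" "R > 0" "s \<ge> 1"
  shows "0 \<le> R + phi_speed l s - phi_speed l 1"
    "R + phi_speed l s - phi_speed l 1 \<le> (R + 1 / (l + 1)) * s powr (l + 1)"
    "min 1 (1 / (l + 1)) * s powr (l + 1) \<le> 1 + (R + phi_speed l s - phi_speed l 1)"
    "1 + (R + phi_speed l s - phi_speed l 1) \<le> (1 + R + 1 / (l + 1)) * s powr (l + 1)"
proof -
  define X where "X = s powr (l + 1)"
  define d where "d = 1 / (l + 1)"
  have X: "X \<ge> 1" using assms by (simp add: X_def ge_one_powr_ge_zero)
  have d: "d > 0" using assms by (simp add: d_def)
  have ph: "R + phi_speed l s - phi_speed l 1 = R + d * (X - 1)"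
    by (simp add: phi_speed_def X_def d_def diff_divide_distrib right_diff_distrib)
  have dX: "0 \<le> d * (X - 1)" using d X by simp
  show "0 \<le> R + phi_speed l s - phi_speed l 1" unfolding ph using dX assms by simp
  have RX: "R \<le> R * X" using X assms by simp
  show "R + phi_speed l s - phi_speed l 1 \<le> (R + 1 / (l + 1)) * s powr (l + 1)"
    unfolding ph X_def[symmetric] d_def[symmetric] using RX d by (simp add: algebra_simps)
  have "(1 + R) \<le> (1 + R) * X" using X assms by simp
  then show "1 + (R + phi_speed l s - phi_speed l 1) \<le> (1 + R + 1 / (l + 1)) * s powr (l + 1)"
    unfolding ph X_def[symmetric] d_def[symmetric] using d by (simp add: algebra_simps)
  have "min 1 d * X = min 1 d + min 1 d * (X - 1)" by (simp add: algebra_simps)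
  also have "\<dots> \<le> 1 + d * (X - 1)" using X d by (intro add_mono mult_right_mono) auto
  finally show "min 1 (1 / (l + 1)) * s powr (l + 1) \<le> 1 + (R + phi_speed l s - phi_speed l 1)"
    unfolding ph X_def[symmetric] d_def[symmetric] using assms by simp
qed

text \<open>Solving \<epsilon> \<le> C \<tau>^(-x) for \<tau> bounds every admissible \<tau>, hence
  T. The decay is known for \<tau> \<ge> 2 only; since \<epsilon> \<le> 1, the power of \<epsilon>
  is at least 1, and the maximum with 2 keeps the bound in that range.\<close>

lemma lifespan_from_decay:
  fixes T :: ereal and C x \<epsilon> :: real
  assumes "x > 0" "C > 0" "0 < \<epsilon>" "\<epsilon> \<le> 1"
    and decay: "\<And>\<tau>. 2 \<le> \<tau> \<Longrightarrow> ereal \<tau> < T \<Longrightarrow> \<epsilon> \<le> C * \<tau> powr (- x)"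
  shows "T \<le> ereal (max 2 (C powr (1 / x)) * \<epsilon> powr (- (1 / x)))"
proof (rule ccontr)
  define B where "B = max 2 (C powr (1 / x)) * \<epsilon> powr (- (1 / x))"
  assume "\<not> T \<le> ereal (max 2 (C powr (1 / x)) * \<epsilon> powr (- (1 / x)))"
  then have "ereal B < T" by (simp add: B_def)
  then obtain \<tau> where \<tau>: "ereal B < ereal \<tau>" "ereal \<tau> < T" using ereal_dense2 by blast
  have e1: "1 \<le> \<epsilon> powr (- (1 / x))"
  proof -
    have "1 powr (- (1 / x)) \<le> \<epsilon> powr (- (1 / x))" using assms by (intro powr_mono2') auto
    then show ?thesis by simp
  qed
  have "2 * 1 \<le> B" unfolding B_def using e1 by (intro mult_mono) auto
  then have t2: "2 \<le> \<tau>" using \<tau> by simp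
  have "\<epsilon> \<le> C * \<tau> powr (- x)" by (rule decay[OF t2 \<tau>(2)])
  then have "\<epsilon> * \<tau> powr x \<le> C * \<tau> powr (- x) * \<tau> powr x" by (intro mult_right_mono) auto
  also have "\<dots> = C" using t2 by (simp add: mult.assoc flip: powr_add)
  finally have "\<tau> powr x \<le> C * inverse \<epsilon>" using assms by (simp add: field_simps)
  then have "(\<tau> powr x) powr (1 / x) \<le> (C * inverse \<epsilon>) powr (1 / x)" using assms by (intro powr_mono2) auto
  then have "\<tau> \<le> C powr (1 / x) * \<epsilon> powr (- (1 / x))"
    using assms t2 by (simp add: powr_powr powr_mult powr_minus inverse_powr)
  also have "\<dots> \<le> B" unfolding B_def by (intro mult_right_mono) auto
  finally show False using \<tau> by simp
qed

text \<open>Up to the factor l + 1, \<open>theta\<close> is minus the quadratic polynomial that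
  defines \<open>pStr\<close>. If A > 0, the comparison with the largest root decides the sign. If A
  \<le> 0, then l \<le> 0, hence B > 0, and 1 + B p - A p^2 has no negative term.\<close>

lemma theta_pos:
  fixes l \<mu> p :: real and n :: nat
  assumes "l > -1" "\<mu> \<ge> 0" "n \<ge> 1" "1 < p" "p < pStr (real n + \<mu> / (l + 1)) l"
  shows "theta n l \<mu> p > 0"
proof -
  define L where "L = l + 1"
  have L: "L > 0" "l = L - 1" using assms by (auto simp: L_def)
  define A where "A = ((real n + \<mu> / L) - 1) / 2 + l / (2 * L)"
  define B where "B = ((real n + \<mu> / L) + 1) / 2 - 3 * l / (2 * L)"
  have AL: "2 * L * A = (real n - 1) * L + \<mu> + l" using L(1) by (simp add: A_def field_simps)
  have BL: "2 * L * B = (real n + 1) * L + \<mu> - 3 * l" using L(1) by (simp add: B_def field_simps)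
  have "2 * theta n l \<mu> p = 2 * L + ((real n + 1) * L + \<mu> - 3 * l) * p - ((real n - 1) * L + \<mu> + l) * p\<^sup>2"
    by (simp add: theta_def L_def field_simps)
  then have th: "theta n l \<mu> p = L * (1 + B * p - A * p\<^sup>2)"
    unfolding AL[symmetric] BL[symmetric] by (simp add: algebra_simps)
  have "1 + B * p - A * p\<^sup>2 > 0"
  proof (cases "A > 0")
    case False
    have "2 * L * A \<le> 0" using False L by (simp add: mult_nonneg_nonpos)
    moreover have "(real n - 1) * L \<ge> 0" using assms L by simp
    ultimately have "l \<le> 0" using AL assms by linarith
    have "(real n + 1) * L > 0" using L by simp
    then have "2 * L * B > 0" unfolding BL using \<open>l \<le> 0\<close> assms by linarith
    then have "B > 0" using L by (simp add: zero_less_mult_iff)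
    then have "B * p > 0" using assms by simp
    moreover have "A * p\<^sup>2 \<le> 0" using False by (simp add: mult_nonpos_nonneg)
    ultimately show ?thesis by linarith
  next
    case A: True
    define S where "S = {q. A * q\<^sup>2 - B * q - 1 = 0}"
    have pS: "pStr (real n + \<mu> / (l + 1)) l = Max S" by (simp add: pStr_def S_def A_def B_def L_def)
    define d where "d = sqrt (B\<^sup>2 + 4 * A)"
    have d: "d * d = B\<^sup>2 + 4 * A" using A by (simp add: d_def)
    have fac: "A * q\<^sup>2 - B * q - 1 = A * (q - (B + d) / (2 * A)) * (q - (B - d) / (2 * A))" for q
    proof -
      have "A * (q - (B + d) / (2 * A)) * (q - (B - d) / (2 * A)) = A * q\<^sup>2 - B * q + (B\<^sup>2 - d * d) / (4 * A)"
        using A by (simp add: field_simps power2_eq_square)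
      also have "(B\<^sup>2 - d * d) / (4 * A) = -1" unfolding d using A by simp
      finally show ?thesis by simp
    qed
    have S: "S = {(B + d) / (2 * A), (B - d) / (2 * A)}" unfolding S_def fac using A by auto
    define P where "P = Max S"
    have "P \<in> S" unfolding P_def by (rule Max_in) (auto simp: S)
    then have fP: "A * P\<^sup>2 - B * P - 1 = 0" by (simp add: S_def)
    have P: "p < P" "P > 0" using assms pS by (auto simp: P_def)
    \<comment> \<open>Multiplying by the root P and inserting B P = A P^2 - 1 exhibits the factor P
      - p.\<close>
    have "(1 + B * p - A * p\<^sup>2) * P = P + (A * P\<^sup>2 - 1) * p - A * p\<^sup>2 * P"
      using fP by (simp add: algebra_simps)
    also have "\<dots> = (P - p) + A * p * P * (P - p)" by (simp add: algebra_simps power2_eq_square)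
    also have "\<dots> > 0" using P A assms by (intro add_pos_pos mult_pos_pos) auto
    finally show ?thesis using P(2) by (simp add: zero_less_mult_iff)
  qed
  then show ?thesis unfolding th using L by simp
qed

section \<open>Weights that are constant in space\<close>

text \<open>The weight itself may depend on \<tau>, but \<open>c\<close>, \<open>M\<close> and
  \<open>d0\<close> are meant to be chosen before \<tau>. The last clause bounds the data functional
  from below; \<open>I0\<close> and \<open>I1\<close> stand for the integrals of \<open>u0\<close>
  and \<open>u1\<close>.\<close>

definition power_weight ::
    "real \<Rightarrow> real \<Rightarrow> real \<Rightarrow> real \<Rightarrow> real \<Rightarrow> real \<Rightarrow> real \<Rightarrow> (real \<Rightarrow> real) \<Rightarrow> (real \<Rightarrow> real) \<Rightarrow> (real \<Rightarrow> real) \<Rightarrow> bool" where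
  "power_weight \<mu> \<nu> r c M d0 \<tau> \<alpha> \<alpha>1 \<alpha>2 \<longleftrightarrow> smooth_on \<alpha> {0<..} \<and> (\<forall>t>0. (\<alpha> has_real_derivative \<alpha>1 t) (at t)) \<and>
      (\<forall>t>0. (\<alpha>1 has_real_derivative \<alpha>2 t) (at t)) \<and>
      (\<forall>t>0. \<alpha>2 t - \<mu> * (\<alpha>1 t / t - \<alpha> t / t\<^sup>2) + \<nu>\<^sup>2 / t\<^sup>2 * \<alpha> t = 0) \<and>
      (\<forall>t\<in>{1..\<tau>}. 0 \<le> \<alpha> t) \<and>
      (\<forall>s\<in>{\<tau>/2..\<tau>}. c * \<tau> powr (1 + r) \<le> \<alpha> s \<and> \<bar>\<alpha> s\<bar> \<le> M * \<tau> powr (1 + r) \<and> \<bar>\<alpha>1 s\<bar> \<le> M * \<tau> powr r) \<and>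
      (\<forall>I0 I1. 0 \<le> I0 \<longrightarrow> 0 \<le> I1 + r * I0 \<longrightarrow> d0 * I0 \<le> \<alpha> 1 * I1 + (\<mu> * \<alpha> 1 - \<alpha>1 1) * I0)"

text \<open>The power t^(1 + r) solves the equation because (1 + r) r - \<mu> r + \<nu>^2 = 0. For
  \<delta> > 0 the data functional is (I1 + r I0) + sqrt \<delta> I0. For \<delta> = 0 the root is
  double, so a logarithm is available, and its derivative at 1 contributes the missing multiple of
  I0.\<close>

lemma power_weight_exists:
  fixes \<mu> \<nu> \<delta> :: real
  assumes \<delta>: "\<delta> = (\<mu> - 1)\<^sup>2 - 4 * \<nu>\<^sup>2" "\<delta> \<ge> 0"
  defines "r \<equiv> (\<mu> - 1 - sqrt \<delta>) / 2"
  obtains c M d0 where "c > 0" "M > 0" "d0 > 0"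
    "\<And>\<tau>. \<tau> \<ge> 2 \<Longrightarrow> \<exists>\<alpha> \<alpha>1 \<alpha>2. power_weight \<mu> \<nu> r c M d0 \<tau> \<alpha> \<alpha>1 \<alpha>2"
proof -
  have char: "(1 + r) * r - \<mu> * r + \<nu>\<^sup>2 = 0"
  proof -
    have "4 * ((1 + r) * r - \<mu> * r + \<nu>\<^sup>2) = (2 * r - (\<mu> - 1))\<^sup>2 - ((\<mu> - 1)\<^sup>2 - 4 * \<nu>\<^sup>2)" by (simp add: power2_eq_square algebra_simps)
    also have "2 * r - (\<mu> - 1) = - sqrt \<delta>" unfolding r_def by (simp add: field_simps)
    also have "(- sqrt \<delta>)\<^sup>2 - ((\<mu> - 1)\<^sup>2 - 4 * \<nu>\<^sup>2) = 0" using \<delta> by simp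
    finally show ?thesis by simp
  qed
  have rd: "2 * r = \<mu> - 1 - sqrt \<delta>" unfolding r_def by (simp add: field_simps)
  define K where "K = 2 powr \<bar>1 + r\<bar> + 2 powr \<bar>r\<bar>"
  have K: "K > 0" "2 powr \<bar>1 + r\<bar> \<le> K" "2 powr \<bar>r\<bar> \<le> K" by (auto simp: K_def intro: add_pos_pos)
  have pd: "((\<lambda>t. t powr a) has_real_derivative a * t powr (a - 1)) (at t)" if "t > 0" for a t :: real
    using that by (auto intro!: derivative_eq_intros)
  have bnd: "s powr (1 + r) \<le> K * \<tau> powr (1 + r)" "s powr r \<le> K * \<tau> powr r" "2 powr (- \<bar>1 + r\<bar>) * \<tau> powr (1 + r) \<le> s powr (1 + r)"
    if "s \<in> {\<tau>/2..\<tau>}" "\<tau> \<ge> 2" for s \<tau> :: real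
  proof -
    have t0: "\<tau> > 0" using that by simp
    show "s powr (1 + r) \<le> K * \<tau> powr (1 + r)" "s powr r \<le> K * \<tau> powr r" "2 powr (- \<bar>1 + r\<bar>) * \<tau> powr (1 + r) \<le> s powr (1 + r)"
      using order_trans[OF powr_half_bounds(1)[OF t0 that(1)] mult_right_mono[OF K(2)]]
        order_trans[OF powr_half_bounds(1)[OF t0 that(1)] mult_right_mono[OF K(3)]] powr_half_bounds(2)[OF t0 that(1)]
      by auto
  qed
  show ?thesis
  proof (cases "\<delta> > 0")
    case True
    show ?thesis
    proof (rule that[of "2 powr (- \<bar>1 + r\<bar>)" "(1 + \<bar>1 + r\<bar>) * K" "sqrt \<delta>"])
      show "0 < (1 + \<bar>1 + r\<bar>) * K" using K by (intro mult_pos_pos) auto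
      show "0 < sqrt \<delta>" using True by simp
      fix \<tau> :: real assume \<tau>: "\<tau> \<ge> 2"
      define \<alpha> where "\<alpha> t = t powr (1 + r)" for t :: real
      define \<alpha>1 where "\<alpha>1 t = (1 + r) * t powr r" for t :: real
      define \<alpha>2 where "\<alpha>2 t = (1 + r) * (r * t powr (r - 1))" for t :: real
      have "(\<alpha> has_real_derivative \<alpha>1 t) (at t)" "(\<alpha>1 has_real_derivative \<alpha>2 t) (at t)" if "t > 0" for t
        unfolding \<alpha>_def[abs_def] \<alpha>1_def[abs_def] \<alpha>2_def using pd[OF that, of "1 + r"] DERIV_cmult[OF pd[OF that, of r], of "1 + r"] by simp_all
      moreover have "\<alpha>2 t - \<mu> * (\<alpha>1 t / t - \<alpha> t / t\<^sup>2) + \<nu>\<^sup>2 / t\<^sup>2 * \<alpha> t = 0" if t: "t > 0" for t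
      proof -
        define Q where "Q = t powr (r - 1)"
        have "t powr r = t * Q" "t powr (1 + r) = t\<^sup>2 * Q" using t by (auto simp: Q_def powr_diff powr_add power2_eq_square)
        then have "\<alpha>2 t - \<mu> * (\<alpha>1 t / t - \<alpha> t / t\<^sup>2) + \<nu>\<^sup>2 / t\<^sup>2 * \<alpha> t = ((1 + r) * r - \<mu> * r + \<nu>\<^sup>2) * Q"
          unfolding \<alpha>_def \<alpha>1_def \<alpha>2_def Q_def[symmetric] using t by (simp add: field_simps)
        then show ?thesis by (simp only: char mult_zero_left)
      qed
      moreover have "2 powr (- \<bar>1 + r\<bar>) * \<tau> powr (1 + r) \<le> \<alpha> s \<and> \<bar>\<alpha> s\<bar> \<le> (1 + \<bar>1 + r\<bar>) * K * \<tau> powr (1 + r) \<and> \<bar>\<alpha>1 s\<bar> \<le> (1 + \<bar>1 + r\<bar>) * K * \<tau> powr r"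
        if s: "s \<in> {\<tau>/2..\<tau>}" for s
      proof (intro conjI)
        show "2 powr (- \<bar>1 + r\<bar>) * \<tau> powr (1 + r) \<le> \<alpha> s" unfolding \<alpha>_def by (rule bnd(3)[OF s \<tau>])
        have "1 * (K * \<tau> powr (1 + r)) \<le> (1 + \<bar>1 + r\<bar>) * (K * \<tau> powr (1 + r))" using K by (intro mult_right_mono) auto
        then show "\<bar>\<alpha> s\<bar> \<le> (1 + \<bar>1 + r\<bar>) * K * \<tau> powr (1 + r)" using bnd(1)[OF s \<tau>] by (simp add: \<alpha>_def mult.assoc)
        have "\<bar>\<alpha>1 s\<bar> = \<bar>1 + r\<bar> * s powr r" by (simp add: \<alpha>1_def abs_mult)
        also have "\<dots> \<le> (1 + \<bar>1 + r\<bar>) * (K * \<tau> powr r)" using bnd(2)[OF s \<tau>] by (intro mult_mono) auto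
        finally show "\<bar>\<alpha>1 s\<bar> \<le> (1 + \<bar>1 + r\<bar>) * K * \<tau> powr r" by (simp only: mult.assoc)
      qed
      moreover have "sqrt \<delta> * I0 \<le> \<alpha> 1 * I1 + (\<mu> * \<alpha> 1 - \<alpha>1 1) * I0" if "0 \<le> I1 + r * I0" for I0 I1
      proof -
        have "\<alpha> 1 * I1 + (\<mu> * \<alpha> 1 - \<alpha>1 1) * I0 = (I1 + r * I0) + sqrt \<delta> * I0 + (\<mu> - 1 - sqrt \<delta> - 2 * r) * I0"
          by (simp add: \<alpha>_def \<alpha>1_def algebra_simps)
        then show ?thesis using that rd by simp
      qed
      moreover have "smooth_on \<alpha> {0<..}" unfolding \<alpha>_def[abs_def] by (rule smooth_on_powr)
      moreover have "0 \<le> \<alpha> t" for t by (simp add: \<alpha>_def)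
      ultimately show "\<exists>\<alpha> \<alpha>1 \<alpha>2. power_weight \<mu> \<nu> r (2 powr (- \<bar>1 + r\<bar>)) ((1 + \<bar>1 + r\<bar>) * K) (sqrt \<delta>) \<tau> \<alpha> \<alpha>1 \<alpha>2"
        unfolding power_weight_def by blast
    qed simp
  next
    case False
    then have d0: "\<delta> = 0" using \<delta>(2) by simp
    have rd: "2 * r = \<mu> - 1" using rd d0 by simp
    show ?thesis
    proof (rule that[of "2 powr (- \<bar>1 + r\<bar>) * ln 2" "(2 * (1 + \<bar>1 + r\<bar>) + 1) * K" 1])
      show "0 < (2 * (1 + \<bar>1 + r\<bar>) + 1) * K" using K(1) by (intro mult_pos_pos add_nonneg_pos) auto
      fix \<tau> :: real assume \<tau>: "\<tau> \<ge> 2"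
      \<comment> \<open>The sign of the logarithm makes its contribution to the data equal to +I0.
        The factor 2 keeps \<open>g\<close> at least ln 2 up to t = \<tau>, and on
        [\<tau>/2, \<tau>] it is at most 2 ln 2, so no logarithm of \<tau> enters the bounds
        there.\<close>
      define g where "g t = ln (2 * \<tau>) - ln t" for t
      define \<alpha> where "\<alpha> t = t powr (1 + r) * g t" for t :: real
      define \<alpha>1 where "\<alpha>1 t = t powr r * ((1 + r) * g t - 1)" for t :: real
      define \<alpha>2 where "\<alpha>2 t = t powr (r - 1) * (r * ((1 + r) * g t - 1) - (1 + r))" for t :: real
      have dg: "(g has_real_derivative - (1 / t)) (at t)" if "t > 0" for t
        unfolding g_def[abs_def] using that by (auto intro!: derivative_eq_intros simp: divide_inverse)
      have d1: "(\<alpha> has_real_derivative \<alpha>1 t) (at t)" if t: "t > 0" for t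
      proof -
        have "(\<alpha> has_real_derivative (1 + r) * t powr (1 + r - 1) * g t + - (1 / t) * t powr (1 + r)) (at t)"
          unfolding \<alpha>_def[abs_def] by (rule DERIV_mult[OF pd[OF t] dg[OF t]])
        moreover have "t powr (1 + r) = t * t powr r" using t by (simp add: powr_add)
        ultimately show ?thesis using t by (simp add: \<alpha>1_def algebra_simps)
      qed
      have d2: "(\<alpha>1 has_real_derivative \<alpha>2 t) (at t)" if t: "t > 0" for t
      proof -
        have "((\<lambda>t. (1 + r) * g t - 1) has_real_derivative (1 + r) * - (1 / t) - 0) (at t)"
          by (intro DERIV_diff DERIV_cmult dg t DERIV_const)
        from DERIV_mult[OF pd[OF t, of r] this]
        have "(\<alpha>1 has_real_derivative r * t powr (r - 1) * ((1 + r) * g t - 1) + ((1 + r) * - (1 / t) - 0) * t powr r) (at t)"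
          unfolding \<alpha>1_def[abs_def] .
        moreover have "t powr r = t * t powr (r - 1)" using t by (simp add: powr_diff)
        then have "r * t powr (r - 1) * ((1 + r) * g t - 1) + ((1 + r) * - (1 / t) - 0) * t powr r = \<alpha>2 t"
          using t by (simp add: \<alpha>2_def field_simps)
        ultimately show ?thesis by simp
      qed
      have ode: "\<alpha>2 t - \<mu> * (\<alpha>1 t / t - \<alpha> t / t\<^sup>2) + \<nu>\<^sup>2 / t\<^sup>2 * \<alpha> t = 0" if t: "t > 0" for t
      proof -
        define Q where "Q = t powr (r - 1)"
        have "t powr r = t * Q" "t powr (1 + r) = t\<^sup>2 * Q" using t by (auto simp: Q_def powr_diff powr_add power2_eq_square)
        then have "\<alpha>2 t - \<mu> * (\<alpha>1 t / t - \<alpha> t / t\<^sup>2) + \<nu>\<^sup>2 / t\<^sup>2 * \<alpha> t = ((1 + r) * r - \<mu> * r + \<nu>\<^sup>2) * Q * g t - (2 * r - (\<mu> - 1)) * Q"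
          unfolding \<alpha>_def \<alpha>1_def \<alpha>2_def Q_def[symmetric] using t by (simp add: field_simps)
        then show ?thesis by (simp add: char rd)
      qed
      have gpos: "ln 2 \<le> g t" if "t > 0" "t \<le> \<tau>" for t
        using that \<tau> by (simp add: g_def ln_mult)
      have gup: "g s \<le> 2" "ln 2 \<le> g s" if s: "s \<in> {\<tau>/2..\<tau>}" for s
      proof -
        have "ln (\<tau> / 2) \<le> ln s" using s \<tau> by auto
        then have "g s \<le> 2 * ln 2" using \<tau> by (simp add: g_def ln_mult ln_div)
        moreover have "ln 2 \<le> (1::real)" using ln_le_minus_one[of 2] by simp
        ultimately show "g s \<le> 2" by linarith
        show "ln 2 \<le> g s" using s \<tau> by (intro gpos) auto
      qed
      have l2: "(0::real) \<le> ln 2" by simp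
      have est: "2 powr (- \<bar>1 + r\<bar>) * ln 2 * \<tau> powr (1 + r) \<le> \<alpha> s \<and> \<bar>\<alpha> s\<bar> \<le> (2 * (1 + \<bar>1 + r\<bar>) + 1) * K * \<tau> powr (1 + r) \<and> \<bar>\<alpha>1 s\<bar> \<le> (2 * (1 + \<bar>1 + r\<bar>) + 1) * K * \<tau> powr r"
        if s: "s \<in> {\<tau>/2..\<tau>}" for s
      proof (intro conjI)
        have "(2 powr (- \<bar>1 + r\<bar>) * \<tau> powr (1 + r)) * ln 2 \<le> s powr (1 + r) * g s"
          using bnd(3)[OF s \<tau>] gup[OF s] by (intro mult_mono) auto
        then show "2 powr (- \<bar>1 + r\<bar>) * ln 2 * \<tau> powr (1 + r) \<le> \<alpha> s" unfolding \<alpha>_def by (simp add: mult_ac)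
        have g0: "0 \<le> g s" using gup(2)[OF s] l2 by linarith
        have "\<bar>\<alpha> s\<bar> = g s * s powr (1 + r)" using g0 by (simp add: \<alpha>_def)
        also have "\<dots> \<le> (2 * (1 + \<bar>1 + r\<bar>) + 1) * (K * \<tau> powr (1 + r))"
        proof (intro mult_mono bnd(1)[OF s \<tau>])
          have "(2::real) \<le> 2 * (1 + \<bar>1 + r\<bar>) + 1" by simp
          then show "g s \<le> 2 * (1 + \<bar>1 + r\<bar>) + 1" by (rule order_trans[OF gup(1)[OF s]])
        qed auto
        finally show "\<bar>\<alpha> s\<bar> \<le> (2 * (1 + \<bar>1 + r\<bar>) + 1) * K * \<tau> powr (1 + r)" by (simp only: mult.assoc)
        have "\<bar>(1 + r) * g s - 1\<bar> \<le> \<bar>1 + r\<bar> * g s + 1"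
          using g0 abs_triangle_ineq4[of "(1 + r) * g s" 1] by (simp add: abs_mult)
        also have "\<dots> \<le> \<bar>1 + r\<bar> * 2 + 1" using gup(1)[OF s] by (intro add_right_mono mult_left_mono) auto
        also have "\<dots> \<le> 2 * (1 + \<bar>1 + r\<bar>) + 1" by simp
        finally have "\<bar>(1 + r) * g s - 1\<bar> * s powr r \<le> (2 * (1 + \<bar>1 + r\<bar>) + 1) * (K * \<tau> powr r)"
          using bnd(2)[OF s \<tau>] by (intro mult_mono) auto
        then show "\<bar>\<alpha>1 s\<bar> \<le> (2 * (1 + \<bar>1 + r\<bar>) + 1) * K * \<tau> powr r" by (simp add: \<alpha>1_def abs_mult mult_ac)
      qed
      have data: "1 * I0 \<le> \<alpha> 1 * I1 + (\<mu> * \<alpha> 1 - \<alpha>1 1) * I0" if "0 \<le> I1 + r * I0" for I0 I1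
      proof -
        have "\<alpha> 1 * I1 + (\<mu> * \<alpha> 1 - \<alpha>1 1) * I0 = ln (2 * \<tau>) * (I1 + r * I0) + I0 + (\<mu> - 1 - 2 * r) * ln (2 * \<tau>) * I0"
          by (simp add: \<alpha>_def \<alpha>1_def g_def algebra_simps)
        moreover have "0 \<le> ln (2 * \<tau>) * (I1 + r * I0)" using that \<tau> by simp
        ultimately show ?thesis using rd by simp
      qed
      have sm: "smooth_on \<alpha> {0<..}" unfolding \<alpha>_def[abs_def] g_def
        by (intro smooth_on_mult smooth_on_powr smooth_on_diff smooth_on_const smooth_on_ln) auto
      have nn: "0 \<le> \<alpha> t" if "t \<in> {1..\<tau>}" for t
      proof -
        have "0 \<le> g t" using order_trans[OF l2 gpos[of t]] that by simp
        then show ?thesis by (simp add: \<alpha>_def)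
      qed
      show "\<exists>\<alpha> \<alpha>1 \<alpha>2. power_weight \<mu> \<nu> r ((2 powr (- \<bar>1 + r\<bar>) * ln 2)) ((2 * (1 + \<bar>1 + r\<bar>) + 1) * K) (1) \<tau> \<alpha> \<alpha>1 \<alpha>2"
        unfolding power_weight_def using sm d1 d2 ode nn est data by blast
    qed simp_all
  qed
qed

lemma integral_positive_data:
  fixes v \<Phi> :: "real ^ 'n \<Rightarrow> real"
  assumes v: "L1_loc v" "ess_support v \<subseteq> ball 0 R" and R: "R > 0" and \<Phi>: "smooth_on \<Phi> UNIV" "\<And>x. \<Phi> x > 0"
  shows "integrable lebesgue (\<lambda>x. v x * \<Phi> x)"
    "AE x in lebesgue. v x \<ge> 0 \<Longrightarrow> \<not> (AE x in lebesgue. v x = 0) \<Longrightarrow> (LINT x|lebesgue. v x * \<Phi> x) > 0"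
proof -
  obtain b where b: "test_function b" "\<And>x. x \<in> ball 0 R \<Longrightarrow> b x = \<Phi> x" "\<And>x. 0 \<le> b x"
    "\<And>x. x \<in> ball 0 R \<Longrightarrow> laplacian b x = laplacian \<Phi> x"
    using localized_test_function[OF \<Phi>(1) less_imp_le[OF \<Phi>(2)] R] by blast
  show i: "integrable lebesgue (\<lambda>x. v x * \<Phi> x)"
    by (rule integral_cong_support(1)[OF AE_zero_outside_ess_support[OF v(2)] b(2) integrable_L1_loc_times_test[OF v(1) b(1)]])
  assume nn: "AE x in lebesgue. v x \<ge> 0" and nz: "\<not> (AE x in lebesgue. v x = 0)"
  have nn': "AE x in lebesgue. 0 \<le> v x * \<Phi> x" using nn by eventually_elim (use \<Phi>(2) in \<open>simp add: less_imp_le\<close>)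
  have "(LINT x|lebesgue. v x * \<Phi> x) \<noteq> 0"
  proof
    assume "(LINT x|lebesgue. v x * \<Phi> x) = 0"
    then have "AE x in lebesgue. v x * \<Phi> x = 0" using integral_nonneg_eq_0_iff_AE[OF i nn'] by simp
    then have "AE x in lebesgue. v x = 0" by eventually_elim (use \<Phi>(2) less_irrefl in \<open>metis mult_eq_0_iff\<close>)
    then show False using nz by simp
  qed
  moreover have "(LINT x|lebesgue. v x * \<Phi> x) \<ge> 0" by (rule integral_nonneg_AE[OF nn'])
  ultimately show "(LINT x|lebesgue. v x * \<Phi> x) > 0" by simp
qed

lemma powr_mult_mono:
  fixes x y v w q :: real
  assumes "0 \<le> x" "x \<le> y" "0 \<le> q" "0 \<le> v" "v \<le> w"
  shows "x powr q * v \<le> y powr q * w"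
  by (rule mult_mono[OF powr_mono2[OF assms(3,1,2)] assms(5) powr_ge_zero assms(4)])

section \<open>The two decay estimates\<close>

text \<open>One inequality gives both conclusions: after absorption its left side is the sum of the
  data term and a multiple of the weighted integral, both nonnegative, and each is bounded by
  dropping the other. The power of \<tau> adds up from 1 for the length of the interval, (1 + r)(1 -
  q) from Young's weight, (r - 1) q from the cutoff error and (l + 1) n from the volume of the
  ball.\<close>

lemma fujita_estimate:
  fixes l \<mu> \<nu> \<delta> p q R Cg :: real and u0 u1 :: "real ^ 'n \<Rightarrow> real" and k :: nat
  assumes l: "l > -1" and \<mu>: "\<mu> \<ge> 0" and \<delta>: "\<delta> = (\<mu> - 1)\<^sup>2 - 4 * \<nu>\<^sup>2" "\<delta> \<ge> 0"
    and p: "p > 1" "q = p / (p - 1)" and R: "R > 0" and k: "real k \<ge> 2 * q"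
    and u0: "L1_loc u0" "ess_support u0 \<subseteq> ball 0 R" and u1: "L1_loc u1" "ess_support u1 \<subseteq> ball 0 R"
    and u0nn: "AE x in lebesgue. u0 x \<ge> 0" "\<not> (AE x in lebesgue. u0 x = 0)"
    and data: "AE x in lebesgue. u1 x + (\<mu> - 1 - sqrt \<delta>) / 2 * u0 x \<ge> 0"
    and cut: "is_cutoff k h g1 g2 Cg"
  obtains C where "C > 0" "\<And>\<epsilon> T u \<tau>. \<lbrakk>weak_solution l \<mu> \<nu> p R u0 u1 \<epsilon> T u; 0 < \<epsilon>; 2 \<le> \<tau>; ereal \<tau> < T\<rbrakk> \<Longrightarrow>
      \<epsilon> \<le> C * \<tau> powr (2 + (\<mu> - 1 - sqrt \<delta>) / 2 - 2 * q + (l + 1) * real CARD('n)) \<and>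
      (LINT s:{\<tau>/2..\<tau>}|lebesgue. h (s / \<tau>) ^ k * (LINT x|lebesgue. \<bar>u s x\<bar> powr p))
        \<le> C * \<tau> powr (1 - 2 * q + (l + 1) * real CARD('n))"
proof -
  note h = is_cutoffD(1-5)[OF cut] and g = is_cutoffD(6-12)[OF cut]
  define r where "r = (\<mu> - 1 - sqrt \<delta>) / 2"
  define N where "N = (l + 1) * real CARD('n)"
  have q: "q > 1" by (rule conjugate_exponent[OF p])
  obtain c M d0 where c: "c > 0" "M > 0" "d0 > 0" and weight:
    "\<And>\<tau>. \<tau> \<ge> 2 \<Longrightarrow> \<exists>\<alpha> \<alpha>1 \<alpha>2. power_weight \<mu> \<nu> r c M d0 \<tau> \<alpha> \<alpha>1 \<alpha>2"
    using power_weight_exists[OF \<delta>, folded r_def] by blast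
  define I0 where "I0 = (LINT x|lebesgue. u0 x * 1)"
  define I1 where "I1 = (LINT x|lebesgue. u1 x * 1)"
  have one: "smooth_on (\<lambda>x :: real ^ 'n. 1 :: real) UNIV" by (rule smooth_on_const) simp
  have I0: "I0 > 0" unfolding I0_def
    by (rule integral_positive_data(2)[OF u0 R one _ u0nn]) simp
  have I1: "0 \<le> I1 + r * I0"
  proof -
    have i: "integrable lebesgue (\<lambda>x. u0 x * 1)" "integrable lebesgue (\<lambda>x. u1 x * 1)"
      using integral_positive_data(1)[OF u0 R one] integral_positive_data(1)[OF u1 R one] by simp_all
    have "I1 + r * I0 = (LINT x|lebesgue. u1 x * 1 + r * (u0 x * 1))" unfolding I0_def I1_def using i by simp
    also have "\<dots> \<ge> 0" by (rule integral_nonneg_AE) (use data in \<open>auto simp: r_def\<close>)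
    finally show ?thesis .
  qed
  \<comment> \<open>Volume of a ball of radius R + 1 / (l + 1); multiplied by \<tau>^((l + 1) n) it
    dominates the volumes of all balls up to time \<tau>.\<close>
  define W where "W = unit_ball_vol (real CARD('n)) * (R + 1 / (l + 1)) ^ CARD('n)"
  have W0: "W \<ge> 0" using R l by (simp add: W_def)
  define K where "K = Cg * ((3 + 2 * \<mu>) * M)"
  have K: "K > 0" using g(7) \<mu> c by (simp add: K_def add_pos_nonneg)
  define K' where "K' = (c / 2) powr (1 - q) * (K powr q * W)"
  have K': "K' \<ge> 0" using W0 by (simp add: K'_def)
  define C where "C = K' / (d0 * I0) + 2 * K' / c + 1"
  have C: "C > 0" "K' / (d0 * I0) \<le> C" "2 * K' / c \<le> C" using K' c I0 by (auto simp: C_def intro!: add_nonneg_pos)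
  have main: "\<epsilon> \<le> C * \<tau> powr (2 + r - 2 * q + N) \<and>
      (LINT s:{\<tau>/2..\<tau>}|lebesgue. h (s / \<tau>) ^ k * (LINT x|lebesgue. \<bar>u s x\<bar> powr p)) \<le> C * \<tau> powr (1 - 2 * q + N)"
    if sol: "weak_solution l \<mu> \<nu> p R u0 u1 \<epsilon> T u" and \<epsilon>: "0 < \<epsilon>" and \<tau>: "2 \<le> \<tau>" "ereal \<tau> < T" for \<epsilon> T u \<tau>
  proof -
    define Ah where "Ah = (LINT s:{\<tau>/2..\<tau>}|lebesgue. h (s / \<tau>) ^ k * (LINT x|lebesgue. \<bar>u s x\<bar> powr p))"
    have Ah0: "Ah \<ge> 0" unfolding Ah_def set_lebesgue_integral_def
      by (intro integral_nonneg_AE AE_I2) (auto simp: h(4))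
    have t0: "\<tau> > 0" using \<tau> by simp
    obtain \<alpha> \<alpha>1 \<alpha>2 where a: "smooth_on \<alpha> {0<..}" "\<forall>t>0. (\<alpha> has_real_derivative \<alpha>1 t) (at t)"
      "\<forall>t>0. (\<alpha>1 has_real_derivative \<alpha>2 t) (at t)"
      "\<forall>t>0. \<alpha>2 t - \<mu> * (\<alpha>1 t / t - \<alpha> t / t\<^sup>2) + \<nu>\<^sup>2 / t\<^sup>2 * \<alpha> t = 0"
      "\<forall>t\<in>{1..\<tau>}. 0 \<le> \<alpha> t"
      "\<forall>s\<in>{\<tau>/2..\<tau>}. c * \<tau> powr (1 + r) \<le> \<alpha> s \<and> \<bar>\<alpha> s\<bar> \<le> M * \<tau> powr (1 + r) \<and> \<bar>\<alpha>1 s\<bar> \<le> M * \<tau> powr r"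
      "\<forall>I0 I1. 0 \<le> I0 \<longrightarrow> 0 \<le> I1 + r * I0 \<longrightarrow> d0 * I0 \<le> \<alpha> 1 * I1 + (\<mu> * \<alpha> 1 - \<alpha>1 1) * I0"
      using weight[OF \<tau>(1)] unfolding power_weight_def by blast
    define Q where "Q = \<tau> powr (r - 1)"
    have Q: "\<tau> powr r = \<tau> * Q" "\<tau> powr (1 + r) = \<tau>\<^sup>2 * Q" "Q > 0"
      using t0 by (auto simp: Q_def powr_diff powr_add power2_eq_square)
    have D: "cutoff_error Cg \<mu> \<tau> \<alpha> \<alpha>1 s \<le> K * Q" if s: "s \<in> {\<tau>/2..\<tau>}" for s
    proof -
      have "\<bar>\<alpha> s\<bar> \<le> \<tau>\<^sup>2 * (M * Q)" "\<bar>\<alpha>1 s\<bar> \<le> \<tau> * (M * Q)" using a(6) s Q by (auto simp: mult_ac)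
      from cutoff_error_le[where C = Cg and \<alpha> = \<alpha> and ?\<alpha>1.0 = \<alpha>1, OF g(7) \<mu> t0 s this] show ?thesis by (simp add: K_def mult.assoc)
    qed
    have V: "(LINT x:ball (0 :: real ^ 'n) (R + phi_speed l s - phi_speed l 1)|lebesgue. (1::real) powr q) \<le> W * \<tau> powr N"
      if s: "s \<in> {\<tau>/2..\<tau>}" for s
    proof -
      have s1: "s \<ge> 1" using s \<tau> by simp
      define \<rho> where "\<rho> = R + phi_speed l s - phi_speed l 1"
      have \<rho>: "0 \<le> \<rho>" "\<rho> \<le> (R + 1 / (l + 1)) * \<tau> powr (l + 1)"
      proof -
        show "0 \<le> \<rho>" unfolding \<rho>_def by (rule cone_radius_bounds(1)[OF l R s1])
        have "\<rho> \<le> (R + 1 / (l + 1)) * s powr (l + 1)" unfolding \<rho>_def by (rule cone_radius_bounds(2)[OF l R s1])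
        also have "\<dots> \<le> (R + 1 / (l + 1)) * \<tau> powr (l + 1)" using s s1 l R by (intro mult_left_mono powr_mono2) auto
        finally show "\<rho> \<le> (R + 1 / (l + 1)) * \<tau> powr (l + 1)" .
      qed
      have "(LINT x:ball (0 :: real ^ 'n) \<rho>|lebesgue. (1::real) powr q) = measure lebesgue (ball (0 :: real ^ 'n) \<rho>)"
        by (simp add: set_lebesgue_integral_def)
      also have "\<dots> = unit_ball_vol (real CARD('n)) * \<rho> ^ CARD('n)" by (rule measure_ball_lebesgue[OF \<rho>(1)])
      also have "\<dots> \<le> unit_ball_vol (real CARD('n)) * ((R + 1 / (l + 1)) * \<tau> powr (l + 1)) ^ CARD('n)"
        using \<rho> by (intro mult_left_mono power_mono) auto
      also have "\<dots> = W * \<tau> powr N"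
        using t0 by (simp add: W_def N_def power_mult_distrib powr_powr flip: powr_realpow)
      finally show ?thesis by (simp only: \<rho>_def)
    qed
    define Mx where "Mx = (K * Q) powr q * (W * \<tau> powr N)"
    have Mx: "(cutoff_error Cg \<mu> \<tau> \<alpha> \<alpha>1 s) powr q
      * (LINT x:ball (0 :: real ^ 'n) (R + phi_speed l s - phi_speed l 1)|lebesgue. (1::real) powr q) \<le> Mx" if s: "s \<in> {\<tau>/2..\<tau>}" for s
    proof -
      have "0 \<le> cutoff_error Cg \<mu> \<tau> \<alpha> \<alpha>1 s"
        using g(7) t0 s \<mu> by (intro cutoff_error_nonneg) auto
      moreover have "0 \<le> (LINT x:ball (0 :: real ^ 'n) (R + phi_speed l s - phi_speed l 1)|lebesgue. (1::real) powr q)"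
        by (simp add: set_lebesgue_integral_def)
      ultimately show ?thesis unfolding Mx_def using D[OF s] V[OF s] q by (intro powr_mult_mono) linarith+
    qed
    \<comment> \<open>Half of the lower bound for the weight: one half of the nonlinear term absorbs
      the integral on the right, the other half stays on the left.\<close>
    define x0 where "x0 = c * \<tau> powr (1 + r) / 2"
    have x0: "x0 > 0" using c t0 by (simp add: x0_def)
    have lap1: "laplacian (\<lambda>x. 1) x = 0 * (1::real)" for x :: "real ^ 'n" by (simp add: laplacian_const)
    have main: "\<epsilon> * (\<alpha> 1 * I1 + (\<mu> * \<alpha> 1 - \<alpha>1 1) * I0) + (c * \<tau> powr (1 + r)) * Ah \<le> x0 * Ah + \<tau> * (x0 powr (1 - q) * Mx)"
      unfolding I0_def I1_def Ah_def
      by (rule weak_solution_adjoint_test(2)[where \<kappa> = 0 and \<Phi> = "\<lambda>x. 1" and h = h and ?\<alpha>1.0 = \<alpha>1 and ?\<alpha>2.0 = \<alpha>2 and ?g1.0 = g1 and ?g2.0 = g2 and Cg = Cg and \<nu> = \<nu> and T = T,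
          OF sol l R \<mu> p k u0 u1 \<tau> cut one _ lap1 a(1)])
        (use a Mx x0 c in auto)
    have "d0 * I0 \<le> \<alpha> 1 * I1 + (\<mu> * \<alpha> 1 - \<alpha>1 1) * I0" using a(7) I0 I1 by simp
    then have low: "\<epsilon> * (d0 * I0) \<le> \<epsilon> * (\<alpha> 1 * I1 + (\<mu> * \<alpha> 1 - \<alpha>1 1) * I0)" using \<epsilon> by (intro mult_left_mono) auto
    have split: "(c * \<tau> powr (1 + r)) * Ah = x0 * Ah + x0 * Ah" by (simp add: x0_def)
    have cancel: "y + x \<le> z" if "y + (x + x) \<le> x + z" for x y z :: real using that by simp
    have "\<epsilon> * (d0 * I0) + (x0 * Ah + x0 * Ah) \<le> x0 * Ah + \<tau> * (x0 powr (1 - q) * Mx)"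
      using order_trans[OF add_right_mono[OF low] main] unfolding split .
    then have key: "\<epsilon> * (d0 * I0) + x0 * Ah \<le> \<tau> * (x0 powr (1 - q) * Mx)" by (rule cancel)
    have rhs: "\<tau> * (x0 powr (1 - q) * Mx) = K' * \<tau> powr (2 + r - 2 * q + N)"
    proof -
      have "x0 powr (1 - q) = (c / 2) powr (1 - q) * \<tau> powr ((1 + r) * (1 - q))"
      proof -
        have "x0 = (c / 2) * \<tau> powr (1 + r)" by (simp add: x0_def)
        then show ?thesis by (simp only: powr_mult powr_powr)
      qed
      moreover have "(K * Q) powr q = K powr q * \<tau> powr ((r - 1) * q)" using K by (simp add: Q_def powr_mult powr_powr)
      ultimately have "\<tau> * (x0 powr (1 - q) * Mx) = K' * (\<tau> powr 1 * \<tau> powr ((1 + r) * (1 - q)) * \<tau> powr ((r - 1) * q) * \<tau> powr N)"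
        using t0 by (simp add: Mx_def K'_def mult_ac)
      also have "\<tau> powr 1 * \<tau> powr ((1 + r) * (1 - q)) * \<tau> powr ((r - 1) * q) * \<tau> powr N = \<tau> powr (1 + (1 + r) * (1 - q) + (r - 1) * q + N)"
        by (simp only: powr_add)
      also have "1 + (1 + r) * (1 - q) + (r - 1) * q + N = 2 + r - 2 * q + N" by (simp add: algebra_simps)
      finally show ?thesis .
    qed
    have "\<epsilon> * (d0 * I0) \<le> K' * \<tau> powr (2 + r - 2 * q + N)"
      using key x0 Ah0 unfolding rhs by (smt (verit) mult_nonneg_nonneg)
    then have "\<epsilon> \<le> K' / (d0 * I0) * \<tau> powr (2 + r - 2 * q + N)" using c I0 by (simp add: field_simps)
    also have "\<dots> \<le> C * \<tau> powr (2 + r - 2 * q + N)" using C by (intro mult_right_mono) auto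
    finally have r1: "\<epsilon> \<le> C * \<tau> powr (2 + r - 2 * q + N)" .
    have "0 \<le> \<epsilon> * (d0 * I0)" using \<epsilon> c I0 by simp
    then have "x0 * Ah \<le> K' * \<tau> powr (2 + r - 2 * q + N)" using key unfolding rhs by linarith
    \<comment> \<open>Division by \<open>x0\<close> removes the power 1 + r, so the bound on the
      integral no longer depends on the root r.\<close>
    also have "2 + r - 2 * q + N = (1 + r) + (1 - 2 * q + N)" by simp
    also have "K' * \<tau> powr ((1 + r) + (1 - 2 * q + N)) = x0 * (2 * K' / c * \<tau> powr (1 - 2 * q + N))"
      unfolding x0_def powr_add[of \<tau> "1 + r" "1 - 2 * q + N"] using c by simp
    finally have "Ah \<le> 2 * K' / c * \<tau> powr (1 - 2 * q + N)" by (rule mult_left_le_imp_le[OF _ x0])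
    also have "\<dots> \<le> C * \<tau> powr (1 - 2 * q + N)" using C by (intro mult_right_mono) auto
    finally show ?thesis using r1 by (simp add: Ah_def)
  qed
  show ?thesis by (rule that[OF C(1)]) (use main in \<open>simp add: r_def N_def\<close>)
qed

text \<open>The cutoff error is of order \<tau>^(e + l - 1) exp(- \<open>phi_speed l s\<close>), and
  the integral of \<Phi>^q over the ball of order \<tau>^((l + 1) m) exp(q
  \<open>phi_speed l s\<close>). The exponentials cancel in the product with the \<open>q\<close>-th
  power of the error, leaving \<tau>^m2. The assumed bound on the weighted integral of |u|^p closes
  the estimate; it is stated with a free constant \<open>CA\<close> so that the preceding estimate
  can supply it.\<close>

lemma strauss_estimate:
  fixes l \<mu> \<nu> \<delta> p q R Cg CA :: real and u0 u1 :: "real ^ 'n \<Rightarrow> real" and k :: nat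
  assumes l: "l > -1" and \<mu>: "\<mu> \<ge> 0" and \<delta>: "\<delta> = (\<mu> - 1)\<^sup>2 - 4 * \<nu>\<^sup>2" "\<delta> \<ge> 0"
    and p: "p > 1" "q = p / (p - 1)" and R: "R > 0" and k: "real k \<ge> 2 * q"
    and u0: "L1_loc u0" "ess_support u0 \<subseteq> ball 0 R" and u1: "L1_loc u1" "ess_support u1 \<subseteq> ball 0 R"
    and u0nn: "AE x in lebesgue. u0 x \<ge> 0" "\<not> (AE x in lebesgue. u0 x = 0)"
    and data: "AE x in lebesgue. u1 x + (\<mu> - 1 - sqrt \<delta>) / 2 * u0 x \<ge> 0"
    and cut: "is_cutoff k h g1 g2 Cg"
    and CA: "CA > 0"
  obtains C where "C > 0" "\<And>\<epsilon> T u \<tau>. \<lbrakk>weak_solution l \<mu> \<nu> p R u0 u1 \<epsilon> T u; 0 < \<epsilon>; 2 \<le> \<tau>; ereal \<tau> < T;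
      (LINT s:{\<tau>/2..\<tau>}|lebesgue. h (s / \<tau>) ^ k * (LINT x|lebesgue. \<bar>u s x\<bar> powr p))
        \<le> CA * \<tau> powr (1 - 2 * q + (l + 1) * real CARD('n))\<rbrakk> \<Longrightarrow>
      \<epsilon> \<le> C * \<tau> powr (- (theta CARD('n) l \<mu> p / (p * (p - 1))))"
proof -
  note h = is_cutoffD(1-5)[OF cut] and g = is_cutoffD(6-12)[OF cut]
  define n where "n = real CARD('n)"
  define e where "e = (\<mu> - l) / 2"
  define b where "b = (n - 1) / 2"
  define r1 where "r1 = (\<mu> - 1 - sqrt \<delta>) / 2"
  have q: "q > 1" by (rule conjugate_exponent[OF p])
  have n: "n \<ge> 1" by (simp add: n_def Suc_leI)
  have b0: "b \<ge> 0" using n by (simp add: b_def)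
  obtain \<alpha> \<alpha>1 \<alpha>2 Cl where a: "smooth_on \<alpha> {0<..}"
    "\<And>t. t > 0 \<Longrightarrow> (\<alpha> has_real_derivative \<alpha>1 t) (at t)"
    "\<And>t. t > 0 \<Longrightarrow> (\<alpha>1 has_real_derivative \<alpha>2 t) (at t)"
    "\<And>t. t > 0 \<Longrightarrow> \<alpha>2 t - \<mu> * (\<alpha>1 t / t - \<alpha> t / t\<^sup>2) + \<nu>\<^sup>2 / t\<^sup>2 * \<alpha> t - t powr (2 * l) * \<alpha> t = 0"
    "\<And>t. t > 0 \<Longrightarrow> \<alpha> t > 0" "(1 + (\<mu> - 1 + sqrt \<delta>) / 2) * \<alpha> 1 - \<alpha>1 1 > 0" "Cl > 0"
    "\<And>t. t \<ge> 1 \<Longrightarrow> \<alpha> t \<le> Cl * t powr ((\<mu> - l) / 2) * exp (- phi_speed l t)"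
    "\<And>t. t \<ge> 1 \<Longrightarrow> \<bar>\<alpha>1 t\<bar> \<le> Cl * t powr ((\<mu> - l) / 2 + l) * exp (- phi_speed l t)"
    using adjoint_time_solution[OF l \<delta>] by blast
  define \<Phi> where "\<Phi> = (radial_eigenfunction :: real ^ 'n \<Rightarrow> real)"
  have \<Phi>: "smooth_on \<Phi> UNIV" "\<And>x. \<Phi> x > 0" "\<And>x. laplacian \<Phi> x = 1 * \<Phi> x"
    unfolding \<Phi>_def using smooth_on_radial_eigenfunction radial_eigenfunction_ge_1 laplacian_radial_eigenfunction
    by (auto intro: less_le_trans[OF zero_less_one])
  obtain CP where CP: "CP > 0" "\<And>x. \<Phi> x \<le> CP * (1 + norm x) powr (- b) * exp (norm x)"
    using radial_eigenfunction_bound[where 'n = 'n] unfolding \<Phi>_def b_def n_def by blast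
  have bq: "b * q \<ge> 0" "q > 0" using b0 q by auto
  obtain CI where CI: "CI > 0" "\<And>r. r \<ge> 0 \<Longrightarrow>
    (LINT x:ball (0 :: real ^ 'n) r|lebesgue. (1 + norm x) powr (- (b * q)) * exp (q * norm x))
      \<le> CI * (1 + r) powr (n - 1 - b * q) * exp (q * r)"
    using integral_exp_weight_ball[where 'n = 'n, OF bq] unfolding n_def by blast
  define I0 where "I0 = (LINT x|lebesgue. u0 x * \<Phi> x)"
  define I1 where "I1 = (LINT x|lebesgue. u1 x * \<Phi> x)"
  have I0: "I0 > 0" unfolding I0_def by (rule integral_positive_data(2)[OF u0 R \<Phi>(1,2) u0nn])
  have I1: "0 \<le> I1 + r1 * I0"
  proof -
    have i: "integrable lebesgue (\<lambda>x. u0 x * \<Phi> x)" "integrable lebesgue (\<lambda>x. u1 x * \<Phi> x)"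
      by (rule integral_positive_data(1)[OF u0 R \<Phi>(1,2)], rule integral_positive_data(1)[OF u1 R \<Phi>(1,2)])
    have "I1 + r1 * I0 = (LINT x|lebesgue. u1 x * \<Phi> x + r1 * (u0 x * \<Phi> x))" unfolding I0_def I1_def using i by simp
    also have "\<dots> = (LINT x|lebesgue. (u1 x + r1 * u0 x) * \<Phi> x)" by (simp add: algebra_simps)
    also have "\<dots> \<ge> 0"
    proof (rule integral_nonneg_AE)
      show "AE x in lebesgue. 0 \<le> (u1 x + r1 * u0 x) * \<Phi> x"
        using data by eventually_elim (use \<Phi>(2) in \<open>simp add: r1_def less_imp_le\<close>)
    qed
    finally show ?thesis .
  qed
  define d where "d = ((1 + (\<mu> - 1 + sqrt \<delta>) / 2) * \<alpha> 1 - \<alpha>1 1) * I0"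
  have d: "d > 0" using a(6) I0 by (simp add: d_def)
  \<comment> \<open>Subtracting \<alpha>(1) times the nonnegative combination I1 + r1 I0 leaves the
    coefficient (\<mu> - r1) \<alpha>(1) - \<alpha>'(1) of I0, positive by the choice of the time
    factor.\<close>
  have dle: "d \<le> \<alpha> 1 * I1 + (\<mu> * \<alpha> 1 - \<alpha>1 1) * I0"
  proof -
    have "\<alpha> 1 * I1 + (\<mu> * \<alpha> 1 - \<alpha>1 1) * I0 = \<alpha> 1 * (I1 + r1 * I0) + d"
    proof -
      have "\<mu> - r1 = 1 + (\<mu> - 1 + sqrt \<delta>) / 2" unfolding r1_def by (simp add: field_simps)
      then have "d = ((\<mu> - r1) * \<alpha> 1 - \<alpha>1 1) * I0" by (simp add: d_def)
      then show ?thesis by (simp add: algebra_simps)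
    qed
    moreover have "0 \<le> \<alpha> 1 * (I1 + r1 * I0)" using a(5)[of 1] I1 by simp
    ultimately show ?thesis by linarith
  qed
  define m where "m = n - 1 - b * q"
  define B where "B = 2 powr \<bar>e + l\<bar> + 2 powr \<bar>e\<bar>"
  have B: "B > 0" "2 powr \<bar>e + l\<bar> \<le> B" "2 powr \<bar>e\<bar> \<le> B" by (auto simp: B_def intro: add_pos_pos)
  define K1 where "K1 = Cg * ((3 + 2 * \<mu>) * (Cl * B))"
  have K1: "K1 > 0" using g(7) \<mu> a(7) B by (simp add: K1_def add_pos_nonneg)
  define G where "G = min 1 (1 / (l + 1)) powr m + (1 + R + 1 / (l + 1)) powr m"
  have G: "G \<ge> 0" by (simp add: G_def)
  define K2 where "K2 = CP powr q * (CI * (G * 2 powr \<bar>(l + 1) * m\<bar>) * exp (q * (R - phi_speed l 1)))"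
  have K2: "K2 \<ge> 0" using CI G by (simp add: K2_def)
  define m2 where "m2 = (e + l - 1) * q + (l + 1) * m"
  define Mc where "Mc = K1 powr q * K2"
  have Mc: "Mc \<ge> 0" using K2 by (simp add: Mc_def)
  define N where "N = 1 - 2 * q + (l + 1) * n"
  \<comment> \<open>With Young's parameter \<tau>^X the two terms have orders X + N and 1 + X (1 -
    q) + m2; this X makes them equal.\<close>
  define X where "X = (1 + m2 - N) / q"
  define C where "C = (CA + Mc) / d"
  have C: "C > 0" using CA Mc d by (simp add: C_def add_pos_nonneg)
  \<comment> \<open>Multiplying by p (p - 1) and replacing q (p - 1) by p turns the balanced
    exponent into a polynomial in p, which is - \<open>theta\<close>.\<close>
  have expo: "X + N = - (theta CARD('n) l \<mu> p / (p * (p - 1)))"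
  proof -
    have p0: "p > 0" "p - 1 > 0" "p \<noteq> 0" "p - 1 \<noteq> 0" using p by auto
    have qp: "q * (p - 1) = p" using p0 by (simp add: p(2))
    have Xp: "X * p = (1 + m2 - N) * (p - 1)" using p0 by (simp add: X_def p(2))
    have "m2 * (p - 1) = (e + l - 1) * (q * (p - 1)) + (l + 1) * ((n - 1) * (p - 1) - b * (q * (p - 1)))"
      by (simp add: m2_def m_def algebra_simps)
    then have m2p: "m2 * (p - 1) = (e + l - 1) * p + (l + 1) * ((n - 1) * (p - 1) - b * p)" unfolding qp .
    have "N * (p - 1) = (p - 1) - 2 * (q * (p - 1)) + (l + 1) * n * (p - 1)"
      by (simp add: N_def algebra_simps)
    then have Np: "N * (p - 1) = (p - 1) - 2 * p + (l + 1) * n * (p - 1)" unfolding qp .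
    have "(X + N) * (p * (p - 1)) = (X * p) * (p - 1) + N * (p - 1) * p" by (simp add: algebra_simps)
    also have "\<dots> = (p - 1) * ((p - 1) + m2 * (p - 1)) + N * (p - 1)" unfolding Xp by (simp add: algebra_simps)
    also have "\<dots> = - theta CARD('n) l \<mu> p"
      unfolding m2p Np by (simp add: theta_def n_def[symmetric] b_def e_def field_simps power2_eq_square)
    finally have "(X + N) * (p * (p - 1)) = - theta CARD('n) l \<mu> p" .
    then show ?thesis using p0 by (simp add: field_simps)
  qed
  have main: "\<epsilon> \<le> C * \<tau> powr (X + N)"
    if sol: "weak_solution l \<mu> \<nu> p R u0 u1 \<epsilon> T u" and \<epsilon>: "0 < \<epsilon>" and \<tau>: "2 \<le> \<tau>" "ereal \<tau> < T"
      and Ahb: "(LINT s:{\<tau>/2..\<tau>}|lebesgue. h (s / \<tau>) ^ k * (LINT x|lebesgue. \<bar>u s x\<bar> powr p)) \<le> CA * \<tau> powr N" for \<epsilon> T u \<tau>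
  proof -
    have t0: "\<tau> > 0" using \<tau> by simp
    define Q where "Q = \<tau> powr (e + l - 1)"
    have Q: "\<tau> powr (e + l) = \<tau> * Q" "Q > 0" using t0 by (auto simp: Q_def powr_diff)
    \<comment> \<open>Since l > -1, the undifferentiated time factor satisfies the same scaling
      bound as its derivative, which is the larger contribution to the cutoff error.\<close>
    have Qe: "\<tau> powr e \<le> \<tau>\<^sup>2 * Q"
    proof -
      have "\<tau> powr e \<le> \<tau> powr (2 + (e + l - 1))" using \<tau> l by (intro powr_mono) auto
      also have "\<dots> = \<tau>\<^sup>2 * Q" using t0 by (simp only: powr_add Q_def powr_numeral)
      finally show ?thesis .
    qed
    have D: "cutoff_error Cg \<mu> \<tau> \<alpha> \<alpha>1 s \<le> K1 * Q * exp (- phi_speed l s)" if s: "s \<in> {\<tau>/2..\<tau>}" for s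
    proof -
      have s1: "s \<ge> 1" "s > 0" using s \<tau> by auto
      define Z where "Z = Cl * B * Q * exp (- phi_speed l s)"
      have "s powr e \<le> B * \<tau> powr e"
        by (rule order_trans[OF powr_half_bounds(1)[OF t0 s] mult_right_mono[OF B(3)]]) simp
      also have "\<dots> \<le> B * (\<tau>\<^sup>2 * Q)" using Qe B by (intro mult_left_mono) auto
      finally have se: "s powr e \<le> B * (\<tau>\<^sup>2 * Q)" .
      have "s powr (e + l) \<le> B * \<tau> powr (e + l)"
        by (rule order_trans[OF powr_half_bounds(1)[OF t0 s] mult_right_mono[OF B(2)]]) simp
      then have sel: "s powr (e + l) \<le> B * (\<tau> * Q)" unfolding Q .
      have "\<bar>\<alpha> s\<bar> \<le> Cl * s powr e * exp (- phi_speed l s)" using a(5)[OF s1(2)] a(8)[OF s1(1)] by (simp add: e_def)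
      also have "\<dots> \<le> Cl * (B * (\<tau>\<^sup>2 * Q)) * exp (- phi_speed l s)" using se a(7) by (intro mult_right_mono mult_left_mono) auto
      finally have b1: "\<bar>\<alpha> s\<bar> \<le> \<tau>\<^sup>2 * Z" by (simp add: Z_def mult_ac)
      have "\<bar>\<alpha>1 s\<bar> \<le> Cl * s powr (e + l) * exp (- phi_speed l s)" using a(9)[OF s1(1)] by (simp add: e_def)
      also have "\<dots> \<le> Cl * (B * (\<tau> * Q)) * exp (- phi_speed l s)" using sel a(7) by (intro mult_right_mono mult_left_mono) auto
      finally have b2: "\<bar>\<alpha>1 s\<bar> \<le> \<tau> * Z" by (simp add: Z_def mult_ac)
      from cutoff_error_le[where C = Cg and \<alpha> = \<alpha> and ?\<alpha>1.0 = \<alpha>1, OF g(7) \<mu> t0 s b1 b2] show ?thesis by (simp add: K1_def Z_def mult.assoc)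
    qed
    have V: "(LINT x:ball (0 :: real ^ 'n) (R + phi_speed l s - phi_speed l 1)|lebesgue. \<Phi> x powr q)
        \<le> K2 * \<tau> powr ((l + 1) * m) * exp (q * phi_speed l s)" if s: "s \<in> {\<tau>/2..\<tau>}" for s
    proof -
      have s1: "s \<ge> 1" "s > 0" using s \<tau> by auto
      define \<rho> where "\<rho> = R + phi_speed l s - phi_speed l 1"
      have \<rho>0: "0 \<le> \<rho>" unfolding \<rho>_def by (rule cone_radius_bounds(1)[OF l R s1(1)])
      have int: "set_integrable lebesgue (ball (0 :: real ^ 'n) \<rho>) f" if "continuous_on UNIV f" for f :: "real ^ 'n \<Rightarrow> real"
      proof (rule set_integrable_subset[where A = "cball 0 \<rho>"])
        have "integrable lborel (\<lambda>x. indicator (cball 0 \<rho>) x *\<^sub>R f x)"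
          by (rule borel_integrable_compact[OF compact_cball continuous_on_subset[OF that]]) simp
        then show "set_integrable lebesgue (cball 0 \<rho>) f" unfolding set_integrable_def by (simp add: integrable_completion)
      qed auto
      have "(LINT x:ball (0 :: real ^ 'n) \<rho>|lebesgue. \<Phi> x powr q)
        \<le> (LINT x:ball (0 :: real ^ 'n) \<rho>|lebesgue. CP powr q * ((1 + norm x) powr (- (b * q)) * exp (q * norm x)))"
      proof (rule set_integral_mono)
        show "set_integrable lebesgue (ball 0 \<rho>) (\<lambda>x. \<Phi> x powr q)"
          by (intro int continuous_on_powr'[OF smooth_on_imp_continuous_on[OF \<Phi>(1)] continuous_on_const]) (use \<Phi>(2) less_imp_le bq in auto)
        have "1 + norm x \<noteq> 0" for x :: "real ^ 'n" using norm_ge_zero[of x] by linarith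
        then show "set_integrable lebesgue (ball 0 \<rho>) (\<lambda>x :: real ^ 'n. CP powr q * ((1 + norm x) powr (- (b * q)) * exp (q * norm x)))"
          by (intro int continuous_intros) auto
        show "\<Phi> x powr q \<le> CP powr q * ((1 + norm x) powr (- (b * q)) * exp (q * norm x))" for x
        proof -
          have "\<Phi> x powr q \<le> (CP * (1 + norm x) powr (- b) * exp (norm x)) powr q"
            using CP(2)[of x] \<Phi>(2)[of x] bq by (intro powr_mono2) auto
          also have "\<dots> = CP powr q * ((1 + norm x) powr (- (b * q)) * exp (q * norm x))"
            using CP(1) by (simp add: powr_mult powr_powr exp_powr_real mult_ac)
          finally show ?thesis .
        qed
      qed
      also have "\<dots> = CP powr q * (LINT x:ball (0 :: real ^ 'n) \<rho>|lebesgue. (1 + norm x) powr (- (b * q)) * exp (q * norm x))"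
        by simp
      also have "\<dots> \<le> CP powr q * (CI * (1 + \<rho>) powr m * exp (q * \<rho>))"
        using CI(2)[OF \<rho>0] by (intro mult_left_mono) (auto simp: m_def)
      also have "\<dots> \<le> CP powr q * (CI * (G * (2 powr \<bar>(l + 1) * m\<bar> * \<tau> powr ((l + 1) * m))) * exp (q * \<rho>))"
      proof -
        \<comment> \<open>The sign of m = n - 1 - b q depends on p, so both bounds on the radius are
          needed.\<close>
        have "(1 + \<rho>) powr m \<le> G * (s powr (l + 1)) powr m"
          unfolding G_def \<rho>_def using l s1 by (intro powr_comparable cone_radius_bounds(3,4)[OF l R s1(1)]) auto
        also have "\<dots> = G * s powr ((l + 1) * m)" by (simp add: powr_powr)
        also have "\<dots> \<le> G * (2 powr \<bar>(l + 1) * m\<bar> * \<tau> powr ((l + 1) * m))"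
          using G by (intro mult_left_mono powr_half_bounds(1)[OF t0 s])
        finally show ?thesis using CI(1) by (intro mult_left_mono mult_right_mono) auto
      qed
      also have "\<dots> = K2 * \<tau> powr ((l + 1) * m) * exp (q * phi_speed l s)"
      proof -
        have "exp (q * \<rho>) = exp (q * (R - phi_speed l 1)) * exp (q * phi_speed l s)"
          unfolding \<rho>_def by (simp add: algebra_simps flip: exp_add)
        then show ?thesis unfolding K2_def by (simp only: mult_ac)
      qed
      finally show ?thesis by (simp only: \<rho>_def)
    qed
    define Mx where "Mx = Mc * \<tau> powr m2"
    have Mx: "(cutoff_error Cg \<mu> \<tau> \<alpha> \<alpha>1 s) powr q
      * (LINT x:ball (0 :: real ^ 'n) (R + phi_speed l s - phi_speed l 1)|lebesgue. \<Phi> x powr q) \<le> Mx" if s: "s \<in> {\<tau>/2..\<tau>}" for s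
    proof -
      have s1: "s > 0" using s \<tau> by auto
      have "0 \<le> cutoff_error Cg \<mu> \<tau> \<alpha> \<alpha>1 s"
        using g(7) t0 s1 \<mu> by (intro cutoff_error_nonneg) auto
      moreover have "0 \<le> (LINT x:ball (0 :: real ^ 'n) (R + phi_speed l s - phi_speed l 1)|lebesgue. \<Phi> x powr q)"
        unfolding set_lebesgue_integral_def by (intro integral_nonneg_AE) auto
      ultimately have "(cutoff_error Cg \<mu> \<tau> \<alpha> \<alpha>1 s) powr q
        * (LINT x:ball (0 :: real ^ 'n) (R + phi_speed l s - phi_speed l 1)|lebesgue. \<Phi> x powr q)
        \<le> (K1 * Q * exp (- phi_speed l s)) powr q * (K2 * \<tau> powr ((l + 1) * m) * exp (q * phi_speed l s))"
        using D[OF s] V[OF s] bq by (intro powr_mult_mono) linarith+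
      \<comment> \<open>Here the decay in time meets the factor exp(q \<open>phi_speed l s\<close>)
        from the ball and cancels it.\<close>
      also have "(K1 * Q * exp (- phi_speed l s)) powr q = K1 powr q * \<tau> powr ((e + l - 1) * q) * exp (- (q * phi_speed l s))"
        using K1 by (simp add: Q_def powr_mult powr_powr exp_powr_real mult_ac)
      also have "K1 powr q * \<tau> powr ((e + l - 1) * q) * exp (- (q * phi_speed l s)) * (K2 * \<tau> powr ((l + 1) * m) * exp (q * phi_speed l s))
        = Mc * (\<tau> powr ((e + l - 1) * q) * \<tau> powr ((l + 1) * m)) * (exp (- (q * phi_speed l s)) * exp (q * phi_speed l s))"
        unfolding Mc_def by (simp only: mult_ac)
      also have "\<dots> = Mx" by (simp add: Mx_def m2_def powr_add flip: exp_add)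
      finally show ?thesis .
    qed
    define x0 where "x0 = \<tau> powr X"
    have x0: "x0 > 0" using t0 by (simp add: x0_def)
    define Ah where "Ah = (LINT s:{\<tau>/2..\<tau>}|lebesgue. h (s / \<tau>) ^ k * (LINT x|lebesgue. \<bar>u s x\<bar> powr p))"
    have key: "\<epsilon> * (\<alpha> 1 * I1 + (\<mu> * \<alpha> 1 - \<alpha>1 1) * I0) \<le> x0 * Ah + \<tau> * (x0 powr (1 - q) * Mx)"
      unfolding I0_def I1_def Ah_def
      by (rule weak_solution_adjoint_test(1)[where \<kappa> = 1 and \<Phi> = \<Phi> and h = h and ?\<alpha>1.0 = \<alpha>1 and ?\<alpha>2.0 = \<alpha>2 and ?g1.0 = g1 and ?g2.0 = g2 and Cg = Cg and \<nu> = \<nu> and T = T,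
          OF sol l R \<mu> p k u0 u1 \<tau> cut \<Phi>(1) less_imp_le[OF \<Phi>(2)] \<Phi>(3) a(1)])
        (use a Mx x0 in \<open>auto intro: less_imp_le\<close>)
    have "\<epsilon> * d \<le> x0 * Ah + \<tau> * (x0 powr (1 - q) * Mx)"
      using key mult_left_mono[OF dle, of \<epsilon>] \<epsilon> by linarith
    also have "\<dots> \<le> x0 * (CA * \<tau> powr N) + \<tau> * (x0 powr (1 - q) * Mx)"
      using Ahb x0 by (simp add: Ah_def)
    also have "x0 * (CA * \<tau> powr N) = CA * \<tau> powr (X + N)" by (simp add: x0_def powr_add)
    also have "\<tau> * (x0 powr (1 - q) * Mx) = Mc * \<tau> powr (X + N)"
    proof -
      have "\<tau> * (x0 powr (1 - q) * Mx) = Mc * (\<tau> powr 1 * \<tau> powr (X * (1 - q)) * \<tau> powr m2)"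
        using t0 by (simp add: x0_def Mx_def powr_powr mult_ac)
      also have "\<tau> powr 1 * \<tau> powr (X * (1 - q)) * \<tau> powr m2 = \<tau> powr (1 + X * (1 - q) + m2)" by (simp only: powr_add)
      also have "1 + X * (1 - q) + m2 = X + N"
      proof -
        have "X * q = 1 + m2 - N" using bq by (simp add: X_def)
        then show ?thesis by (simp add: algebra_simps)
      qed
      finally show ?thesis .
    qed
    finally have "\<epsilon> * d \<le> (CA + Mc) * \<tau> powr (X + N)" by (simp add: distrib_right)
    then show ?thesis using d by (simp add: C_def field_simps)
  qed
  show ?thesis by (rule that[OF C]) (use main in \<open>simp add: N_def n_def flip: expo\<close>)
qed

section \<open>Combination of the two estimates\<close>

theorem theorem1p2:
  fixes l \<mu> \<nu> \<delta> p R :: real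
    and u0 u1 :: "real ^ 'n \<Rightarrow> real"
  assumes "l > -1" and "\<mu> \<ge> 0" and "\<nu>\<^sup>2 \<ge> 0"
    and "\<delta> = (\<mu> - 1)\<^sup>2 - 4 * \<nu>\<^sup>2" and "\<delta> \<ge> 0"
    and "1 < p"
    and "ereal p < max (ereal (pStr (real CARD('n) + \<mu> / (l + 1)) l))
                       (pFuj ((l + 1) * real CARD('n) + (\<mu> - 1) / 2 - sqrt \<delta> / 2))"
    and "R > 0"
    and "L1_loc u0" and "L1_loc u1"
    and "AE x in lebesgue. u0 x \<ge> 0" and "AE x in lebesgue. u1 x \<ge> 0"
    and "\<not> (AE x in lebesgue. u0 x = 0)" and "\<not> (AE x in lebesgue. u1 x = 0)"
    and "compact (ess_support u0)" and "compact (ess_support u1)"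
    and "ess_support u0 \<subseteq> ball 0 R" and "ess_support u1 \<subseteq> ball 0 R"
    and "AE x in lebesgue. u1 x + (\<mu> - 1 - sqrt \<delta>) / 2 * u0 x \<ge> 0"
  shows "\<exists>\<epsilon>0 > 0.
     (\<forall>\<epsilon>\<in>{0<..\<epsilon>0}. \<forall>T u. weak_solution l \<mu> \<nu> p R u0 u1 \<epsilon> T u \<longrightarrow> T < \<infinity>) \<and>
     (\<exists>C > 0. \<forall>\<epsilon>\<in>{0<..\<epsilon>0}. \<forall>T u. weak_solution l \<mu> \<nu> p R u0 u1 \<epsilon> T u \<longrightarrow>
        (p < pStr (real CARD('n) + \<mu> / (l + 1)) l \<longrightarrow>
           T \<le> ereal (C * \<epsilon> powr (- (p * (p - 1) / theta CARD('n) l \<mu> p)))) \<and>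
        (ereal p < pFuj ((l + 1) * real CARD('n) + (\<mu> - 1) / 2 - sqrt \<delta> / 2) \<longrightarrow>
           T \<le> ereal (C * \<epsilon> powr
             (- (1 / (2 / (p - 1) - ((l + 1) * real CARD('n) + (\<mu> - 1) / 2 - sqrt \<delta> / 2)))))))"
proof -
  define q where "q = p / (p - 1)"
  have q: "q > 1" by (rule conjugate_exponent[OF assms(6) q_def])
  \<comment> \<open>The power and the step are fixed before both estimates, because the weighted
    integral bounded by one must be the very integral used by the other.\<close>
  obtain k :: nat where k: "real k \<ge> 2 * q" using real_arch_simple by blast
  then have k2: "k \<ge> 2" using q by linarith
  obtain h g1 g2 Cg where cut: "is_cutoff k h g1 g2 Cg"
    using cutoff_exists[OF k2] by blast
  define kF where "kF = (l + 1) * real CARD('n) + (\<mu> - 1) / 2 - sqrt \<delta> / 2"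
  define xF where "xF = 2 / (p - 1) - kF"
  note common = assms(1,2,4,5,6) q_def assms(8) k assms(9,17,10,18,11,13,19) cut
  obtain C1 where C1: "C1 > 0" "\<And>\<epsilon> T u \<tau>. \<lbrakk>weak_solution l \<mu> \<nu> p R u0 u1 \<epsilon> T u; 0 < \<epsilon>; 2 \<le> \<tau>; ereal \<tau> < T\<rbrakk> \<Longrightarrow>
      \<epsilon> \<le> C1 * \<tau> powr (2 + (\<mu> - 1 - sqrt \<delta>) / 2 - 2 * q + (l + 1) * real CARD('n)) \<and>
      (LINT s:{\<tau>/2..\<tau>}|lebesgue. h (s / \<tau>) ^ k * (LINT x|lebesgue. \<bar>u s x\<bar> powr p))
        \<le> C1 * \<tau> powr (1 - 2 * q + (l + 1) * real CARD('n))"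
    by (rule fujita_estimate[OF common], (assumption | rule that)+)
  obtain C2 where C2: "C2 > 0" "\<And>\<epsilon> T u \<tau>. \<lbrakk>weak_solution l \<mu> \<nu> p R u0 u1 \<epsilon> T u; 0 < \<epsilon>; 2 \<le> \<tau>; ereal \<tau> < T;
      (LINT s:{\<tau>/2..\<tau>}|lebesgue. h (s / \<tau>) ^ k * (LINT x|lebesgue. \<bar>u s x\<bar> powr p))
        \<le> C1 * \<tau> powr (1 - 2 * q + (l + 1) * real CARD('n))\<rbrakk> \<Longrightarrow>
      \<epsilon> \<le> C2 * \<tau> powr (- (theta CARD('n) l \<mu> p / (p * (p - 1))))"
    by (rule strauss_estimate[OF common C1(1)], (assumption | rule that)+)
  define th where "th = theta CARD('n) l \<mu> p"
  note C2 = C2[folded th_def]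
  \<comment> \<open>Uses 2 q = 2 + 2 / (p - 1).\<close>
  have exF: "2 + (\<mu> - 1 - sqrt \<delta>) / 2 - 2 * q + (l + 1) * real CARD('n) = - xF"
    using assms(6) by (simp add: xF_def kF_def q_def field_simps)
  define B1 where "B1 = max 2 (C1 powr (1 / xF))"
  define B2 where "B2 = max 2 (C2 powr (1 / (th / (p * (p - 1)))))"
  have F: "T \<le> ereal (B1 * \<epsilon> powr (- (1 / xF)))"
    if sol: "weak_solution l \<mu> \<nu> p R u0 u1 \<epsilon> T u" "0 < \<epsilon>" "\<epsilon> \<le> 1" and pF: "ereal p < pFuj kF" for \<epsilon> T u
    unfolding B1_def
  proof (rule lifespan_from_decay[OF _ C1(1) sol(2,3)])
    show "xF > 0"
    proof (cases "kF > 0")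
      case True
      then have "p < 1 + 2 / kF" using pF by (simp add: pFuj_def)
      then have "(p - 1) * kF < 2" using True by (simp add: field_simps)
      then show ?thesis using assms(6) by (simp add: xF_def field_simps)
    next
      \<comment> \<open>The convention \<open>pFuj\<close> = \<infinity> for nonpositive argument:
        xF is then positive whatever p > 1 is.\<close>
      case False
      have "2 / (p - 1) > 0" using assms(6) by simp
      then show ?thesis using False unfolding xF_def by linarith
    qed
    show "\<epsilon> \<le> C1 * \<tau> powr (- xF)" if "2 \<le> \<tau>" "ereal \<tau> < T" for \<tau>
      using C1(2)[OF sol(1,2) that] unfolding exF by simp
  qed
  have S: "T \<le> ereal (B2 * \<epsilon> powr (- (p * (p - 1) / th)))"
    if sol: "weak_solution l \<mu> \<nu> p R u0 u1 \<epsilon> T u" "0 < \<epsilon>" "\<epsilon> \<le> 1"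
      and pS: "p < pStr (real CARD('n) + \<mu> / (l + 1)) l" for \<epsilon> T u
  proof -
    have th: "th > 0" unfolding th_def
      by (rule theta_pos[OF assms(1,2) _ assms(6) pS]) (simp add: Suc_leI)
    have "T \<le> ereal (B2 * \<epsilon> powr (- (1 / (th / (p * (p - 1))))))" unfolding B2_def
    proof (rule lifespan_from_decay[OF _ C2(1) sol(2,3)])
      show "th / (p * (p - 1)) > 0" using th assms(6) by simp
      show "\<epsilon> \<le> C2 * \<tau> powr (- (th / (p * (p - 1))))" if "2 \<le> \<tau>" "ereal \<tau> < T" for \<tau>
        \<comment> \<open>The bound on the integral in \<open>C1\<close> holds for every p > 1, so
          it is at hand below the Strauss exponent.\<close>
        using C2(2)[OF sol(1,2) that] C1(2)[OF sol(1,2) that] by blast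
    qed
    then show ?thesis by simp
  qed
  define C where "C = max B1 B2"
  have C: "B1 * y \<le> C * y" "B2 * y \<le> C * y" if "y \<ge> 0" for y
    using that by (auto simp: C_def intro: mult_right_mono)
  have F': "T \<le> ereal (C * \<epsilon> powr (- (1 / xF)))"
    if "weak_solution l \<mu> \<nu> p R u0 u1 \<epsilon> T u" "0 < \<epsilon>" "\<epsilon> \<le> 1" "ereal p < pFuj kF" for \<epsilon> T u
    by (rule order_trans[OF F[OF that]]) (simp add: C)
  have S': "T \<le> ereal (C * \<epsilon> powr (- (p * (p - 1) / th)))"
    if "weak_solution l \<mu> \<nu> p R u0 u1 \<epsilon> T u" "0 < \<epsilon>" "\<epsilon> \<le> 1" "p < pStr (real CARD('n) + \<mu> / (l + 1)) l" for \<epsilon> T u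
    by (rule order_trans[OF S[OF that]]) (simp add: C)
  have fin: "T < \<infinity>" if sol: "weak_solution l \<mu> \<nu> p R u0 u1 \<epsilon> T u" "0 < \<epsilon>" "\<epsilon> \<le> 1" for \<epsilon> T u
  proof (cases "p < pStr (real CARD('n) + \<mu> / (l + 1)) l")
    case True
    show ?thesis by (rule le_less_trans[OF S[OF sol True]]) simp
  next
    case False
    \<comment> \<open>Below the maximum but not below the Strauss exponent, p must lie below the
      Fujita exponent.\<close>
    then have "ereal p < pFuj kF" using assms(7) by (auto simp: kF_def max_def split: if_splits)
    then show ?thesis by (rule le_less_trans[OF F[OF sol]]) simp
  qed
  have "C > 0" by (simp add: C_def B1_def)
  then show ?thesis
    unfolding kF_def[symmetric] xF_def[symmetric] th_def[symmetric]
    using fin F' S' by (intro exI[of _ 1] conjI exI[of _ C]) auto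
qed

end
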